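(* Let $n\ge3$. Adjoin $(K_{i,0}^\pm)^{1/2}$ to the Heisenberg algebra $\mathcal{H}_n$ and to $\mathcal{K}_n$, and define $\tilde K_i^\pm(z)$ by $\tilde K_i^\pm(z)\tilde K_i^\pm(qz)=K_i^\pm(z)$. Let $\mathbb{F}^{B}$ be an irreducible representation of $\mathcal{H}_n$ on which $C$ acts as $q^{1/2}$. Then with the action $$E_i(z)\mapsto k\,\tilde K_i^-(z)\tilde K_i^+(qz),\qquad K_i^\pm(z)\mapsto K_i^\pm(z),\qquad C\mapsto q^{1/2}\qquad(i\in\mathbb{Z}/n\mathbb{Z}),$$ where $k=1/(q^{1/2}-q^{-1/2})$, $\mathbb{F}^{B}$ is an admissible $\mathcal{K}_n$ module.
   Context: **Parameters.** Fix $q^{1/2},d^{1/2}\in\mathbb{C}^\times$, $q_1=q^{-1}d$, $q_2=q^2$, $q_3=q^{-1}d^{-1}$, and assume that $q_1^iq_2^j=1$ ($i,j\in\mathbb{Z}$) implies $i=j=0$. Let $n\ge3$; indices $i,j\in\mathbb{Z}/n\mathbb{Z}$. $\delta(z)=\sum_{k\in\mathbb{Z}}z^k$, $[A,B]_p=AB-pBA$, $\mathrm{Sym}$ is symmetrization (average over permutations of the variables). Put $g_{i,i}(z,w)=z-q^2w$, $g_{i,i\pm1}(z,w)=z-q^{-1}d^{\pm1}w$, $g_{i,j}(z,w)=z-w$ otherwise; $G_{i,i}(x)=q^2\frac{1-q^{-2}x}{1-q^2x}$, $G_{i,i\pm1}(x)=q^{-1}\frac{1-qd^{\pm1}x}{1-q^{-1}d^{\pm1}x}$,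 $G_{i,j}(x)=1$ otherwise (power series in $x$); $d_{i,j}=d^{\pm1}$ if $i\equiv j\pm1$, $d_{i,j}=1$ otherwise. **Algebra $\mathcal{K}_n$.** Generated by an invertible central $C$ and the coefficients of $E_i(z)=\sum_kE_{i,k}z^{-k}$, $K_i^\pm(z)=K_{i,0}^\pm\exp\big(\pm(q-q^{-1})\sum_{\pm r>0}H_{i,r}z^{-r}\big)$, with relations (1) $K_i^\pm(z)K_j^\pm(w)=K_j^\pm(w)K_i^\pm(z)$; $K_i^+(z)K_j^-(w)=K_j^-(w)K_i^+(z)G_{i,j}(w/z)G_{i,j}(C^2w/z)$; (2) $K_i^+(z)E_j(w)=E_j(w)K_i^+(z)G_{i,j}(w/z)$; $E_j(w)K_i^-(z)=K_i^-(z)E_j(w)G_{j,i}(z/w)$; (3) $d_{i,j}g_{i,j}(z,w)E_i(z)E_j(w)+g_{j,i}(w,z)E_j(w)E_i(z)=\frac{\delta_{i,j}}{q-q^{-1}}\big(g_{i,i}(z,w)\delta(C^2z/w)K_i^-(z)K_i^+(C^2z)+g_{i,i}(w,z)\delta(C^2w/z)K_i^-(w)K_i^+(C^2w)\big)$; (4) $E_i(z)E_j(w)=E_j(w)E_i(z)$ for $i\not\equiv j,j\pm1$; (5) $\mathrm{Sym}_{z_1,z_2}[E_i(z_1),[E_i(z_2),E_{i\pm1}(w)]_q]_{q^{-1}}=-\mathrm{Sym}_{z_1,z_2}\Big\{\Big(\frac{1}{1-q^{-1}d^{\mp1}z_1/w}+\frac{q^{-1}d^{\pm1}w/z_2}{1-q^{-1}d^{\pm1}w/z_2}\Big)\delta(C^2z_1/z_2)K_i^-(z_1)E_{i\pm1}(w)K_i^+(z_2)\Big\}$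 (expansion in non-negative powers of $z_1/w$, $w/z_2$ respectively). Grading: $\deg E_{i,k}=k$, $\deg H_{i,r}=r$, $\deg K^\pm_{i,0}=\deg C=0$; $\mathcal{K}_n$ is the graded quotient by these relations of the free algebra on the generators completed in the positive direction. **Heisenberg algebra.** $\mathcal{H}_n\subset\mathcal{K}_n$ is the subalgebra generated by $H_{i,r}$ ($i\in\mathbb{Z}/n\mathbb{Z}$, $r\ne0$), $K_{i,0}^\pm$, $C^{\pm1}$. When $C=q^{1/2}$ one has $\tilde K_i^+(z)\tilde K_j^-(w)=\tilde K_j^-(w)\tilde K_i^+(z)\tilde G_{i,j}(w/z)$, where $\tilde G_{i,i}(x)=q\frac{1-q^{-1}x}{1-x}\frac{1-qx}{1-q^2x}$, $\tilde G_{i,i\pm1}(x)=q^{-1/2}\frac{1-qd^{\pm1}x}{1-d^{\pm1}x}$, and $\tilde G_{i,j}(x)=1$ otherwise. **Admissible module.** A $\mathcal{K}_n$ module $V$ is admissible if $C$ is diagonalizable on it and $V$ is $\mathbb{Z}$-graded with finite-dimensional components of degree bounded from above: $V=\oplus_{k=-\infty}^{N}V_k$, $\dim V_k<\infty$.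
   Formalization: Admissible's "dim V_k finite" is impossible, as K_{i,0}^+ and K_{i,0}^- q^4-commute; it becomes "V_k is a finite sum of irreducibles over the zero modes". K_{i,0}^± are invertible, and each vector of F^B is killed by monomials of large degree, so that the E_i(z) are defined. *)

theory Defs
  imports
    Complex_Main
    "HOL-Computational_Algebra.Formal_Power_Series"
    "HOL-Computational_Algebra.Fundamental_Theorem_Algebra"
    "HOL-Library.Groups_Big_Fun"
    "Berlekamp_Zassenhaus.Finite_Field"
begin

text \<open>
  Indices live in \<open>'n mod_ring\<close>, the ring of integers modulo \<open>n = CARD('n)\<close>.
  The parameters \<open>qh\<close>, \<open>dh\<close> are the chosen square roots of \<open>q\<close>, \<open>d\<close>.
\<close>

section \<open>Parameters and structure functions\<close>

definition generic_parameters :: "complex \<Rightarrow> complex \<Rightarrow> bool" where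
  "generic_parameters qh dh \<longleftrightarrow> qh \<noteq> 0 \<and> dh \<noteq> 0 \<and>
     (let q = qh^2; d = dh^2; q1 = inverse q * d; q2 = q^2 in
       \<forall>i j :: int. q1 powi i * q2 powi j = 1 \<longrightarrow> i = 0 \<and> j = 0)"

text \<open>The polynomials are \<open>g_{i,j}(z,w) = z - g_root q d i j * w\<close>.\<close>

definition g_root :: "complex \<Rightarrow> complex \<Rightarrow> 'n::nontriv mod_ring \<Rightarrow> 'n mod_ring \<Rightarrow> complex" where
  "g_root q d i j =
     (if j = i then q^2
      else if j = i + 1 then inverse q * d
      else if j = i - 1 then inverse q * inverse d
      else 1)"

definition G_series ::
  "complex \<Rightarrow> complex \<Rightarrow> 'n::nontriv mod_ring \<Rightarrow> 'n mod_ring \<Rightarrow> complex fps" where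
  "G_series q d i j =
     (let frac = (\<lambda>c a b. fps_const c * (1 - fps_const a * fps_X) * inverse (1 - fps_const b * fps_X)) in
      if j = i then frac (q^2) (inverse (q^2)) (q^2)
      else if j = i + 1 then frac (inverse q) (q * d) (inverse q * d)
      else if j = i - 1 then frac (inverse q) (q * inverse d) (inverse q * inverse d)
      else 1)"

definition d_coeff :: "complex \<Rightarrow> 'n::nontriv mod_ring \<Rightarrow> 'n mod_ring \<Rightarrow> complex" where
  "d_coeff d i j = (if i = j + 1 then d else if i = j - 1 then inverse d else 1)"

text \<open>
  Commutation factor of the adjoined roots \<open>(K_{i,0}\<^sup>+)^{1/2}\<close> and \<open>(K_{j,0}\<^sup>-)^{1/2}\<close>: the constant
  term of the series written \<open>G_{i,j}\<close> with a tilde.  Its square is the constant term of \<open>G_{i,j}\<close>.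
\<close>

definition root_factor :: "complex \<Rightarrow> 'n::nontriv mod_ring \<Rightarrow> 'n mod_ring \<Rightarrow> complex" where
  "root_factor qh i j =
     (if j = i then qh^2 else if j = i + 1 \<or> j = i - 1 then inverse qh else 1)"

section \<open>Series of operators\<close>

text \<open>
  \<open>op_pow X m a\<close> and \<open>op_exp scale X a\<close> are the coefficients of \<open>x^a\<close> in
  \<open>(\<Sum>r\<ge>1. X r x^r)^m\<close> and in \<open>exp (\<Sum>r\<ge>1. X r x^r)\<close>.
\<close>

fun op_pow :: "(nat \<Rightarrow> 'v \<Rightarrow> 'v) \<Rightarrow> nat \<Rightarrow> nat \<Rightarrow> 'v \<Rightarrow> 'v::ab_group_add" where
  "op_pow X 0 a v = (if a = 0 then v else 0)"
| "op_pow X (Suc m) a v = (\<Sum>r = 1..a. X r (op_pow X m (a - r) v))"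

definition op_exp ::
  "(complex \<Rightarrow> 'v \<Rightarrow> 'v) \<Rightarrow> (nat \<Rightarrow> 'v \<Rightarrow> 'v) \<Rightarrow> nat \<Rightarrow> 'v \<Rightarrow> 'v::ab_group_add" where
  "op_exp scale X a v = (\<Sum>m\<le>a. scale (1 / fact m) (op_pow X m a v))"

definition op_powi :: "('v \<Rightarrow> 'v) \<Rightarrow> int \<Rightarrow> 'v \<Rightarrow> 'v" where
  "op_powi f k = (if k \<ge> 0 then f ^^ nat k else (inv_into UNIV f) ^^ nat (- k))"

text \<open>
  A set of generators is given by pairs (degree, operator).  \<open>continuous_action\<close> says that a
  free algebra on graded generators, completed in the positive direction, acts: for every vector,
  all monomials of sufficiently large degree vanish on it.  All infinite sums of operators below
  (\<^const>\<open>Sum_any\<close>) are then pointwise finite.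
\<close>

definition continuous_action :: "(int \<times> ('v \<Rightarrow> 'v::zero)) set \<Rightarrow> bool" where
  "continuous_action gens \<longleftrightarrow>
     (\<forall>v. \<exists>N. \<forall>xs \<in> lists gens. sum_list (map fst xs) \<ge> N \<longrightarrow> foldr (\<lambda>x. snd x) xs v = 0)"

context vector_space
begin

definition irreducible_on :: "('b \<Rightarrow> 'b) set \<Rightarrow> 'b set \<Rightarrow> bool" where
  "irreducible_on ops S \<longleftrightarrow>
     subspace S \<and> S \<noteq> {0} \<and> (\<forall>f \<in> ops. f ` S \<subseteq> S) \<and>
     (\<forall>T. subspace T \<and> T \<subseteq> S \<and> (\<forall>f \<in> ops. f ` T \<subseteq> T) \<longrightarrow> T = {0} \<or> T = S)"

definition is_grading :: "(int \<Rightarrow> 'b set) \<Rightarrow> bool" where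
  "is_grading V \<longleftrightarrow> (\<forall>k. subspace (V k)) \<and>
     (\<forall>v. \<exists>!c. (\<forall>k. c k \<in> V k) \<and> finite {k. c k \<noteq> 0} \<and> v = Sum_any c)"

definition diagonalizable :: "('b \<Rightarrow> 'b) \<Rightarrow> bool" where
  "diagonalizable f \<longleftrightarrow> span {v. \<exists>c. f v = scale c v} = UNIV"

end

section \<open>The Heisenberg algebra\<close>

text \<open>
  \<open>K0p i\<close>, \<open>K0m i\<close> are \<open>K_{i,0}\<^sup>+\<close>, \<open>K_{i,0}\<^sup>-\<close>, and \<open>Rp i\<close>, \<open>Rm i\<close> their adjoined square roots;
  \<open>H i r\<close> is \<open>H_{i,r}\<close> (the value at \<open>r = 0\<close> is never used).
\<close>

locale heisenberg_data = vector_space scale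
  for scale :: "complex \<Rightarrow> 'v::ab_group_add \<Rightarrow> 'v" (infixr \<open>*s\<close> 75) +
  fixes qh dh :: complex
    and C :: "'v \<Rightarrow> 'v"
    and K0p K0m Rp Rm :: "'n::nontriv mod_ring \<Rightarrow> 'v \<Rightarrow> 'v"
    and H :: "'n mod_ring \<Rightarrow> int \<Rightarrow> 'v \<Rightarrow> 'v"
begin

abbreviation q :: complex where "q \<equiv> qh^2"
abbreviation d :: complex where "d \<equiv> dh^2"

text \<open>\<open>Kp i a\<close> is the coefficient of \<open>z^{-a}\<close> in \<open>K_i\<^sup>+(z)\<close>; \<open>Km i b\<close> that of \<open>z^b\<close> in \<open>K_i\<^sup>-(z)\<close>.\<close>

definition Kp :: "'n mod_ring \<Rightarrow> nat \<Rightarrow> 'v \<Rightarrow> 'v" where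
  "Kp i a v = K0p i (op_exp scale (\<lambda>r u. (q - inverse q) *s H i (int r) u) a v)"

definition Km :: "'n mod_ring \<Rightarrow> nat \<Rightarrow> 'v \<Rightarrow> 'v" where
  "Km i b v = K0m i (op_exp scale (\<lambda>r u. (- (q - inverse q)) *s H i (- int r) u) b v)"

definition zero_mode_ops :: "('v \<Rightarrow> 'v) set" where
  "zero_mode_ops = {C, inv_into UNIV C} \<union>
     (\<Union>i. {K0p i, inv_into UNIV (K0p i), K0m i, inv_into UNIV (K0m i), Rp i, inv_into UNIV (Rp i), Rm i, inv_into UNIV (Rm i)})"

definition H_gens :: "(int \<times> ('v \<Rightarrow> 'v)) set" where
  "H_gens = {(0, f) | f. f \<in> zero_mode_ops} \<union> {(r, H i r) | i r. r \<noteq> 0}"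

end

text \<open>
  Representations of the Heisenberg algebra with the square roots adjoined.  The inner sum in
  \<open>Kp_Km\<close> is the coefficient of \<open>x^l\<close> in \<open>G_{i,j}(x) G_{i,j}(C\<^sup>2x)\<close>, where \<open>x = w/z\<close>.
\<close>

locale heisenberg_module = heisenberg_data +
  assumes linear_C: "Vector_Spaces.linear scale scale C"
    and linear_K0: "\<And>i. Vector_Spaces.linear scale scale (K0p i)"
                   "\<And>i. Vector_Spaces.linear scale scale (K0m i)"
    and linear_R: "\<And>i. Vector_Spaces.linear scale scale (Rp i)"
                  "\<And>i. Vector_Spaces.linear scale scale (Rm i)"
    and linear_H: "\<And>i r. r \<noteq> 0 \<Longrightarrow> Vector_Spaces.linear scale scale (H i r)"
    and invertible: "bij C" "\<And>i. bij (K0p i)" "\<And>i. bij (K0m i)" "\<And>i. bij (Rp i)" "\<And>i. bij (Rm i)"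
    and continuous_H: "continuous_action H_gens"
    and C_central: "\<And>f r v. (r, f) \<in> H_gens \<Longrightarrow> C (f v) = f (C v)"
    and Kp_Kp: "\<And>i j a b v. Kp i a (Kp j b v) = Kp j b (Kp i a v)"
    and Km_Km: "\<And>i j a b v. Km i a (Km j b v) = Km j b (Km i a v)"
    and Kp_Km: "\<And>i j a b v. Kp i a (Km j b v) =
      (\<Sum>l\<le>min a b. \<Sum>m\<le>l.
         (fps_nth (G_series q d i j) (l - m) * fps_nth (G_series q d i j) m) *s
           (C ^^ (2 * m)) (Km j (b - l) (Kp i (a - l) v)))"
    and R_square: "\<And>i v. Rp i (Rp i v) = K0p i v" "\<And>i v. Rm i (Rm i v) = K0m i v"
    and R_R: "\<And>i j v. Rp i (Rp j v) = Rp j (Rp i v)" "\<And>i j v. Rm i (Rm j v) = Rm j (Rm i v)"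
    and Rp_Rm: "\<And>i j v. Rp i (Rm j v) = root_factor qh i j *s Rm j (Rp i v)"
    and R_H: "\<And>i j r v. r \<noteq> 0 \<Longrightarrow> Rp i (H j r v) = H j r (Rp i v)"
             "\<And>i j r v. r \<noteq> 0 \<Longrightarrow> Rm i (H j r v) = H j r (Rm i v)"

definition (in heisenberg_data) irreducible_H_module :: bool where
  "irreducible_H_module \<longleftrightarrow> irreducible_on (snd ` H_gens) UNIV"

section \<open>The algebra \<open>K_n\<close>\<close>

text \<open>\<open>E i k\<close> is \<open>E_{i,k}\<close>, the coefficient of \<open>z^{-k}\<close> in \<open>E_i(z)\<close>.\<close>

locale K_data = heisenberg_data scale qh dh C K0p K0m Rp Rm H
  for scale :: "complex \<Rightarrow> 'v::ab_group_add \<Rightarrow> 'v" (infixr \<open>*s\<close> 75)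
    and qh dh C K0p K0m Rp Rm and H :: "'n::nontriv mod_ring \<Rightarrow> int \<Rightarrow> 'v \<Rightarrow> 'v" +
  fixes E :: "'n mod_ring \<Rightarrow> int \<Rightarrow> 'v \<Rightarrow> 'v"
begin

definition K_gens :: "(int \<times> ('v \<Rightarrow> 'v)) set" where
  "K_gens = H_gens \<union> {(k, E i k) | i k. True}"

text \<open>\<open>delta_KK i a b\<close>: coefficient of \<open>z^{-a} w^{-b}\<close> in \<open>\<delta>(C\<^sup>2z/w) K_i\<^sup>-(z) K_i\<^sup>+(C\<^sup>2z)\<close>.\<close>

definition delta_KK :: "'n mod_ring \<Rightarrow> int \<Rightarrow> int \<Rightarrow> 'v \<Rightarrow> 'v" where
  "delta_KK i a b v = Sum_any (\<lambda>(k :: int, p :: nat, c :: nat).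
     if k + int p - int c = - a \<and> - k = - b
     then op_powi C (2 * k) (Km i p (op_powi C (- 2 * int c) (Kp i c v))) else 0)"

text \<open>\<open>EEE i j a b m\<close>: coefficient of \<open>z_1^{-a} z_2^{-b} w^{-m}\<close> in
  \<open>[E_i(z_1), [E_i(z_2), E_j(w)]_q]_{q^{-1}}\<close>.\<close>

definition bracket :: "complex \<Rightarrow> ('v \<Rightarrow> 'v) \<Rightarrow> ('v \<Rightarrow> 'v) \<Rightarrow> 'v \<Rightarrow> 'v" where
  "bracket p A B v = A (B v) - p *s B (A v)"

definition EEE :: "'n mod_ring \<Rightarrow> 'n mod_ring \<Rightarrow> int \<Rightarrow> int \<Rightarrow> int \<Rightarrow> 'v \<Rightarrow> 'v" where
  "EEE i j a b m = bracket (inverse q) (E i a) (bracket q (E i b) (E j m))"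

text \<open>\<open>delta_KEK \<epsilon> i j a b m\<close>: coefficient of \<open>z_1^{-a} z_2^{-b} w^{-m}\<close> in
  \<open>(1/(1 - q^{-1}\<epsilon>^{-1}z_1/w) + (q^{-1}\<epsilon>w/z_2)/(1 - q^{-1}\<epsilon>w/z_2)) \<delta>(C\<^sup>2z_1/z_2) K_i\<^sup>-(z_1) E_j(w) K_i\<^sup>+(z_2)\<close>.
  The index \<open>l\<close> comes from the geometric series, \<open>k\<close> from the delta function.\<close>

definition delta_KEK ::
  "complex \<Rightarrow> 'n mod_ring \<Rightarrow> 'n mod_ring \<Rightarrow> int \<Rightarrow> int \<Rightarrow> int \<Rightarrow> 'v \<Rightarrow> 'v" where
  "delta_KEK \<epsilon> i j a b m v =
     Sum_any (\<lambda>(l :: nat, k :: int, p :: nat, c :: nat).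
       if int l + k + int p = - a \<and> - k - int c = - b
       then (inverse q * inverse \<epsilon>) ^ l *s op_powi C (2 * k) (Km i p (E j (m - int l) (Kp i c v))) else 0)
   + Sum_any (\<lambda>(l :: nat, k :: int, p :: nat, c :: nat).
       if l \<ge> 1 \<and> k + int p = - a \<and> - int l - k - int c = - b
       then (inverse q * \<epsilon>) ^ l *s op_powi C (2 * k) (Km i p (E j (m + int l) (Kp i c v))) else 0)"

end

text \<open>
  Modules over \<open>K_n\<close> with the square roots of \<open>K_{i,0}\<^sup>\<plusminus>\<close> adjoined; every relation between
  currents is the family of identities of its coefficients.
\<close>

locale K_module = K_data + heisenberg_module +
  assumes linear_E: "\<And>i k. Vector_Spaces.linear scale scale (E i k)"
    and continuous_K: "continuous_action K_gens"
    and C_E: "\<And>i k v. C (E i k v) = E i k (C v)"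
    and Kp_E: "\<And>i j a m v. Kp i a (E j m v) =
      (\<Sum>l\<le>a. fps_nth (G_series q d i j) l *s E j (m + int l) (Kp i (a - l) v))"
    and E_Km: "\<And>i j b m v. E j m (Km i b v) =
      (\<Sum>l\<le>b. fps_nth (G_series q d j i) l *s Km i (b - l) (E j (m - int l) v))"
    and Rp_E: "\<And>i j m v. Rp i (E j m v) = root_factor qh i j *s E j m (Rp i v)"
    and E_Rm: "\<And>i j m v. E j m (Rm i v) = root_factor qh j i *s Rm i (E j m v)"
    and E_E: "\<And>i j a b v.
      d_coeff d i j *s (E i (a + 1) (E j b v) - g_root q d i j *s E i a (E j (b + 1) v))
      + (E j (b + 1) (E i a v) - g_root q d j i *s E j b (E i (a + 1) v)) =
      (if i = j then inverse (q - inverse q) *s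
         ((delta_KK i (a + 1) b v - g_root q d i i *s delta_KK i a (b + 1) v)
          + (delta_KK i (b + 1) a v - g_root q d i i *s delta_KK i b (a + 1) v))
       else 0)"
    and E_E_distant: "\<And>i j a b v. i \<noteq> j \<Longrightarrow> i \<noteq> j + 1 \<Longrightarrow> i \<noteq> j - 1 \<Longrightarrow>
      E i a (E j b v) = E j b (E i a v)"
    and Serre: "\<And>i j \<epsilon> a b m v. (j, \<epsilon>) \<in> {(i + 1, d), (i - 1, inverse d)} \<Longrightarrow>
      (1/2) *s (EEE i j a b m v + EEE i j b a m v) =
      - ((1/2) *s (delta_KEK \<epsilon> i j a b m v + delta_KEK \<epsilon> i j b a m v))"

section \<open>Admissible modules\<close>

text \<open>
  The relations force \<open>K_{i,0}\<^sup>+ K_{i,0}\<^sup>- = q^4 K_{i,0}\<^sup>- K_{i,0}\<^sup>+\<close> with both factors invertible of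
  degree \<open>0\<close>.  Hence no nonzero graded component can be finite-dimensional in the naive sense
  (\<open>no_finite_dim_component\<close> below), and finiteness of a component can only be meant relative to
  the zero modes: it is a sum of finitely many irreducible modules over the algebra generated by
  them, i.e. it has finite multiplicities.  (If the zero modes acted by scalars, this would be
  finite-dimensionality.)
\<close>

lemma (in vector_space) sequence_relation:
  fixes x :: "nat \<Rightarrow> 'b"
  assumes fin: "finite B" and sub: "range x \<subseteq> span B"
  shows "\<exists>c. (\<exists>j\<le>card B. c j \<noteq> 0) \<and> (\<Sum>j\<le>card B. scale (c j) (x j)) = 0"
proof (cases "inj_on x {..card B}")
  case True
  have "dependent (x ` {..card B})"
  proof (rule ccontr)
    assume "\<not> dependent (x ` {..card B})"
    then have "card (x ` {..card B}) \<le> card B"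
      using independent_span_bound[OF fin] sub by blast
    then show False
      by (simp add: card_image True)
  qed
  then obtain u where u: "(\<Sum>v\<in>x ` {..card B}. scale (u v) v) = 0" "\<exists>v\<in>x ` {..card B}. u v \<noteq> 0"
    using dependent_finite[of "x ` {..card B}"] by auto
  show ?thesis
  proof (rule exI[of _ "u \<circ> x"], rule conjI)
    show "\<exists>j\<le>card B. (u \<circ> x) j \<noteq> 0" using u(2) by auto
    show "(\<Sum>j\<le>card B. scale ((u \<circ> x) j) (x j)) = 0"
      using u(1) by (simp add: sum.reindex[OF True] o_def)
  qed
next
  case False
  then obtain k l where kl: "k \<le> card B" "l \<le> card B" "k \<noteq> l" "x k = x l"
    by (auto simp: inj_on_def)
  define c :: "nat \<Rightarrow> 'a" where "c = (\<lambda>j. if j = k then 1 else if j = l then -1 else 0)"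
  have "(\<Sum>j\<le>card B. scale (c j) (x j)) = (\<Sum>j\<in>{k,l}. scale (c j) (x j))"
    by (rule sum.mono_neutral_right) (use kl in \<open>auto simp: c_def\<close>)
  also have "\<dots> = 0" using kl by (simp add: c_def)
  finally have "(\<Sum>j\<le>card B. scale (c j) (x j)) = 0" .
  moreover have "c k \<noteq> 0" by (simp add: c_def)
  ultimately show ?thesis using kl(1) by blast
qed

lemma eigenvector_of_relation:
  fixes scale' :: "complex \<Rightarrow> 'c::ab_group_add \<Rightarrow> 'c"
  assumes vs: "vector_space scale'" and lin: "Vector_Spaces.linear scale' scale' A"
    and W: "module.subspace scale' W" "A ` W \<subseteq> W"
    and rel: "Polynomial.degree p \<le> n" "p \<noteq> 0" "(\<Sum>j\<le>n. scale' (poly.coeff p j) ((A ^^ j) u)) = 0" "u \<in> W" "u \<noteq> 0"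
  shows "\<exists>v\<in>W. \<exists>l. v \<noteq> 0 \<and> A v = scale' l v"
  using rel
proof (induction n arbitrary: p)
  case 0
  interpret V: vector_space scale' by (fact vs)
  have "poly.coeff p 0 \<noteq> 0"
    using 0 leading_coeff_0_iff[of p] by simp
  with 0 show ?case by simp
next
  case (Suc n)
  interpret V: vector_space scale' by (fact vs)
  interpret A: Vector_Spaces.linear scale' scale' A by (fact lin)
  show ?case
  proof (cases "Polynomial.degree p = 0")
    case True
    then have "poly.coeff p 0 \<noteq> 0" using Suc.prems leading_coeff_0_iff[of p] by simp
    have "(\<Sum>j\<le>Suc n. scale' (poly.coeff p j) ((A ^^ j) u)) = (\<Sum>j\<in>{0}. scale' (poly.coeff p j) ((A ^^ j) u))"
      by (rule sum.mono_neutral_right) (use True in \<open>auto simp: coeff_eq_0\<close>)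
    with \<open>poly.coeff p 0 \<noteq> 0\<close> Suc.prems show ?thesis by simp
  next
    case False
    then obtain a where "poly p a = 0"
      using fundamental_theorem_of_algebra[of p] by (auto simp: constant_degree)
    then obtain r where r: "p = [:-a, 1:] * r" unfolding poly_eq_0_iff_dvd dvd_def by blast
    have r0: "r \<noteq> 0" using r Suc.prems by auto
    have dr: "Polynomial.degree r \<le> n" using Suc.prems(1) degree_mult_eq[of "[:-a, 1:]" r] r0
      by (simp only: r) simp
    define w where "w = (\<Sum>j\<le>n. scale' (poly.coeff r j) ((A ^^ j) u))"
    have Aj: "(A ^^ j) u \<in> W" for j
      by (induction j) (use W Suc.prems in auto)
    have wW: "w \<in> W" unfolding w_def
      by (intro V.subspace_sum V.subspace_scale W Aj)
    have cf: "poly.coeff p (Suc j) = poly.coeff r j - a * poly.coeff r (Suc j)" "poly.coeff p 0 = - a * poly.coeff r 0" for j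
      by (simp_all add: r coeff_pCons)
    have "0 = (\<Sum>j\<le>Suc n. scale' (poly.coeff p j) ((A ^^ j) u))" using Suc.prems by simp
    also have "\<dots> = scale' (poly.coeff p 0) u + (\<Sum>j\<le>n. scale' (poly.coeff p (Suc j)) ((A ^^ Suc j) u))"
      by (subst sum.atMost_Suc_shift) simp
    also have "\<dots> = (\<Sum>j\<le>n. scale' (poly.coeff r j) ((A ^^ Suc j) u))
       - (scale' (a * poly.coeff r 0) u + (\<Sum>j\<le>n. scale' (a * poly.coeff r (Suc j)) ((A ^^ Suc j) u)))"
      by (simp add: cf V.scale_left_diff_distrib sum_subtractf)
    also have "scale' (a * poly.coeff r 0) u + (\<Sum>j\<le>n. scale' (a * poly.coeff r (Suc j)) ((A ^^ Suc j) u))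
       = (\<Sum>j\<le>Suc n. scale' (a * poly.coeff r j) ((A ^^ j) u))"
      by (subst sum.atMost_Suc_shift) simp
    also have "\<dots> = scale' a w"
      using dr by (simp add: w_def V.scale_sum_right coeff_eq_0)
    also have "(\<Sum>j\<le>n. scale' (poly.coeff r j) ((A ^^ Suc j) u)) = A w"
      by (simp add: w_def A.sum A.scale)
    finally have "A w = scale' a w" by simp
    moreover have ?thesis if "w = 0"
      using Suc.IH[OF dr r0] that Suc.prems by (simp add: w_def)
    ultimately show ?thesis using wW by blast
  qed
qed

lemma (in heisenberg_module) no_finite_dim_component:
  assumes gen: "generic_parameters qh dh"
    and W: "subspace W" "K0p i ` W \<subseteq> W" "K0m i ` W \<subseteq> W"
    and fin: "finite B" "W \<subseteq> span B"
  shows "W = {0}"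
proof (rule ccontr)
  assume "W \<noteq> {0}"
  then obtain u where u: "u \<in> W" "u \<noteq> 0" using subspace_0[OF W(1)] by blast
  interpret A: Vector_Spaces.linear scale scale "K0p i" by (rule linear_K0)
  interpret B: Vector_Spaces.linear scale scale "K0m i" by (rule linear_K0)
  have inW: "(f ^^ k) v \<in> W" if "f ` W \<subseteq> W" "v \<in> W" for f :: "'a \<Rightarrow> 'a" and k v
    by (induction k) (use that in auto)
  have "range (\<lambda>j. (K0p i ^^ j) u) \<subseteq> span B" using inW[OF W(2) u(1)] fin(2) by auto
  from sequence_relation[OF fin(1) this] obtain c j where
    c: "j \<le> card B" "c j \<noteq> 0" "(\<Sum>j\<le>card B. c j *s (K0p i ^^ j) u) = 0" by auto
  define p where "p = (\<Sum>j\<le>card B. Polynomial.monom (c j) j)"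
  have cp: "poly.coeff p k = (if k \<le> card B then c k else 0)" for k
    by (auto simp: p_def coeff_sum sum.delta)
  have "Polynomial.degree p \<le> card B" by (rule degree_le) (simp add: cp)
  moreover have "p \<noteq> 0" using c cp[of j] by auto
  moreover have "(\<Sum>j\<le>card B. poly.coeff p j *s (K0p i ^^ j) u) = 0" using c(3) by (simp add: cp)
  ultimately obtain v l where v: "v \<in> W" "v \<noteq> 0" "K0p i v = l *s v"
    using eigenvector_of_relation[OF vector_space_axioms linear_K0(1) W(1,2)] u by blast
  have inj: "K0p i x = 0 \<longleftrightarrow> x = 0" "K0m i x = 0 \<longleftrightarrow> x = 0" for x
    using inj_eq[OF bij_is_inj[OF invertible(2)[of i]], of x 0]
      inj_eq[OF bij_is_inj[OF invertible(3)[of i]], of x 0] by (simp_all add: A.zero B.zero)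
  have l: "l \<noteq> 0" using v inj(1)[of v] by auto
  have comm: "K0p i (K0m i x) = q^4 *s K0m i (K0p i x)" for x
  proof -
    have "Kp i 0 y = K0p i y" "Km i 0 y = K0m i y" for y
      by (simp_all add: Kp_def Km_def op_exp_def)
    moreover have "fps_nth (G_series q d i i) 0 * fps_nth (G_series q d i i) 0 = q^4"
      by (simp add: G_series_def power_add[symmetric] flip: power_mult)
    ultimately show ?thesis
      using Kp_Km[of i 0 i 0 x] by simp
  qed
  define y where "y = (\<lambda>k. (K0m i ^^ k) v)"
  have y0: "y k \<noteq> 0" for k by (induction k) (simp_all add: y_def v(2) inj(2))
  have yA: "K0p i (y k) = (l * q^(4*k)) *s y k" for k
  proof (induction k)
    case (Suc k)
    then show ?case
      by (simp add: y_def comm B.scale power_add power_mult mult_ac)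
  qed (simp add: y_def v)
  have qh: "qh \<noteq> 0" using gen by (simp add: generic_parameters_def)
  have root: "q^(4*m) \<noteq> 1" if "m > 0" for m :: nat
  proof
    assume "q^(4*m) = 1"
    then have "(inverse q * d) powi 0 * (q^2) powi (int (2*m)) = 1"
      by (simp only: power_int_of_nat) (simp add: power_mult[symmetric])
    then have "int (2*m) = 0"
      using gen unfolding generic_parameters_def Let_def by blast
    with that show False by simp
  qed
  have distinct: "q^(4*k) \<noteq> q^(4*n)" if "k < n" for k n :: nat
  proof
    assume "q^(4*k) = q^(4*n)"
    also have "4*n = 4*k + 4*(n-k)" using that by simp
    finally have "q^(4*(n-k)) = 1" using qh by (simp only: power_add) simp
    then show False using root[of "n-k"] that by simp
  qed
  have indep: "\<forall>k<n. c k = 0" if "(\<Sum>k<n. c k *s y k) = 0" for n and c :: "nat \<Rightarrow> complex"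
    using that
  proof (induction n arbitrary: c)
    case (Suc n)
    let ?S = "\<Sum>k<Suc n. c k *s y k"
    have "0 = K0p i ?S - (l * q^(4*n)) *s ?S" using Suc.prems A.zero by simp
    also have "\<dots> = (\<Sum>k<Suc n. (c k * (l * q^(4*k) - l * q^(4*n))) *s y k)"
      by (simp only: A.sum A.scale yA scale_sum_right sum_subtractf[symmetric] scale_scale
            scale_left_diff_distrib[symmetric]) (simp add: algebra_simps)
    also have "\<dots> = (\<Sum>k<n. (c k * (l * q^(4*k) - l * q^(4*n))) *s y k)" by simp
    finally have "\<forall>k<n. c k * (l * q^(4*k) - l * q^(4*n)) = 0"
      using Suc.IH[of "\<lambda>k. c k * (l * q^(4*k) - l * q^(4*n))"] by simp
    then have "\<forall>k<n. c k = 0" using distinct l by auto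
    moreover from this have "c n = 0" using Suc.prems y0 by simp
    ultimately show ?case by (simp add: less_Suc_eq)
  qed simp
  have "range y \<subseteq> span B" using inW[OF W(3) v(1)] fin(2) by (auto simp: y_def)
  from sequence_relation[OF fin(1) this] obtain c j where
    "j \<le> card B" "c j \<noteq> 0" "(\<Sum>j\<le>card B. c j *s y j) = 0" by auto
  with indep[of c "Suc (card B)"] show False by (simp add: lessThan_Suc_atMost)
qed

definition (in heisenberg_data) finite_over_zero_modes :: "'v set \<Rightarrow> bool" where
  "finite_over_zero_modes U \<longleftrightarrow>
     (\<exists>\<S>. finite \<S> \<and> (\<forall>S \<in> \<S>. irreducible_on zero_mode_ops S) \<and> U = span (\<Union>\<S>))"

locale admissible_K_module = K_module +
  assumes C_diagonalizable: "diagonalizable C"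
    and graded: "\<exists>V N. is_grading V
      \<and> (\<forall>(r, f) \<in> K_gens. \<forall>k. f ` V k \<subseteq> V (k + r))
      \<and> (\<forall>k > N. V k = {0})
      \<and> (\<forall>k. finite_over_zero_modes (V k))"

section \<open>The boundary action\<close>

text \<open>
  \<open>is_tilde s R K Kt\<close>: \<open>Kt\<close> are the coefficients of the current \<open>Kt(x)\<close> with
  \<open>Kt(x) Kt(s x) = K(x)\<close> and leading coefficient \<open>R\<close>.  Here \<open>x = z^{-1}\<close>, \<open>s = q^{-1}\<close> for the
  positive currents and \<open>x = z\<close>, \<open>s = q\<close> for the negative ones.  Since \<open>Kt(x)\<close> is formed in the
  commutative algebra generated by \<open>R\<close> and the \<open>H_{i,r}\<close> of one sign, its coefficients commute
  with \<open>R\<close>; this makes it unique.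
\<close>

definition is_tilde ::
  "(complex \<Rightarrow> 'v \<Rightarrow> 'v) \<Rightarrow> complex \<Rightarrow> ('v \<Rightarrow> 'v) \<Rightarrow> (nat \<Rightarrow> 'v \<Rightarrow> 'v) \<Rightarrow>
   (nat \<Rightarrow> 'v \<Rightarrow> 'v::ab_group_add) \<Rightarrow> bool" where
  "is_tilde scale s R K Kt \<longleftrightarrow>
     (\<forall>v. Kt 0 v = R v) \<and>
     (\<forall>a v. Kt a (R v) = R (Kt a v)) \<and>
     (\<forall>a v. (\<Sum>b\<le>a. scale (s ^ (a - b)) (Kt b (Kt (a - b) v))) = K a v)"

text \<open>\<open>boundary_E\<close>: coefficient of \<open>z^{-m}\<close> in \<open>k Kt_i\<^sup>-(z) Kt_i\<^sup>+(qz)\<close>, \<open>k = 1/(q^{1/2} - q^{-1/2})\<close>.\<close>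

definition boundary_E ::
  "(complex \<Rightarrow> 'v \<Rightarrow> 'v) \<Rightarrow> complex \<Rightarrow> ('i \<Rightarrow> nat \<Rightarrow> 'v \<Rightarrow> 'v) \<Rightarrow> ('i \<Rightarrow> nat \<Rightarrow> 'v \<Rightarrow> 'v) \<Rightarrow>
   'i \<Rightarrow> int \<Rightarrow> 'v \<Rightarrow> 'v::ab_group_add" where
  "boundary_E scale qh Ktp Ktm i m v =
     scale (1 / (qh - inverse qh))
       (Sum_any (\<lambda>(a :: nat, b :: nat).
          if int a - int b = m then scale (inverse (qh^2) ^ a) (Ktm i b (Ktp i a v)) else 0))"

end

theory Submission
  imports Defs "HOL-Analysis.Cartesian_Space"
begin

text \<open>
  The boundary current is a product of two vertex operators: put \<open>M\<^sub>i(z)\<close> for the root of \<open>K\<^sub>i\<^sup>-(z)\<close>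
  and \<open>P\<^sub>i(z)\<close> for the root of \<open>K\<^sub>i\<^sup>+\<close> at the argument \<open>q z\<close>, so that \<open>E\<^sub>i(z) = k M\<^sub>i(z) P\<^sub>i(z)\<close>.  Both
  are exponentials of linear combinations of Heisenberg generators of one sign, times a square root
  of a zero mode.  At \<open>C = q\<^sup>1\<^sup>/\<^sup>2\<close> the commutator of \<open>H\<^bsub>i,r\<^esub>\<close> and \<open>H\<^bsub>j,-r\<^esub>\<close> is a scalar, hence every
  exchange of two such exponentials only produces a scalar series (\<open>exchange_rescaled\<close>, \<open>P_M\<close>, \<open>KP_M\<close>,
  \<open>P_KM\<close>).  The exchange of \<open>K\<^sub>i\<^sup>\<plusminus>\<close> with \<open>E\<^sub>j\<close> comes out at once, because \<open>P\<^sub>j\<close> commutes with \<open>K\<^sub>i\<^sup>+\<close> and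
  \<open>M\<^sub>j\<close> with \<open>K\<^sub>i\<^sup>-\<close>.

  For the relations between the \<open>E\<^sub>i\<close>, every product is rewritten in normally ordered form, all \<open>M\<close> to
  the left of all \<open>P\<close>.  A normally ordered product is symmetric in its factors, so the quadratic and
  the Serre relation become identities between the scalar coefficients (\<open>EE_EE\<close>, \<open>EE_EE_EE\<close>).  For
  \<open>i \<noteq> j\<close> the polynomials \<open>g\<close> cancel the pole of the exchange series.  For \<open>i = j\<close>, and in the Serre
  relation, the two expansions of one rational function differ by delta functions supported at
  \<open>q z = w\<close> (\<open>quadratic_delta\<close>, \<open>cubic_delta\<close>); on this locus the normally ordered product of two currents
  \<open>E\<^sub>i\<close> collapses to \<open>K\<^sub>i\<^sup>-\<close> on the left and \<open>K\<^sub>i\<^sup>+\<close> on the right (\<open>ins_ins_diagonal\<close>), because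
  \<open>M\<^sub>i(z) M\<^sub>i(q z) = K\<^sub>i\<^sup>-(z)\<close>.  This is where the right hand sides come from.

  Admissibility rests on a degree operator.  Since the parameters are generic, the matrix of the
  commutators \<open>[H\<^bsub>i,r\<^esub>, H\<^bsub>j,-r\<^esub>]\<close> is invertible (\<open>hc_kernel\<close>), and its inverse gives an Euler operator,
  quadratic in the Heisenberg generators, whose commutator with a generator is a multiple of it by
  its degree.  The components of the grading are its eigenspaces.  Continuity of the action
  produces vacuum vectors and forbids positive degrees; irreducibility then forces the eigenspaces to
  span, and makes the vacuum space irreducible over the zero modes (\<open>irreducible_vacuum\<close>).  A component
  of negative degree is a sum of finitely many images of components of higher degree under the
  operators \<open>H\<^bsub>j,-r\<^esub>\<close>, which commute with the zero modes (\<open>comp_negative\<close>, \<open>finite_comp\<close>).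
\<close>

unbundle no vec_syntax
no_notation vector_scalar_mult (infixl \<open>*s\<close> 70)
unbundle fps_syntax

section \<open>The ring of additive endomorphisms\<close>

text \<open>
  The class of rings requires \<open>0 \<noteq> 1\<close>, which fails for the endomorphisms of the trivial group.  The
  integer component is a second factor of the ring that is present only in that case.
\<close>

typedef (overloaded) 'v endo =
  "{(f :: 'v::ab_group_add \<Rightarrow> 'v, b :: int).
     (\<forall>x y. f (x + y) = f x + f y) \<and> ((\<exists>x::'v. x \<noteq> 0) \<longrightarrow> b = 0)}"
  by (rule exI[of _ "(\<lambda>x. 0, 0)"]) simp

setup_lifting type_definition_endo

lift_definition endo_apply :: "'v::ab_group_add endo \<Rightarrow> 'v \<Rightarrow> 'v" is fst .

instantiation endo :: (ab_group_add) ring_1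
begin

lift_definition zero_endo :: "'a endo" is "(\<lambda>x. 0, 0)" by simp
lift_definition one_endo :: "'a endo" is
  "(\<lambda>x. x, if \<exists>x::'a. x \<noteq> 0 then 0 else 1)" by simp
lift_definition plus_endo :: "'a endo \<Rightarrow> 'a endo \<Rightarrow> 'a endo" is
  "\<lambda>p r. (\<lambda>x. fst p x + fst r x, snd p + snd r)" by (auto simp: algebra_simps)
lift_definition uminus_endo :: "'a endo \<Rightarrow> 'a endo" is
  "\<lambda>p. (\<lambda>x. - fst p x, - snd p)" by auto
lift_definition minus_endo :: "'a endo \<Rightarrow> 'a endo \<Rightarrow> 'a endo" is
  "\<lambda>p r. (\<lambda>x. fst p x - fst r x, snd p - snd r)" by (auto simp: algebra_simps)
lift_definition times_endo :: "'a endo \<Rightarrow> 'a endo \<Rightarrow> 'a endo" is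
  "\<lambda>p r. (\<lambda>x. fst p (fst r x), snd p * snd r)" by auto

instance
proof
  fix a b c :: "'a endo"
  show "a * b * c = a * (b * c)" by transfer simp
  show "1 * a = a"
    by transfer (auto split: if_splits)
  show "a * 1 = a"
    by transfer (auto split: if_splits)
  show "(0::'a endo) \<noteq> 1"
  proof (cases "\<exists>x::'a. x \<noteq> 0")
    case True
    then show ?thesis by transfer (auto simp: fun_eq_iff)
  next
    case False
    then show ?thesis by transfer simp
  qed
  show "(a + b) * c = a * c + b * c" by transfer (auto simp: distrib_right)
  show "a * (b + c) = a * b + a * c" by transfer (auto simp: distrib_left)
  show "a + b + c = a + (b + c)" by transfer (simp add: add.assoc)
  show "a + b = b + a" by transfer (simp add: add.commute)
  show "0 + a = a" by transfer simp
  show "- a + a = 0" by transfer simp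
  show "a - b = a + - b" by transfer simp
qed

end

lemma endo_apply_simps [simp]:
  "endo_apply 0 v = 0" "endo_apply 1 v = v"
  "endo_apply (a + b) v = endo_apply a v + endo_apply b v"
  "endo_apply (a - b) v = endo_apply a v - endo_apply b v"
  "endo_apply (- a) v = - endo_apply a v"
  "endo_apply (a * b) v = endo_apply a (endo_apply b v)"
  by (transfer; simp)+

lemma endo_apply_sum [simp]: "endo_apply (sum f A) v = (\<Sum>x\<in>A. endo_apply (f x) v)"
  by (induction A rule: infinite_finite_induct) auto

lemma endo_eqI:
  fixes a b :: "'v::ab_group_add endo"
  assumes "\<exists>x::'v. x \<noteq> 0" and "\<And>v. endo_apply a v = endo_apply b v"
  shows "a = b"
  using assms by transfer (auto simp: fun_eq_iff)

text \<open>
  A function that is not additive is sent to zero.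
\<close>

lift_definition endo_of :: "('v::ab_group_add \<Rightarrow> 'v) \<Rightarrow> 'v endo" is
  "\<lambda>f. (if \<forall>x y. f (x + y) = f x + f y then f else (\<lambda>x. 0), 0)" by simp

lemma endo_apply_endo_of [simp]:
  "(\<And>x y. f (x + y) = f x + f y) \<Longrightarrow> endo_apply (endo_of f) = f"
  by transfer simp

section \<open>Exponentials of noncommutative power series\<close>

text \<open>
  Uniqueness of solutions of differential equations needs cancellation of positive integers, also
  for series whose coefficients are themselves series.
\<close>

definition torsion_free :: "'a::ring_1 itself \<Rightarrow> bool" where
  "torsion_free _ \<longleftrightarrow> (\<forall>n (x::'a). of_nat (Suc n) * x = 0 \<longrightarrow> x = 0)"

lemma torsion_freeD: "torsion_free TYPE('a::ring_1) \<Longrightarrow> of_nat (Suc n) * (x::'a) = 0 \<Longrightarrow> x = 0"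
  unfolding torsion_free_def by blast

lemma fps_of_nat_mult_nth: "(of_nat k * f) $ n = of_nat k * (f :: 'a::ring_1 fps) $ n"
  by (metis fps_mult_left_const_nth fps_of_nat)

lemma torsion_free_fps: "torsion_free TYPE('a::ring_1) \<Longrightarrow> torsion_free TYPE('a fps)"
  unfolding torsion_free_def fps_eq_iff fps_of_nat_mult_nth by (auto simp del: of_nat_Suc)

lemma fps_mult_unit_right_eq_0:
  fixes Z U :: "'a::ring_1 fps"
  assumes U: "U $ 0 = 1" and ZU: "Z * U = 0"
  shows "Z = 0"
proof (rule fps_ext)
  fix n show "Z $ n = 0 $ n"
  proof (induction n rule: less_induct)
    case (less n)
    have "0 = (Z * U) $ n" by (simp add: ZU)
    also have "\<dots> = (\<Sum>i\<in>{n}. Z $ i * U $ (n - i))"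
      unfolding fps_mult_nth by (rule sum.mono_neutral_right) (use less in auto)
    finally show ?case by (simp add: U)
  qed
qed

text \<open>
  The coefficient of \<open>x^n\<close> in \<open>Z D\<close> only involves the coefficients of \<open>D\<close> up to \<open>n\<close>, which determine the
  next one.  All identities between exponentials below are proved by exhibiting both sides as
  solutions of one linear equation.
\<close>

lemma fps_linear_ode_zero:
  fixes D Z :: "'a::ring_1 fps"
  assumes tf: "torsion_free TYPE('a)" and D: "fps_deriv D = Z * D" "D $ 0 = 0"
  shows "D = 0"
proof (rule fps_ext)
  fix n show "D $ n = 0 $ n"
  proof (induction n rule: less_induct)
    case (less n)
    show ?case
    proof (cases n)
      case 0
      then show ?thesis using D by simp
    next
      case (Suc m)
      have "of_nat (Suc m) * D $ Suc m = fps_deriv D $ m" by (simp del: of_nat_Suc)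
      also have "\<dots> = 0" unfolding D fps_mult_nth by (rule sum.neutral) (use less Suc in auto)
      finally show ?thesis using torsion_freeD[OF tf] Suc by auto
    qed
  qed
qed

text \<open>
  When the coefficients of \<open>X\<close> commute with each other, this characterizes \<open>exp X\<close> without any
  division by factorials.
\<close>

definition is_fps_exp :: "'a::ring_1 fps \<Rightarrow> 'a fps \<Rightarrow> bool" where
  "is_fps_exp X U \<longleftrightarrow> U $ 0 = 1 \<and> fps_deriv U = fps_deriv X * U"

lemma is_fps_expD:
  assumes "is_fps_exp X U" shows "U $ 0 = 1" "fps_deriv U = fps_deriv X * U"
  using assms by (auto simp: is_fps_exp_def)

lemma is_fps_exp_unique:
  fixes X U V :: "'a::ring_1 fps"
  assumes tf: "torsion_free TYPE('a)" and U: "is_fps_exp X U" and V: "is_fps_exp X V"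
  shows "U = V"
  using fps_linear_ode_zero[OF tf, of "U - V" "fps_deriv X"] is_fps_expD[OF U] is_fps_expD[OF V]
  by (simp add: right_diff_distrib)

lemma is_fps_exp_mult:
  assumes "is_fps_exp X U" "is_fps_exp Y V" and "fps_deriv Y * U = U * fps_deriv Y"
  shows "is_fps_exp (X + Y) (U * V)"
  using is_fps_expD[OF assms(1)] is_fps_expD[OF assms(2)] assms(3)
  unfolding is_fps_exp_def
  by (simp add: distrib_right mult.assoc) (simp add: mult.assoc[symmetric])

lemma fps_const_commute_iff:
  "fps_const t * f = f * fps_const (t :: 'a::ring_1) \<longleftrightarrow> (\<forall>n. t * f $ n = f $ n * t)"
  by (simp add: fps_eq_iff)

lemma fps_commuteI:
  assumes "\<And>a b. f $ a * g $ b = g $ b * (f $ a :: 'a::ring_1)"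
  shows "f * g = g * f"
proof (rule fps_ext)
  fix n
  have "(f * g) $ n = (\<Sum>i=0..n. g $ (n - i) * f $ i)" by (simp add: fps_mult_nth assms)
  also have "\<dots> = (g * f) $ n" unfolding fps_mult_nth
    by (rule sum.reindex_bij_witness[of _ "\<lambda>i. n - i" "\<lambda>i. n - i"]) auto
  finally show "(f * g) $ n = (g * f) $ n" .
qed

lemma deriv_nth_commute:
  assumes "\<And>n. t * X $ n = X $ n * (t :: 'a::ring_1)"
  shows "t * fps_deriv X $ n = fps_deriv X $ n * t"
proof -
  have "t * (of_nat k * x) = of_nat k * (t * x)" for k and x :: 'a
    by (metis mult.assoc mult_of_nat_commute)
  then show ?thesis by (simp only: fps_deriv_nth assms mult.assoc)
qed

text \<open>
  The series \<open>t U\<close> and \<open>U t\<close> solve the same differential equation with the same initial value.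
\<close>

lemma exp_commute:
  fixes X U :: "'a::ring_1 fps"
  assumes tf: "torsion_free TYPE('a)" and U: "is_fps_exp X U"
    and X: "\<And>n. t * X $ n = X $ n * t"
  shows "t * U $ n = U $ n * t"
proof -
  have "fps_const t * U - U * fps_const t = 0"
  proof (rule fps_linear_ode_zero[OF tf])
    have "fps_const t * fps_deriv X = fps_deriv X * fps_const t"
      unfolding fps_const_commute_iff using deriv_nth_commute[OF X] by blast
    then show "fps_deriv (fps_const t * U - U * fps_const t) =
        fps_deriv X * (fps_const t * U - U * fps_const t)"
      using is_fps_expD[OF U] by (simp add: right_diff_distrib mult.assoc[symmetric])
  qed (use is_fps_expD[OF U] in simp)
  then show ?thesis using fps_const_commute_iff[of t U] by simp
qed

section \<open>Exchange relations of exponentials\<close>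

text \<open>
  For a complex vector space, \<open>\<sigma> c\<close> is multiplication by \<open>c\<close> in the ring of additive endomorphisms.
  It is not central there; the elements that commute with all of them are the linear maps.
\<close>

locale central_scalars =
  fixes \<sigma> :: "complex \<Rightarrow> 'a::ring_1"
  assumes \<sigma>_add: "\<sigma> (a + b) = \<sigma> a + \<sigma> b"
    and \<sigma>_mult: "\<sigma> (a * b) = \<sigma> a * \<sigma> b"
    and \<sigma>_1 [simp]: "\<sigma> 1 = 1"
begin

lemma \<sigma>_0 [simp]: "\<sigma> 0 = 0"
  using \<sigma>_add[of 0 0] by simp

lemma \<sigma>_of_nat: "\<sigma> (of_nat n) = of_nat n"
  by (induction n) (simp_all add: \<sigma>_add)

lemma \<sigma>_sum: "\<sigma> (sum f A) = (\<Sum>x\<in>A. \<sigma> (f x))"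
  by (induction A rule: infinite_finite_induct) (simp_all add: \<sigma>_add)

lemma torsion_free: "torsion_free TYPE('a)"
  unfolding torsion_free_def
proof (intro allI impI)
  fix n and x :: 'a assume "of_nat (Suc n) * x = 0"
  then have "\<sigma> (1 / of_nat (Suc n)) * (\<sigma> (of_nat (Suc n)) * x) = 0" unfolding \<sigma>_of_nat by simp
  then show "x = 0"
    by (simp add: mult.assoc[symmetric] \<sigma>_mult[symmetric] del: of_nat_Suc)
qed

lemmas torsion_free2 = torsion_free_fps[OF torsion_free]

definition linear_elt :: "'a \<Rightarrow> bool" where
  "linear_elt x \<longleftrightarrow> (\<forall>c. \<sigma> c * x = x * \<sigma> c)"

text \<open>
  The monomial \<open>c y\<^sup>l\<close>.
\<close>

definition mono :: "complex \<Rightarrow> nat \<Rightarrow> 'a fps" where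
  "mono c l = Abs_fps (\<lambda>k. if k = l then \<sigma> c else 0)"

lemma mono_0_eq [simp]: "mono c 0 = fps_const (\<sigma> c)" by (simp add: mono_def fps_eq_iff)

lemma mono_mult_nth: "(mono c l * f) $ b = (if l \<le> b then \<sigma> c * f $ (b - l) else 0)"
proof -
  have "(mono c l * f) $ b = (\<Sum>i=0..b. if i = l then \<sigma> c * f $ (b - i) else 0)"
    unfolding fps_mult_nth mono_def by (rule sum.cong) auto
  then show ?thesis by simp
qed

lemma mult_mono_nth: "(f * mono c l) $ b = (if l \<le> b then f $ (b - l) * \<sigma> c else 0)"
proof -
  have "(f * mono c l) $ b = (\<Sum>i=0..b. if i = b - l then (if l \<le> b then f $ i * \<sigma> c else 0) else 0)"
    unfolding fps_mult_nth mono_def by (rule sum.cong) auto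
  then show ?thesis by simp
qed

lemma mono_mult_mono: "mono c l * mono e k = mono (c * e) (l + k)"
proof (rule fps_ext)
  fix n
  have "mono e k $ (n - l) = (if n - l = k then \<sigma> e else 0)" by (simp add: mono_def)
  then show "(mono c l * mono e k) $ n = mono (c * e) (l + k) $ n"
    unfolding mono_mult_nth by (auto simp: mono_def[of _ "l + k"] \<sigma>_mult)
qed

lemma mono_sum: "mono (sum f A) l = (\<Sum>x\<in>A. mono (f x) l)"
  by (rule fps_ext) (auto simp: mono_def \<sigma>_sum fps_sum_nth)

lemma mono_commute:
  assumes "\<And>b. linear_elt (f $ b)"
  shows "mono c l * f = f * mono c l"
  by (rule fps_ext) (use assms in \<open>auto simp: mono_mult_nth mult_mono_nth linear_elt_def\<close>)

lemma deriv_mono: "fps_deriv (mono c (Suc l)) = mono (of_nat (Suc l) * c) l"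
  by (rule fps_ext) (auto simp: mono_def \<sigma>_mult \<sigma>_of_nat simp del: of_nat_Suc)

text \<open>
  Series in two variables \<open>x\<close>, \<open>y\<close> are series in \<open>x\<close> over series in \<open>y\<close>; this is \<open>y\<^sup>s g(x y)\<close>.
\<close>

definition diag :: "nat \<Rightarrow> complex fps \<Rightarrow> 'a fps fps" where
  "diag s g = Abs_fps (\<lambda>l. mono (g $ l) (l + s))"

text \<open>
  The series \<open>f(x)\<close> in two variables; the series \<open>f(y)\<close> is \<open>fps_const f\<close>.
\<close>

definition lift_coeffs :: "'a fps \<Rightarrow> 'a fps fps" where
  "lift_coeffs f = Abs_fps (\<lambda>a. fps_const (f $ a))"

lemma lift_coeffs_nth [simp]: "lift_coeffs f $ a = fps_const (f $ a)"
  by (simp add: lift_coeffs_def)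

lemma diag_mult: "diag s g * diag t h = diag (s + t) (g * h)"
proof (rule fps_ext)
  fix n
  have "(diag s g * diag t h) $ n = (\<Sum>i=0..n. mono (g $ i * h $ (n - i)) (n + (s + t)))"
    unfolding fps_mult_nth by (rule sum.cong) (auto simp: diag_def mono_mult_mono ac_simps)
  then show "(diag s g * diag t h) $ n = diag (s + t) (g * h) $ n"
    by (simp add: diag_def mono_sum fps_mult_nth)
qed

lemma deriv_diag: "fps_deriv (diag 0 g) = diag 1 (fps_deriv g)"
  by (rule fps_ext, rule fps_ext)
    (auto simp: diag_def mono_def fps_of_nat_mult_nth \<sigma>_mult \<sigma>_of_nat simp del: of_nat_Suc)

lemma deriv_lift_coeffs: "fps_deriv (lift_coeffs f) = lift_coeffs (fps_deriv f)"
  by (rule fps_ext, rule fps_ext) (auto simp: fps_of_nat_mult_nth simp del: of_nat_Suc)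

lemma lift_coeffs_mult: "lift_coeffs (f * g) = lift_coeffs f * lift_coeffs g"
proof -
  have "fps_const (sum h A) = (\<Sum>i\<in>A. fps_const (h i))" for h :: "nat \<Rightarrow> 'a" and A
    by (induction A rule: infinite_finite_induct) (simp_all flip: fps_const_add)
  then show ?thesis by (intro fps_ext) (simp add: fps_mult_nth)
qed

lemma diag_commute:
  assumes "\<And>a b. linear_elt (f $ a $ b)"
  shows "diag s g * f = f * diag s g"
  by (rule fps_commuteI) (simp add: diag_def mono_commute assms)

lemma linear_elt_simps [simp]: "linear_elt 0" "linear_elt 1"
  by (simp_all add: linear_elt_def)

text \<open>
  This is \<open>U(x) W(y) = W(y) U(x) \<gamma>(x y)\<close>, so that both variables can be differentiated.
\<close>

lemma exchange_iff:
  assumes lin: "\<And>n. linear_elt (U $ n)" "\<And>n. linear_elt (W $ n)"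
  shows "lift_coeffs U * fps_const W = fps_const W * lift_coeffs U * diag 0 \<gamma> \<longleftrightarrow>
    (\<forall>a b. U $ a * W $ b = (\<Sum>l\<le>min a b. \<sigma> (\<gamma> $ l) * (W $ (b - l) * U $ (a - l))))"
proof -
  have L: "(lift_coeffs U * fps_const W) $ a $ b = U $ a * W $ b" for a b by simp
  have R: "(fps_const W * lift_coeffs U * diag 0 \<gamma>) $ a $ b =
      (\<Sum>l\<le>min a b. \<sigma> (\<gamma> $ l) * (W $ (b - l) * U $ (a - l)))" for a b
  proof -
    have c: "fps_const W * lift_coeffs U * diag 0 \<gamma> = diag 0 \<gamma> * (fps_const W * lift_coeffs U)"
    proof (rule diag_commute[symmetric])
      fix a b show "linear_elt ((fps_const W * lift_coeffs U) $ a $ b)"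
        using lin unfolding linear_elt_def by simp (metis mult.assoc)
    qed
    have "(fps_const W * lift_coeffs U * diag 0 \<gamma>) $ a $ b =
       (\<Sum>l=0..a. if l \<le> b then \<sigma> (\<gamma> $ l) * (W $ (b - l) * U $ (a - l)) else 0)"
      unfolding c fps_mult_nth[of "diag 0 \<gamma>"] fps_sum_nth
      by (rule sum.cong) (auto simp: diag_def mono_mult_nth)
    also have "\<dots> = (\<Sum>l\<le>min a b. \<sigma> (\<gamma> $ l) * (W $ (b - l) * U $ (a - l)))"
      by (rule sum.mono_neutral_cong_right) auto
    finally show ?thesis .
  qed
  show ?thesis unfolding fps_eq_iff L R ..
qed

lemma linear_elt_mult: "linear_elt x \<Longrightarrow> linear_elt y \<Longrightarrow> linear_elt (x * y)"
  unfolding linear_elt_def by (metis mult.assoc)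

lemma linear_elt_of_nat: "linear_elt (of_nat n)"
  unfolding linear_elt_def by (simp add: mult_of_nat_commute)

lemma linear_deriv: "(\<And>n. linear_elt (X $ n)) \<Longrightarrow> linear_elt (fps_deriv X $ n)"
  by (simp add: linear_elt_mult linear_elt_of_nat del: of_nat_Suc)

text \<open>
  Differentiating \<open>U(x) W(y) = W(y) U(x) \<gamma>(x y)\<close> in \<open>x\<close> and cancelling the invertible series \<open>U(x) \<gamma>(x y)\<close>
  gives the commutator of \<open>X'(x)\<close> with \<open>W(y)\<close>; differentiating this in \<open>y\<close> and cancelling \<open>W(y)\<close> gives the
  commutator of the exponents.
\<close>

lemma exponents_from_exchange:
  assumes U: "is_fps_exp X U" and W: "is_fps_exp Y W"
    and lin: "\<And>n. linear_elt (U $ n)" "\<And>n. linear_elt (W $ n)"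
    and \<gamma>: "\<gamma> $ 0 = 1" "fps_deriv \<gamma> = lam * \<gamma>"
    and ex: "\<And>a b. U $ a * W $ b = (\<Sum>l\<le>min a b. \<sigma> (\<gamma> $ l) * (W $ (b - l) * U $ (a - l)))"
  shows "fps_deriv X $ a * fps_deriv Y $ b - fps_deriv Y $ b * fps_deriv X $ a =
    (if a = b then \<sigma> (of_nat (Suc a) * lam $ a) else 0)"
proof -
  define u w x \<Gamma> \<Lambda> where uw: "u = lift_coeffs U" "w = fps_const W" "x = lift_coeffs (fps_deriv X)"
    and GL: "\<Gamma> = diag 0 \<gamma>" "\<Lambda> = diag 1 lam"
  have rel: "u * w = w * u * \<Gamma>"
    unfolding uw GL exchange_iff[OF lin] using ex by blast
  have du: "fps_deriv u = x * u"
    using is_fps_expD(2)[OF U] by (simp add: uw deriv_lift_coeffs flip: lift_coeffs_mult)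
  have dw: "fps_deriv w = 0" by (simp add: uw)
  have dG: "fps_deriv \<Gamma> = \<Lambda> * \<Gamma>"
    by (simp add: GL deriv_diag diag_mult \<gamma>)
  have \<Lambda>u: "u * \<Lambda> = \<Lambda> * u"
    unfolding GL uw by (rule diag_commute[symmetric]) (auto simp: lin)
  have "x * w * (u * \<Gamma>) = fps_deriv (u * w)"
    by (simp add: du dw mult.assoc) (simp add: rel[unfolded mult.assoc])
  also have "\<dots> = (w * x + w * \<Lambda>) * (u * \<Gamma>)"
    unfolding rel by (simp add: du dw dG mult.assoc[symmetric] \<Lambda>u distrib_right distrib_left)
      (simp add: mult.assoc[of w] \<Lambda>u)
  finally have "(x * w - (w * x + w * \<Lambda>)) * (u * \<Gamma>) = 0" by (simp add: left_diff_distrib)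
  from fps_mult_unit_right_eq_0[OF _ this]
  have "x * w = w * x + w * \<Lambda>" by (simp add: uw GL is_fps_expD[OF U] diag_def \<gamma>)
  from arg_cong[OF this, of "\<lambda>f. f $ a"]
  have T: "fps_const (fps_deriv X $ a) * W = W * fps_const (fps_deriv X $ a) + W * mono (lam $ a) (Suc a)"
    by (simp add: uw GL diag_def)
  define t m where t: "t = fps_const (fps_deriv X $ a)" and m: "m = mono (lam $ a) (Suc a)"
  have dm: "fps_deriv m = mono (of_nat (Suc a) * lam $ a) a" unfolding m deriv_mono ..
  have mW: "W * fps_deriv m = fps_deriv m * W" unfolding dm by (rule mono_commute[symmetric]) (rule lin)
  have dt: "fps_deriv t = 0" by (simp add: t)
  have "t * fps_deriv Y * W = fps_deriv (t * W)"
    using is_fps_expD(2)[OF W] by (simp add: dt mult.assoc)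
  also have "\<dots> = fps_deriv Y * (W * t + W * m) + W * fps_deriv m"
    unfolding T[folded t m] using is_fps_expD(2)[OF W] by (simp add: dt mult.assoc distrib_left)
  also have "\<dots> = (fps_deriv Y * t + fps_deriv m) * W"
    unfolding T[folded t m, symmetric] mW by (simp add: mult.assoc distrib_right)
  finally have "(t * fps_deriv Y - (fps_deriv Y * t + fps_deriv m)) * W = 0" by (simp add: left_diff_distrib)
  from fps_mult_unit_right_eq_0[OF _ this] have "t * fps_deriv Y = fps_deriv Y * t + fps_deriv m"
    using is_fps_expD[OF W] by simp
  from arg_cong[OF this, of "\<lambda>f. f $ b"] show ?thesis
    unfolding dm t by (auto simp: mono_def simp del: fps_deriv_nth)
qed

text \<open>
  The two differentiations of the converse are inverted by uniqueness of solutions: first the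
  commutator of \<open>X'(x)\<close> with \<open>W(y)\<close> is integrated in \<open>y\<close>, then \<open>U(x) W(y)\<close> in \<open>x\<close>.
\<close>

lemma exchange_from_exponents:
  assumes U: "is_fps_exp X U" and W: "is_fps_exp Y W"
    and lin: "\<And>n. linear_elt (X $ n)" "\<And>n. linear_elt (Y $ n)"
    and \<gamma>: "\<gamma> $ 0 = 1" "fps_deriv \<gamma> = lam * \<gamma>"
    and com: "\<And>a b. fps_deriv X $ a * fps_deriv Y $ b - fps_deriv Y $ b * fps_deriv X $ a =
      (if a = b then \<sigma> (of_nat (Suc a) * lam $ a) else 0)"
  shows "U $ a * W $ b = (\<Sum>l\<le>min a b. \<sigma> (\<gamma> $ l) * (W $ (b - l) * U $ (a - l)))"
proof -
  have linU: "linear_elt (U $ n)" for n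
    unfolding linear_elt_def using exp_commute[OF torsion_free U] lin(1) linear_elt_def by blast
  have linW: "linear_elt (W $ n)" for n
    unfolding linear_elt_def using exp_commute[OF torsion_free W] lin(2) linear_elt_def by blast
  have X': "fps_const (fps_deriv X $ a) * W = W * fps_const (fps_deriv X $ a) + W * mono (lam $ a) (Suc a)" for a
  proof -
    define t m where t: "t = fps_const (fps_deriv X $ a)" and m: "m = mono (lam $ a) (Suc a)"
    have dm: "fps_deriv m = mono (of_nat (Suc a) * lam $ a) a" unfolding m deriv_mono ..
    have mW: "W * fps_deriv m = fps_deriv m * W" unfolding dm by (rule mono_commute[symmetric]) (rule linW)
    have dt: "fps_deriv t = 0" by (simp add: t)
    have tY: "t * fps_deriv Y = fps_deriv Y * t + fps_deriv m"
      using com[of a] by (intro fps_ext) (simp add: t dm mono_def algebra_simps del: fps_deriv_nth)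
    have "t * W - (W * t + W * m) = 0"
    proof (rule fps_linear_ode_zero[OF torsion_free])
      have "fps_deriv (t * W - (W * t + W * m)) =
          (fps_deriv Y * t + fps_deriv m) * W - (fps_deriv Y * (W * t) + (fps_deriv Y * (W * m) + W * fps_deriv m))"
        using is_fps_expD(2)[OF W] by (simp add: dt mult.assoc flip: tY)
      also have "\<dots> = fps_deriv Y * (t * W - (W * t + W * m))"
        unfolding mW by (simp add: algebra_simps)
      finally show "fps_deriv (t * W - (W * t + W * m)) = fps_deriv Y * (t * W - (W * t + W * m))" .
      show "(t * W - (W * t + W * m)) $ 0 = 0"
        using is_fps_expD(1)[OF W] by (simp add: t m mono_def)
    qed
    then show ?thesis by (simp add: t m)
  qed
  define u w x \<Gamma> \<Lambda> where uw: "u = lift_coeffs U" "w = fps_const W" "x = lift_coeffs (fps_deriv X)"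
    and GL: "\<Gamma> = diag 0 \<gamma>" "\<Lambda> = diag 1 lam"
  have xw: "x * w = w * x + w * \<Lambda>"
    by (rule fps_ext) (simp add: uw GL diag_def X' del: fps_deriv_nth)
  have du: "fps_deriv u = x * u"
    using is_fps_expD(2)[OF U] by (simp add: uw deriv_lift_coeffs flip: lift_coeffs_mult)
  have dw: "fps_deriv w = 0" by (simp add: uw)
  have dG: "fps_deriv \<Gamma> = \<Lambda> * \<Gamma>"
    by (simp add: GL deriv_diag diag_mult \<gamma>)
  have \<Lambda>u: "u * \<Lambda> = \<Lambda> * u"
    unfolding GL uw by (rule diag_commute[symmetric]) (auto simp: linU)
  have "u * w - w * u * \<Gamma> = 0"
  proof (rule fps_linear_ode_zero[OF torsion_free2])
    have "fps_deriv (u * w - w * u * \<Gamma>) = x * (u * w) - ((w * x) * (u * \<Gamma>) + w * (u * \<Lambda>) * \<Gamma>)"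
      by (simp add: du dw dG mult.assoc distrib_left)
    also have "\<dots> = x * (u * w) - (w * x + w * \<Lambda>) * (u * \<Gamma>)"
      unfolding \<Lambda>u by (simp add: distrib_right mult.assoc)
    also have "\<dots> = x * (u * w - w * u * \<Gamma>)"
      unfolding xw[symmetric] by (simp add: right_diff_distrib mult.assoc)
    finally show "fps_deriv (u * w - w * u * \<Gamma>) = x * (u * w - w * u * \<Gamma>)" .
    show "(u * w - w * u * \<Gamma>) $ 0 = 0" by (simp add: uw GL diag_def is_fps_expD[OF U] \<gamma>)
  qed
  then have "u * w = w * u * \<Gamma>" by simp
  from this[unfolded uw GL exchange_iff[OF linU linW]] show ?thesis by blast
qed

lemma of_nat_mult_left_commute: "of_nat k * (s * x) = s * (of_nat k * (x::'b::semiring_1))"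
  unfolding mult.assoc[symmetric] mult_of_nat_commute[of k s] ..

section \<open>Exponential series and their dilation roots\<close>

text \<open>
  The exponential of a series without constant term, for which only the powers up to \<open>a\<close> contribute
  to the coefficient of \<open>x\<^sup>a\<close>.
\<close>

definition expser :: "'a fps \<Rightarrow> 'a fps" where
  "expser X = Abs_fps (\<lambda>a. \<Sum>m\<le>a. \<sigma> (1 / fact m) * (X ^ m) $ a)"

lemma linear_elt_sum: "(\<And>x. x \<in> A \<Longrightarrow> linear_elt (f x)) \<Longrightarrow> linear_elt (sum f A)"
  by (induction A rule: infinite_finite_induct)
    (auto simp: linear_elt_def distrib_left distrib_right)

lemma linear_elt_\<sigma> [simp]: "linear_elt (\<sigma> c)"
  by (simp add: linear_elt_def mult.commute flip: \<sigma>_mult)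

lemma linear_fps_mult:
  "(\<And>n. linear_elt (f $ n)) \<Longrightarrow> (\<And>n. linear_elt (g $ n)) \<Longrightarrow> linear_elt ((f * g) $ n)"
  unfolding fps_mult_nth by (intro linear_elt_sum linear_elt_mult) auto

lemma linear_fps_power: "(\<And>n. linear_elt (f $ n)) \<Longrightarrow> linear_elt ((f ^ m) $ n)"
  by (induction m arbitrary: n) (auto intro: linear_fps_mult)

lemma linear_expser: "(\<And>n. linear_elt (X $ n)) \<Longrightarrow> linear_elt (expser X $ n)"
  by (auto simp: expser_def intro!: linear_elt_sum linear_elt_mult linear_fps_power)

lemma power_nth_eq_0:
  fixes X :: "'a fps"
  assumes "X $ 0 = 0" "a < m" shows "(X ^ m) $ a = 0"
  using assms(2)
proof (induction m arbitrary: a)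
  case (Suc m)
  show ?case unfolding power_Suc fps_mult_nth
  proof (rule sum.neutral, rule ballI)
    fix i assume "i \<in> {0..a}"
    then show "X $ i * (X ^ m) $ (a - i) = 0"
      using Suc assms(1) by (cases i) auto
  qed
qed simp

text \<open>
  The derivative of \<open>X\<^sup>m\<close> is \<open>m X' X\<^sup>m\<^sup>-\<^sup>1\<close> because \<open>X\<close> commutes with \<open>X'\<close>.
\<close>

lemma is_fps_exp_expser:
  assumes lin: "\<And>n. linear_elt (X $ n)" and X0: "X $ 0 = 0"
    and com: "\<And>a b. X $ a * X $ b = X $ b * X $ a"
  shows "is_fps_exp X (expser X)"
proof -
  let ?X' = "fps_deriv X"
  have com': "X * ?X' = ?X' * X"
    by (rule fps_commuteI) (rule deriv_nth_commute, rule com)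
  have comp: "X ^ m * ?X' = ?X' * X ^ m" for m
  proof (induction m)
    case (Suc m)
    have "X ^ Suc m * ?X' = X * (X ^ m * ?X')" by (simp add: mult.assoc)
    also have "\<dots> = X * ?X' * X ^ m" unfolding Suc.IH by (simp only: mult.assoc)
    also have "\<dots> = ?X' * X ^ Suc m" unfolding com' by (simp add: mult.assoc)
    finally show ?case .
  qed simp
  have dp: "fps_deriv (X ^ Suc m) = of_nat (Suc m) * (?X' * X ^ m)" for m
  proof (induction m)
    case (Suc m)
    have "fps_deriv (X ^ Suc (Suc m)) = ?X' * X ^ Suc m + X * (of_nat (Suc m) * (?X' * X ^ m))"
      by (subst power_Suc) (simp add: Suc.IH del: power_Suc of_nat_Suc)
    also have "X * (of_nat (Suc m) * (?X' * X ^ m)) = of_nat (Suc m) * (?X' * X ^ Suc m)"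
    proof -
      have "X * (of_nat (Suc m) * (?X' * X ^ m)) = of_nat (Suc m) * (X * ?X' * X ^ m)"
        by (simp only: of_nat_mult_left_commute mult.assoc)
      then show ?thesis unfolding com' by (simp add: mult.assoc del: of_nat_Suc)
    qed
    also have "?X' * X ^ Suc m + of_nat (Suc m) * (?X' * X ^ Suc m) = of_nat (Suc (Suc m)) * (?X' * X ^ Suc m)"
      by (simp add: distrib_right)
    finally show ?case .
  qed simp
  have "fps_deriv (expser X) $ a = (?X' * expser X) $ a" for a
  proof -
    have "fps_deriv (expser X) $ a = (\<Sum>m\<le>Suc a. \<sigma> (1 / fact m) * fps_deriv (X ^ m) $ a)"
      unfolding expser_def fps_deriv_nth fps_nth_Abs_fps sum_distrib_left Suc_eq_plus1
      by (intro sum.cong refl of_nat_mult_left_commute)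
    also have "\<dots> = (\<Sum>m\<le>a. \<sigma> (1 / fact (Suc m)) * fps_deriv (X ^ Suc m) $ a)"
      by (subst sum.atMost_Suc_shift) (simp del: fps_deriv_nth power_Suc)
    also have "\<dots> = (\<Sum>m\<le>a. \<sigma> (1 / fact m) * (?X' * X ^ m) $ a)"
    proof (rule sum.cong, simp)
      fix m
      have "\<sigma> (1 / fact (Suc m)) * fps_deriv (X ^ Suc m) $ a =
          \<sigma> (1 / fact (Suc m)) * (\<sigma> (of_nat (Suc m)) * (?X' * X ^ m) $ a)"
        unfolding dp fps_of_nat_mult_nth \<sigma>_of_nat ..
      also have "\<dots> = \<sigma> (1 / fact (Suc m) * of_nat (Suc m)) * (?X' * X ^ m) $ a"
        by (simp only: \<sigma>_mult mult.assoc)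
      also have "1 / fact (Suc m) * of_nat (Suc m) = (1 / fact m :: complex)"
        by (simp add: divide_simps del: of_nat_Suc)
      finally show "\<sigma> (1 / fact (Suc m)) * fps_deriv (X ^ Suc m) $ a = \<sigma> (1 / fact m) * (?X' * X ^ m) $ a" .
    qed
    also have "\<dots> = (\<Sum>k=0..a. ?X' $ k * (\<Sum>m\<le>a. \<sigma> (1 / fact m) * (X ^ m) $ (a - k)))"
    proof -
      have "\<sigma> c * (?X' $ k * y) = ?X' $ k * (\<sigma> c * y)" for c k y
        using linear_deriv[OF lin, of k] unfolding linear_elt_def mult.assoc[symmetric] by simp
      then show ?thesis unfolding fps_mult_nth sum_distrib_left by (subst sum.swap) (simp only:)
    qed
    also have "\<dots> = (\<Sum>k=0..a. ?X' $ k * expser X $ (a - k))"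
    proof (rule sum.cong, simp)
      fix k
      have "(\<Sum>m\<le>a. \<sigma> (1 / fact m) * (X ^ m) $ (a - k)) = expser X $ (a - k)"
        unfolding expser_def fps_nth_Abs_fps
        by (rule sum.mono_neutral_right) (auto simp: power_nth_eq_0[OF X0])
      then show "?X' $ k * (\<Sum>m\<le>a. \<sigma> (1 / fact m) * (X ^ m) $ (a - k)) = ?X' $ k * expser X $ (a - k)"
        by simp
    qed
    finally show ?thesis unfolding fps_mult_nth .
  qed
  then have "fps_deriv (expser X) = ?X' * expser X" by (rule fps_ext)
  then show ?thesis by (simp add: is_fps_exp_def expser_def)
qed

text \<open>
  The \<open>n\<close>-th coefficient of \<open>exp X\<close> is \<open>X $ n\<close> plus a polynomial in earlier coefficients of \<open>X\<close>, so
  commuting with the exponential passes to the exponent by induction.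
\<close>

lemma expser_exponent_commute:
  assumes t: "linear_elt t" and X0: "X $ 0 = 0"
    and tU: "\<And>n. t * expser X $ n = expser X $ n * t"
  shows "t * X $ n = X $ n * t"
proof (induction n rule: less_induct)
  case (less a)
  have low: "t * (X ^ m) $ c = (X ^ m) $ c * t" if "c < a" for m c
    using that
  proof (induction m arbitrary: c)
    case (Suc m)
    have "t * (X $ i * (X ^ m) $ (c - i)) = X $ i * (X ^ m) $ (c - i) * t" if "i \<in> {0..c}" for i
    proof -
      have "t * X $ i = X $ i * t" "t * (X ^ m) $ (c - i) = (X ^ m) $ (c - i) * t"
        using that Suc less.IH[of i] by auto
      then show ?thesis by (metis mult.assoc)
    qed
    then show ?case unfolding power_Suc fps_mult_nth sum_distrib_left sum_distrib_right
      by (intro sum.cong) auto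
  qed simp
  have high: "t * (X ^ m) $ a = (X ^ m) $ a * t" if m: "m \<noteq> 1" for m
  proof (cases "m = 0")
    case False
    with m obtain k where k: "m = Suc (Suc k)" by (metis One_nat_def old.nat.exhaust)
    have "t * (X $ i * (X ^ Suc k) $ (a - i)) = X $ i * (X ^ Suc k) $ (a - i) * t" if "i \<in> {0..a}" for i
    proof (cases "i = 0 \<or> i = a")
      case True
      then show ?thesis using X0 by auto
    next
      case False
      then have "t * X $ i = X $ i * t" "t * (X ^ Suc k) $ (a - i) = (X ^ Suc k) $ (a - i) * t"
        using that less.IH[of i] low[of "a - i" "Suc k"] by auto
      then show ?thesis by (metis mult.assoc)
    qed
    then show ?thesis unfolding k power_Suc[of X "Suc k"] fps_mult_nth[of X] sum_distrib_left sum_distrib_right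
      by (intro sum.cong) auto
  qed simp
  show ?case
  proof (cases "a = 0")
    case False
    let ?f = "\<lambda>m. \<sigma> (1 / fact m) * (X ^ m) $ a"
    have "expser X $ a = ?f 1 + (\<Sum>m\<in>{..a} - {1}. ?f m)"
      unfolding expser_def fps_nth_Abs_fps by (rule sum.remove) (use False in auto)
    then have X: "X $ a = expser X $ a - (\<Sum>m\<in>{..a} - {1}. ?f m)" by simp
    have "t * ?f m = ?f m * t" if "m \<noteq> 1" for m
    proof -
      have "t * \<sigma> (1 / fact m) = \<sigma> (1 / fact m) * t" using t by (simp add: linear_elt_def)
      then show ?thesis using high[OF that] by (metis mult.assoc)
    qed
    then show ?thesis unfolding X right_diff_distrib left_diff_distrib sum_distrib_left sum_distrib_right tU
      by (intro arg_cong2[where f=minus] sum.cong) auto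
  qed (simp add: X0)
qed

text \<open>
  The series \<open>f(s x)\<close>.
\<close>

definition dilate :: "complex \<Rightarrow> 'a fps \<Rightarrow> 'a fps" where
  "dilate s f = Abs_fps (\<lambda>n. \<sigma> (s ^ n) * f $ n)"

lemma dilate_mult:
  assumes "\<And>n. linear_elt (f $ n)"
  shows "dilate s (f * g) = dilate s f * dilate s g"
proof (rule fps_ext)
  fix n
  have "dilate s (f * g) $ n = (\<Sum>i=0..n. \<sigma> (s ^ i * s ^ (n - i)) * (f $ i * g $ (n - i)))"
    unfolding dilate_def fps_nth_Abs_fps fps_mult_nth sum_distrib_left
    by (rule sum.cong) (auto simp flip: power_add)
  also have "\<dots> = (dilate s f * dilate s g) $ n"
    unfolding dilate_def fps_nth_Abs_fps fps_mult_nth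
  proof (rule sum.cong, simp)
    fix i
    show "\<sigma> (s ^ i * s ^ (n - i)) * (f $ i * g $ (n - i)) = \<sigma> (s ^ i) * f $ i * (\<sigma> (s ^ (n - i)) * g $ (n - i))"
    proof -
      have "\<sigma> (s ^ (n - i)) * (f $ i * g $ (n - i)) = f $ i * (\<sigma> (s ^ (n - i)) * g $ (n - i))"
        using assms[of i] unfolding linear_elt_def mult.assoc[symmetric] by simp
      then show ?thesis unfolding \<sigma>_mult by (simp only: mult.assoc)
    qed
  qed
  finally show "dilate s (f * g) $ n = (dilate s f * dilate s g) $ n" .
qed

lemma deriv_dilate: "fps_deriv (dilate s f) = fps_const (\<sigma> s) * dilate s (fps_deriv f)"
proof (rule fps_ext)
  fix n
  have "of_nat (n + 1) * (\<sigma> (s ^ (n + 1)) * f $ (n + 1)) = \<sigma> (s ^ (n + 1)) * (of_nat (n + 1) * f $ (n + 1))"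
    by (rule of_nat_mult_left_commute)
  then show "fps_deriv (dilate s f) $ n = (fps_const (\<sigma> s) * dilate s (fps_deriv f)) $ n"
    by (simp add: dilate_def \<sigma>_mult mult.assoc del: of_nat_Suc)
qed

lemma is_fps_exp_dilate:
  assumes U: "is_fps_exp X U" and lin: "\<And>n. linear_elt (X $ n)"
  shows "is_fps_exp (dilate s X) (dilate s U)"
proof -
  have "dilate s (fps_deriv X * U) = dilate s (fps_deriv X) * dilate s U"
    by (rule dilate_mult) (rule linear_deriv, rule lin)
  then show ?thesis using is_fps_expD[OF U]
    by (simp add: is_fps_exp_def deriv_dilate mult.assoc) (simp add: dilate_def)
qed

definition rescale :: "(nat \<Rightarrow> complex) \<Rightarrow> 'a fps \<Rightarrow> 'a fps" where
  "rescale c X = Abs_fps (\<lambda>n. \<sigma> (c n) * X $ n)"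

lemma rescale_nth [simp]: "rescale c X $ n = \<sigma> (c n) * X $ n"
  by (simp add: rescale_def)

lemma linear_rescale: "(\<And>n. linear_elt (X $ n)) \<Longrightarrow> linear_elt (rescale c X $ n)"
  by (simp add: linear_elt_mult)

lemma commute_\<sigma>_mult:
  assumes "linear_elt x" "linear_elt y" "x * y = y * x"
  shows "\<sigma> a * x * (\<sigma> b * y) = \<sigma> b * y * (\<sigma> a * x)"
proof -
  have "\<sigma> a * x * (\<sigma> b * y) = \<sigma> a * (x * \<sigma> b) * y" by (simp only: mult.assoc)
  also have "\<dots> = \<sigma> a * (\<sigma> b * x) * y"
    using assms(1) unfolding linear_elt_def by simp
  also have "\<dots> = \<sigma> b * \<sigma> a * (y * x)"
    unfolding assms(3)[symmetric] by (simp only: mult.assoc[symmetric] \<sigma>_mult[symmetric] mult.commute[of a b])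
  also have "\<dots> = \<sigma> b * y * (\<sigma> a * x)"
    using assms(2) unfolding linear_elt_def mult.assoc by (simp only: mult.assoc[symmetric])
  finally show ?thesis .
qed

lemma is_fps_exp_rescale:
  assumes lin: "\<And>n. linear_elt (X $ n)" and X0: "X $ 0 = 0"
    and com: "\<And>a b. X $ a * X $ b = X $ b * X $ a"
  shows "is_fps_exp (rescale c X) (expser (rescale c X))"
proof (rule is_fps_exp_expser)
  show "linear_elt (rescale c X $ n)" for n by (rule linear_rescale[OF lin])
  show "rescale c X $ 0 = 0" by (simp add: X0)
  show "rescale c X $ a * rescale c X $ b = rescale c X $ b * rescale c X $ a" for a b
    unfolding rescale_nth by (rule commute_\<sigma>_mult[OF lin lin com])
qed

lemma dilate_expser_rescale:
  assumes lin: "\<And>n. linear_elt (X $ n)" and X0: "X $ 0 = 0"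
    and com: "\<And>a b. X $ a * X $ b = X $ b * X $ a"
  shows "dilate s (expser (rescale c X)) = expser (rescale (\<lambda>n. s ^ n * c n) X)"
proof (rule is_fps_exp_unique[OF torsion_free])
  have eq: "dilate s (rescale c X) = rescale (\<lambda>n. s ^ n * c n) X"
    unfolding dilate_def rescale_def fps_nth_Abs_fps \<sigma>_mult mult.assoc ..
  have "is_fps_exp (rescale c X) (expser (rescale c X))" by (rule is_fps_exp_rescale[OF lin X0 com])
  moreover have "linear_elt (rescale c X $ n)" for n by (rule linear_rescale[OF lin])
  ultimately show "is_fps_exp (rescale (\<lambda>n. s ^ n * c n) X) (dilate s (expser (rescale c X)))"
    unfolding eq[symmetric] by (rule is_fps_exp_dilate)
  show "is_fps_exp (rescale (\<lambda>n. s ^ n * c n) X) (expser (rescale (\<lambda>n. s ^ n * c n) X))"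
    by (rule is_fps_exp_rescale[OF lin X0 com])
qed

text \<open>
  The weights \<open>1 / (1 + s\<^sup>n)\<close> and \<open>s\<^sup>n / (1 + s\<^sup>n)\<close> add up to one, and the second exponent is the first one
  at \<open>s x\<close>.  This solves the equation \<open>T(x) T(s x) = exp X\<close>.
\<close>

lemma expser_split:
  assumes lin: "\<And>n. linear_elt (X $ n)" and X0: "X $ 0 = 0"
    and com: "\<And>a b. X $ a * X $ b = X $ b * X $ a"
    and s: "\<And>n. n > 0 \<Longrightarrow> 1 + s ^ n \<noteq> 0"
  defines "T \<equiv> expser (rescale (\<lambda>n. 1 / (1 + s ^ n)) X)"
  shows "T * dilate s T = expser X"
proof (rule is_fps_exp_unique[OF torsion_free])
  let ?c = "\<lambda>n. 1 / (1 + s ^ n)" and ?e = "\<lambda>n. s ^ n * (1 / (1 + s ^ n))"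
  have eq: "rescale ?c X + rescale ?e X = X"
  proof (rule fps_ext)
    fix n
    show "(rescale ?c X + rescale ?e X) $ n = X $ n"
    proof (cases "n = 0")
      case False
      then have c: "?c n + ?e n = 1" using s[of n] by (simp add: divide_simps)
      have "(rescale ?c X + rescale ?e X) $ n = \<sigma> (?c n + ?e n) * X $ n"
        by (simp only: fps_add_nth rescale_nth \<sigma>_add distrib_right)
      then show ?thesis unfolding c by simp
    qed (simp add: X0)
  qed
  have "is_fps_exp (rescale ?c X + rescale ?e X) (T * dilate s T)"
    unfolding T_def dilate_expser_rescale[OF lin X0 com]
  proof (rule is_fps_exp_mult)
    show "is_fps_exp (rescale ?c X) (expser (rescale ?c X))" "is_fps_exp (rescale ?e X) (expser (rescale ?e X))"
      by (rule is_fps_exp_rescale[OF lin X0 com])+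
    show "fps_deriv (rescale ?e X) * expser (rescale ?c X) = expser (rescale ?c X) * fps_deriv (rescale ?e X)"
    proof (rule fps_commuteI)
      fix a b
      have 1: "rescale ?c X $ m * rescale ?e X $ n = rescale ?e X $ n * rescale ?c X $ m" for m n
        unfolding rescale_nth by (rule commute_\<sigma>_mult[OF lin lin com])
      have 2: "rescale ?c X $ m * fps_deriv (rescale ?e X) $ a = fps_deriv (rescale ?e X) $ a * rescale ?c X $ m" for m
        by (rule deriv_nth_commute) (rule 1)
      show "fps_deriv (rescale ?e X) $ a * expser (rescale ?c X) $ b = expser (rescale ?c X) $ b * fps_deriv (rescale ?e X) $ a"
        by (rule exp_commute[OF torsion_free is_fps_exp_rescale[OF lin X0 com]]) (rule 2[symmetric])
    qed
  qed
  then show "is_fps_exp X (T * dilate s T)" unfolding eq .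
qed (rule is_fps_exp_expser[OF lin X0 com])

end

section \<open>Logarithmic derivatives of the structure functions\<close>

text \<open>
  The function \<open>lam\<close> lists the coefficients of \<open>(log g)'\<close>.
\<close>

definition log_deriv :: "complex fps \<Rightarrow> (nat \<Rightarrow> complex) \<Rightarrow> bool" where
  "log_deriv g lam \<longleftrightarrow> g $ 0 = 1 \<and> fps_deriv g = Abs_fps lam * g"

text \<open>
  The series \<open>(1 - a x) / (1 - b x)\<close>, of which all structure functions are products.
\<close>

definition ratio :: "complex \<Rightarrow> complex \<Rightarrow> complex fps" where
  "ratio a b = (1 - fps_const a * fps_X) * inverse (1 - fps_const b * fps_X)"

lemma inverse_geometric: "inverse (1 - fps_const b * fps_X) = Abs_fps (\<lambda>n. (b::complex) ^ n)"
proof (rule fps_inverse_unique)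
  show "(1 - fps_const b * fps_X) * Abs_fps (\<lambda>n. b ^ n) = 1"
  proof (rule fps_ext)
    fix n
    show "((1 - fps_const b * fps_X) * Abs_fps (\<lambda>n. b ^ n)) $ n = 1 $ n"
      by (cases n) (simp_all add: left_diff_distrib mult.assoc)
  qed
qed

lemma log_deriv_mult:
  "log_deriv g l \<Longrightarrow> log_deriv h m \<Longrightarrow> log_deriv (g * h) (\<lambda>n. l n + m n)"
proof -
  have "Abs_fps (\<lambda>n. l n + m n) = Abs_fps l + Abs_fps m" by (rule fps_ext) simp
  then show "log_deriv g l \<Longrightarrow> log_deriv h m \<Longrightarrow> ?thesis"
    unfolding log_deriv_def by (simp add: algebra_simps)
qed

lemma log_deriv_1: "log_deriv 1 (\<lambda>n. 0)"
proof -
  have "Abs_fps (\<lambda>n. 0) = (0 :: complex fps)" by (rule fps_ext) simp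
  then show ?thesis by (simp add: log_deriv_def)
qed

lemma log_deriv_ratio: "log_deriv (ratio a b) (\<lambda>n. b ^ Suc n - a ^ Suc n)"
proof -
  let ?A = "1 - fps_const a * fps_X" and ?B = "1 - fps_const b * fps_X"
  have A: "?A * inverse ?A = 1" by (rule inverse_mult_eq_1') simp
  have L: "Abs_fps (\<lambda>n. b ^ Suc n - a ^ Suc n) =
      fps_const b * inverse ?B - fps_const a * inverse ?A"
    unfolding inverse_geometric by (rule fps_ext) simp
  have "fps_deriv (inverse ?B) = - fps_deriv ?B * (inverse ?B)\<^sup>2" by (rule fps_inverse_deriv) simp
  then have dI: "fps_deriv (inverse ?B) = fps_const b * (inverse ?B)\<^sup>2" by simp
  have dA: "fps_deriv ?A = - fps_const a" by simp
  have dR: "fps_deriv (ratio a b) = ?A * fps_deriv (inverse ?B) + fps_deriv ?A * inverse ?B"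
    unfolding ratio_def by (rule fps_deriv_mult)
  have alg: "A * (ca * (J * J)) + - cb * J = (ca * J - cb * I) * (A * J)"
    if "A * I = 1" for A I J ca cb :: "complex fps"
  proof -
    have "(ca * J - cb * I) * (A * J) = ca * J * A * J - cb * (A * I) * J" by (simp add: algebra_simps)
    then show ?thesis unfolding that by (simp add: algebra_simps)
  qed
  have "fps_deriv (ratio a b) = Abs_fps (\<lambda>n. b ^ Suc n - a ^ Suc n) * ratio a b"
    unfolding dR dI dA L power2_eq_square alg[OF A] by (simp only: ratio_def)
  then show ?thesis unfolding log_deriv_def by (simp add: ratio_def)
qed

definition fps_dilate :: "complex \<Rightarrow> complex fps \<Rightarrow> complex fps" where
  "fps_dilate s f = Abs_fps (\<lambda>n. s ^ n * f $ n)"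

lemma log_deriv_dilate:
  assumes "log_deriv g l" shows "log_deriv (fps_dilate s g) (\<lambda>n. s ^ Suc n * l n)"
  unfolding log_deriv_def
proof
  show "fps_dilate s g $ 0 = 1" using assms by (simp add: log_deriv_def fps_dilate_def)
  show "fps_deriv (fps_dilate s g) = Abs_fps (\<lambda>n. s ^ Suc n * l n) * fps_dilate s g"
  proof (rule fps_ext)
    fix n
    have "fps_deriv (fps_dilate s g) $ n = s ^ Suc n * fps_deriv g $ n"
      by (simp add: fps_dilate_def)
    also have "\<dots> = s ^ Suc n * (\<Sum>i=0..n. l i * g $ (n - i))"
      using assms by (simp add: log_deriv_def fps_mult_nth del: fps_deriv_nth)
    also have "\<dots> = (\<Sum>i=0..n. s ^ Suc i * l i * (s ^ (n - i) * g $ (n - i)))"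
      unfolding sum_distrib_left
    proof (rule sum.cong, simp)
      fix i assume "i \<in> {0..n}"
      then have s: "s ^ Suc n = s ^ Suc i * s ^ (n - i)" by (simp flip: power_add)
      show "s ^ Suc n * (l i * g $ (n - i)) = s ^ Suc i * l i * (s ^ (n - i) * g $ (n - i))"
        unfolding s by (simp only: ac_simps)
    qed
    finally show "fps_deriv (fps_dilate s g) $ n = (Abs_fps (\<lambda>n. s ^ Suc n * l n) * fps_dilate s g) $ n"
      unfolding fps_mult_nth fps_dilate_def fps_nth_Abs_fps .
  qed
qed

section \<open>The Heisenberg representation in the endomorphism ring\<close>

lemma mult_swap_middle: "u * b = b * u \<Longrightarrow> (a * u) * (b * w) = (a * b) * (u * (w :: 'a::semigroup_mult))"
  by (metis mult.assoc)

lemma mult_commute2: "a * x = x * a \<Longrightarrow> b * x = x * b \<Longrightarrow> (a * b) * x = x * (a * (b :: 'a::semigroup_mult))"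
  by (metis mult.assoc)

text \<open>
  The representation and its boundary currents.  The currents are determined by the representation
  (\<open>Ktm_eq\<close>, \<open>Ktp_eq\<close>), and appear as parameters because they are given by their defining equations.
\<close>

locale boundary_module = heisenberg_module scale qh dh C K0p K0m Rp Rm H
  for scale :: "complex \<Rightarrow> 'v::ab_group_add \<Rightarrow> 'v" (infixr \<open>*s\<close> 75)
    and qh dh C K0p K0m Rp Rm and H :: "'n::nontriv mod_ring \<Rightarrow> int \<Rightarrow> 'v \<Rightarrow> 'v" +
  fixes Ktp Ktm :: "'n mod_ring \<Rightarrow> nat \<Rightarrow> 'v \<Rightarrow> 'v"
  assumes card_n: "CARD('n) \<ge> 3"
    and generic: "generic_parameters qh dh"
    and irreducible: "irreducible_H_module"
    and C_eq: "C v = qh *s v"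
    and tilde_p: "is_tilde scale (inverse q) (Rp i) (Kp i) (Ktp i)"
    and tilde_m: "is_tilde scale q (Rm i) (Km i) (Ktm i)"
begin

abbreviation lin :: "('v \<Rightarrow> 'v) \<Rightarrow> bool" where
  "lin F \<equiv> Vector_Spaces.linear scale scale F"

lemma qh_nz [simp]: "qh \<noteq> 0" and dh_nz [simp]: "dh \<noteq> 0"
  using generic by (auto simp: generic_parameters_def)

lemma genericD: "(inverse q * d) powi i * (q^2) powi j = 1 \<Longrightarrow> i = 0 \<and> j = 0"
  using generic unfolding generic_parameters_def Let_def by blast

lemma q_power_square_neq_1: "n > 0 \<Longrightarrow> (q ^ n)^2 \<noteq> 1"
proof
  assume n: "n > 0" and eq: "(q ^ n)^2 = 1"
  have "(inverse q * d) powi 0 * (q^2) powi (int n) = (q ^ n)^2"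
    by (simp add: power_mult[symmetric] mult.commute)
  then show False using genericD[of 0 "int n"] n eq by simp
qed

lemma q_power_neq: "n > 0 \<Longrightarrow> q ^ n \<noteq> 1" "n > 0 \<Longrightarrow> 1 + q ^ n \<noteq> 0" "n > 0 \<Longrightarrow> 1 + inverse q ^ n \<noteq> 0"
proof -
  show "n > 0 \<Longrightarrow> q ^ n \<noteq> 1" "n > 0 \<Longrightarrow> 1 + q ^ n \<noteq> 0"
    using q_power_square_neq_1[of n] by (auto simp: add_eq_0_iff)
  then show "n > 0 \<Longrightarrow> 1 + inverse q ^ n \<noteq> 0"
    by (auto simp: power_inverse field_simps add_eq_0_iff)
qed

lemma nontrivial: "\<exists>x::'v. x \<noteq> 0"
  using irreducible by (auto simp: irreducible_H_module_def irreducible_on_def)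

definition sc :: "complex \<Rightarrow> 'v endo" where "sc c = endo_of (\<lambda>v. c *s v)"

lemma sc_apply [simp]: "endo_apply (sc c) v = c *s v"
  by (simp add: sc_def scale_right_distrib)

lemmas endo_ext = endo_eqI[OF nontrivial]

sublocale S: central_scalars sc
proof
  fix a b :: complex
  show "sc (a + b) = sc a + sc b" by (rule endo_ext) (simp add: scale_left_distrib)
  show "sc (a * b) = sc a * sc b" by (rule endo_ext) simp
  show "sc 1 = 1" by (rule endo_ext) simp
qed

lemma lin_simps:
  assumes "lin f"
  shows "f (x + y) = f x + f y" "f (c *s x) = c *s f x" "f 0 = 0" "f (x - y) = f x - f y" "f (sum g A) = (\<Sum>a\<in>A. f (g a))"
proof -
  interpret Vector_Spaces.linear scale scale f by fact
  show "f (x + y) = f x + f y" "f (c *s x) = c *s f x" "f 0 = 0" "f (x - y) = f x - f y" "f (sum g A) = (\<Sum>a\<in>A. f (g a))"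
    by (rule add scale zero diff sum)+
qed

lemma linear_endo_of: "lin f \<Longrightarrow> S.linear_elt (endo_of f)"
  unfolding S.linear_elt_def by (intro allI endo_ext) (simp add: lin_simps)

lemma endo_apply_linear: "lin f \<Longrightarrow> endo_apply (endo_of f) v = f v"
  by (simp add: lin_simps)

definition kp :: "'n mod_ring \<Rightarrow> 'v endo" where "kp i = endo_of (K0p i)"
definition km :: "'n mod_ring \<Rightarrow> 'v endo" where "km i = endo_of (K0m i)"
definition rp :: "'n mod_ring \<Rightarrow> 'v endo" where "rp i = endo_of (Rp i)"
definition rm :: "'n mod_ring \<Rightarrow> 'v endo" where "rm i = endo_of (Rm i)"

lemma zero_mode_apply [simp]:
  "endo_apply (kp i) v = K0p i v" "endo_apply (km i) v = K0m i v"
  "endo_apply (rp i) v = Rp i v" "endo_apply (rm i) v = Rm i v"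
  unfolding kp_def km_def rp_def rm_def by (auto intro: endo_apply_linear linear_K0 linear_R)

lemma linear_zero_mode: "S.linear_elt (kp i)" "S.linear_elt (km i)" "S.linear_elt (rp i)" "S.linear_elt (rm i)"
  unfolding kp_def km_def rp_def rm_def by (auto intro: linear_endo_of linear_K0 linear_R)

text \<open>
  The exponents of \<open>K\<^sub>i\<^sup>+\<close> and \<open>K\<^sub>i\<^sup>-\<close>, as series in \<open>z\<^sup>-\<^sup>1\<close> and \<open>z\<close> respectively.
\<close>

definition hX :: "'n mod_ring \<Rightarrow> 'v endo fps" where
  "hX i = Abs_fps (\<lambda>r. if r = 0 then 0 else endo_of (\<lambda>v. (q - inverse q) *s H i (int r) v))"
definition hY :: "'n mod_ring \<Rightarrow> 'v endo fps" where
  "hY i = Abs_fps (\<lambda>r. if r = 0 then 0 else endo_of (\<lambda>v. (- (q - inverse q)) *s H i (- int r) v))"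

lemma linear_scaled: "lin f \<Longrightarrow> lin (\<lambda>v. c *s f v)"
  by (unfold_locales) (simp_all add: lin_simps scale_right_distrib mult.commute)

lemma hX_0 [simp]: "hX i $ 0 = 0" "hY i $ 0 = 0" by (simp_all add: hX_def hY_def)

lemma hX_apply: "r > 0 \<Longrightarrow> endo_apply (hX i $ r) v = (q - inverse q) *s H i (int r) v"
  and hY_apply: "r > 0 \<Longrightarrow> endo_apply (hY i $ r) v = (- (q - inverse q)) *s H i (- int r) v"
  unfolding hX_def hY_def by (simp_all add: lin_simps[OF linear_H] scale_right_distrib scale_right_diff_distrib)

lemma linear_h: "S.linear_elt (hX i $ r)" "S.linear_elt (hY i $ r)"
  unfolding hX_def hY_def by (auto intro!: linear_endo_of linear_scaled linear_H simp del: scale_minus_left)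

lemma endo_power_apply:
  assumes "\<And>r. r > 0 \<Longrightarrow> endo_apply (F $ r) = X r" "F $ 0 = 0"
  shows "endo_apply ((F ^ m) $ a) v = op_pow X m a v"
proof (induction m arbitrary: a v)
  case (Suc m)
  have "endo_apply ((F ^ Suc m) $ a) v = (\<Sum>i=0..a. endo_apply (F $ i) (op_pow X m (a - i) v))"
    by (simp add: fps_mult_nth Suc)
  also have "\<dots> = (\<Sum>i=1..a. X i (op_pow X m (a - i) v))"
    by (rule sum.mono_neutral_cong_right) (use assms in \<open>auto simp: Suc_le_eq\<close>)
  finally show ?case by simp
qed simp

lemma expser_apply:
  assumes "\<And>r. r > 0 \<Longrightarrow> endo_apply (F $ r) = X r" "F $ 0 = 0"
  shows "endo_apply (S.expser F $ a) v = op_exp scale X a v"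
  by (simp add: S.expser_def op_exp_def endo_power_apply[OF assms])

lemma K_eq:
  "endo_apply (S.expser (hX i) $ a) v = op_exp scale (\<lambda>r u. (q - inverse q) *s H i (int r) u) a v"
  "endo_apply (S.expser (hY i) $ a) v = op_exp scale (\<lambda>r u. (- (q - inverse q)) *s H i (- int r) u) a v"
  by (rule expser_apply; use hX_apply hY_apply in \<open>auto simp del: scale_minus_left minus_diff_eq\<close>)+

lemma Kp_eq: "Kp i a v = endo_apply (kp i * S.expser (hX i) $ a) v"
  by (simp add: Kp_def K_eq)

lemma Km_eq: "Km i a v = endo_apply (km i * S.expser (hY i) $ a) v"
  by (simp only: Km_def K_eq endo_apply_simps zero_mode_apply)

lemma zero_mode_cancel:
  "kp i * x = kp i * y \<longleftrightarrow> x = y" "km i * x = km i * y \<longleftrightarrow> x = y"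
  "rp i * x = rp i * y \<longleftrightarrow> x = y" "rm i * x = rm i * y \<longleftrightarrow> x = y"
proof -
  have *: "e * x = e * y \<longleftrightarrow> x = y" if "bij f" "\<And>v. endo_apply e v = f v" for e :: "'v endo" and f
  proof
    assume eq: "e * x = e * y"
    have "f (endo_apply x v) = f (endo_apply y v)" for v
      using arg_cong[OF eq, of "\<lambda>z. endo_apply z v"] by (simp add: that)
    then show "x = y" using bij_is_inj[OF that(1)] by (intro endo_ext) (auto dest: injD)
  qed simp
  show "kp i * x = kp i * y \<longleftrightarrow> x = y" "km i * x = km i * y \<longleftrightarrow> x = y"
    "rp i * x = rp i * y \<longleftrightarrow> x = y" "rm i * x = rm i * y \<longleftrightarrow> x = y"
    using *[OF invertible(2), of "kp i" i] *[OF invertible(3), of "km i" i]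
      *[OF invertible(4), of "rp i" i] *[OF invertible(5), of "rm i" i] by simp_all
qed

lemma rp_h: "rp i * hX j $ r = hX j $ r * rp i" "rp i * hY j $ r = hY j $ r * rp i"
  and rm_h: "rm i * hX j $ r = hX j $ r * rm i" "rm i * hY j $ r = hY j $ r * rm i"
  by (cases "r = 0"; auto intro!: endo_ext simp: hX_apply hY_apply R_H lin_simps[OF linear_R(1)] lin_simps[OF linear_R(2)] simp del: scale_minus_left)+

lemma r_square: "rp i * rp i = kp i" "rm i * rm i = km i"
  by (auto intro!: endo_ext simp: R_square)

lemma r_commute: "rp i * rp j = rp j * rp i" "rm i * rm j = rm j * rm i"
  "rp i * rm j = sc (root_factor qh i j) * (rm j * rp i)"
  by (auto intro!: endo_ext simp: R_R Rp_Rm)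

lemma k_h: "kp i * hX j $ r = hX j $ r * kp i" "kp i * hY j $ r = hY j $ r * kp i"
  "km i * hX j $ r = hX j $ r * km i" "km i * hY j $ r = hY j $ r * km i"
  unfolding r_square[symmetric] by (rule mult_commute2; rule rp_h rm_h)+

lemma commute_expser:
  assumes "S.linear_elt t" "\<And>n. t * X $ n = X $ n * t"
  shows "t * S.expser X $ a = S.expser X $ a * t"
proof -
  have p: "t * (X ^ m) $ a = (X ^ m) $ a * t" for m
  proof -
    have "fps_const t * X = X * fps_const t" using fps_const_commute_iff assms(2) by blast
    then have "X ^ m * fps_const t = fps_const t * X ^ m" by (metis power_commuting_commutes)
    then show ?thesis using fps_const_commute_iff[of t "X ^ m"] by simp
  qed
  have "t * (sc c * (X ^ m) $ a) = sc c * (X ^ m) $ a * t" for c m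
  proof (rule mult_commute2[symmetric])
    show "sc c * t = t * sc c" using assms(1) by (simp add: S.linear_elt_def)
  qed (simp add: p)
  then show ?thesis
    by (simp add: S.expser_def sum_distrib_left sum_distrib_right)
qed

text \<open>
  Commutation of the \<open>K\<^sub>i\<^sup>+\<close> passes to the exponential factors, where the zero modes can be cancelled,
  and from there to the exponents, one factor at a time.
\<close>

lemma hX_hX: "hX i $ a * hX j $ b = hX j $ b * hX i $ a"
  and hY_hY: "hY i $ a * hY j $ b = hY j $ b * hY i $ a"
proof -
  have lU: "S.linear_elt (S.expser (hX i) $ a)" "S.linear_elt (S.expser (hY i) $ a)" for i a
    using linear_h by (auto intro: S.linear_expser)
  have kU: "kp i * S.expser (hX j) $ a = S.expser (hX j) $ a * kp i"
    "km i * S.expser (hY j) $ a = S.expser (hY j) $ a * km i" for i j a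
    by (intro commute_expser linear_zero_mode k_h)+
  have kk: "kp i * kp j = kp j * kp i" "km i * km j = km j * km i" for i j
    unfolding r_square[symmetric] mult_swap_middle[OF r_commute(1)] mult_swap_middle[OF r_commute(2)]
    by (simp_all only: mult_swap_middle[OF r_commute(1)] mult_swap_middle[OF r_commute(2)] r_commute(1,2)[of j i])
  have K1: "kp i * S.expser (hX i) $ a * (kp j * S.expser (hX j) $ b) = kp j * S.expser (hX j) $ b * (kp i * S.expser (hX i) $ a)" for i j a b
    using Kp_Kp unfolding Kp_eq endo_apply_simps(6)[symmetric] by (rule endo_ext)
  have "kp i * (kp j * (S.expser (hX i) $ a * S.expser (hX j) $ b)) = kp i * (kp j * (S.expser (hX j) $ b * S.expser (hX i) $ a))" for i j a b
    using K1[of i a j b] unfolding mult_swap_middle[OF kU(1)[symmetric]] kk(1)[of j i] unfolding mult.assoc .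
  then have UU: "S.expser (hX i) $ a * S.expser (hX j) $ b = S.expser (hX j) $ b * S.expser (hX i) $ a" for i j a b
    unfolding zero_mode_cancel .
  have K2: "km i * S.expser (hY i) $ a * (km j * S.expser (hY j) $ b) = km j * S.expser (hY j) $ b * (km i * S.expser (hY i) $ a)" for i j a b
    using Km_Km unfolding Km_eq endo_apply_simps(6)[symmetric] by (rule endo_ext)
  have "km i * (km j * (S.expser (hY i) $ a * S.expser (hY j) $ b)) = km i * (km j * (S.expser (hY j) $ b * S.expser (hY i) $ a))" for i j a b
    using K2[of i a j b] unfolding mult_swap_middle[OF kU(2)[symmetric]] kk(2)[of j i] unfolding mult.assoc .
  then have WW: "S.expser (hY i) $ a * S.expser (hY j) $ b = S.expser (hY j) $ b * S.expser (hY i) $ a" for i j a b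
    unfolding zero_mode_cancel .
  have XU: "hX i $ a * S.expser (hX j) $ b = S.expser (hX j) $ b * hX i $ a" for i j a b
    using S.expser_exponent_commute[OF lU(1) hX_0(1) UU] by (rule sym)
  show "hX i $ a * hX j $ b = hX j $ b * hX i $ a"
    by (rule S.expser_exponent_commute[OF linear_h(1) hX_0(1) XU])
  have YW: "hY i $ a * S.expser (hY j) $ b = S.expser (hY j) $ b * hY i $ a" for i j a b
    using S.expser_exponent_commute[OF lU(2) hX_0(2) WW] by (rule sym)
  show "hY i $ a * hY j $ b = hY j $ b * hY i $ a"
    by (rule S.expser_exponent_commute[OF linear_h(2) hX_0(2) YW])
qed

section \<open>Exchange relations of the vertex operators\<close>

definition G_normalized :: "'n mod_ring \<Rightarrow> 'n mod_ring \<Rightarrow> complex fps" where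
  "G_normalized i j =
     (if j = i then ratio (inverse (q^2)) (q^2)
      else if j = i + 1 then ratio (q * d) (inverse q * d)
      else if j = i - 1 then ratio (q * inverse d) (inverse q * inverse d)
      else 1)"

definition log_G :: "'n mod_ring \<Rightarrow> 'n mod_ring \<Rightarrow> nat \<Rightarrow> complex" where
  "log_G i j n =
     (if j = i then (q^2) ^ Suc n - inverse (q^2) ^ Suc n
      else if j = i + 1 then (inverse q * d) ^ Suc n - (q * d) ^ Suc n
      else if j = i - 1 then (inverse q * inverse d) ^ Suc n - (q * inverse d) ^ Suc n
      else 0)"

text \<open>
  The exchange series of the boundary currents at arguments \<open>q z\<close> and \<open>w\<close>, that is, the series
  \<open>G\<^bsub>i,j\<^esub>\<close> with a tilde taken at \<open>x / q\<close>, divided by its constant term.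
\<close>

definition theta_normalized :: "'n mod_ring \<Rightarrow> 'n mod_ring \<Rightarrow> complex fps" where
  "theta_normalized i j =
     (if j = i then ratio 1 q * ratio (inverse (q^2)) (inverse q)
      else if j = i + 1 then ratio d (inverse q * d)
      else if j = i - 1 then ratio (inverse d) (inverse q * inverse d)
      else 1)"

lemma log_deriv_G: "log_deriv (G_normalized i j) (log_G i j)"
  unfolding G_normalized_def log_G_def
  by (simp add: log_deriv_ratio log_deriv_1 del: power_Suc)

lemma G_series_eq: "G_series q d i j = fps_const ((root_factor qh i j)^2) * G_normalized i j"
  by (simp add: G_series_def root_factor_def G_normalized_def ratio_def Let_def mult.assoc power_inverse)

lemma log_deriv_cong: "log_deriv g l \<Longrightarrow> (\<And>n. l n = m n) \<Longrightarrow> log_deriv g m"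
  by (simp add: ext[of l m])

text \<open>
  Equivalently, \<open>\<theta>(x) \<theta>(q x)\<close> is the structure function \<open>G\<^bsub>i,j\<^esub>\<close> up to its constant term; this is where
  the weight \<open>1 / (1 + q\<^sup>n)\<close> of the boundary currents enters the scalar side.
\<close>

lemma log_deriv_theta:
  "log_deriv (theta_normalized i j) (\<lambda>n. log_G i j n / (1 + q ^ Suc n))"
proof -
  have 1: "(q^2) ^ n = (q^n)^2" "inverse (q^2) ^ n = inverse ((q^n)^2)" for n
    by (simp_all add: power_mult[symmetric] power_inverse mult.commute)
  have nz: "1 + q ^ Suc n \<noteq> 0" for n using q_power_neq(2)[of "Suc n"] by simp
  have a: "q ^ Suc n - 1 ^ Suc n + (inverse q ^ Suc n - inverse (q^2) ^ Suc n) =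
      ((q^2) ^ Suc n - inverse (q^2) ^ Suc n) / (1 + q ^ Suc n)" for n
  proof -
    have "t - 1 + (inverse t - inverse (t^2)) = (t^2 - inverse (t^2)) / (1 + t)"
      if "t \<noteq> 0" "1 + t \<noteq> 0" for t :: complex
      using that by (simp add: divide_simps) (simp add: algebra_simps power2_eq_square power4_eq_xxxx)
    from this[of "q ^ Suc n"] show ?thesis using nz[of n] unfolding 1 by (simp add: power_inverse del: power_Suc)
  qed
  have b: "(inverse q * e) ^ Suc n - e ^ Suc n = ((inverse q * e) ^ Suc n - (q * e) ^ Suc n) / (1 + q ^ Suc n)" for n e
  proof -
    have "(inverse t - 1) * u = (inverse t - t) * u / (1 + t)"
      if "t \<noteq> 0" "1 + t \<noteq> 0" for t u :: complex
      using that by (simp add: divide_simps) (simp add: algebra_simps power2_eq_square)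
    from this[of "q ^ Suc n" "e ^ Suc n"] show ?thesis
      using nz[of n] by (simp add: power_inverse power_mult_distrib algebra_simps del: power_Suc)
  qed
  show ?thesis
    unfolding theta_normalized_def log_G_def
    using log_deriv_cong[OF log_deriv_mult[OF log_deriv_ratio log_deriv_ratio] a]
      log_deriv_cong[OF log_deriv_ratio b] log_deriv_1
    by (simp del: power_Suc)
qed

text \<open>
  The logarithmic derivative of \<open>G\<^bsub>i,j\<^esub>(x) G\<^bsub>i,j\<^esub>(C\<^sup>2 x)\<close>, where \<open>C\<^sup>2 = q\<close>.
\<close>

definition log_KK :: "'n mod_ring \<Rightarrow> 'n mod_ring \<Rightarrow> nat \<Rightarrow> complex" where
  "log_KK i j n = (1 + q ^ Suc n) * log_G i j n"

lemma log_deriv_KK: "log_deriv (fps_dilate q (G_normalized i j) * G_normalized i j) (log_KK i j)"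
  by (rule log_deriv_cong[OF log_deriv_mult[OF log_deriv_dilate[OF log_deriv_G] log_deriv_G]])
    (simp add: log_KK_def algebra_simps)

lemma C_power: "(C ^^ k) v = qh ^ k *s v"
  by (induction k) (simp_all add: C_eq)

abbreviation U :: "'n mod_ring \<Rightarrow> 'v endo fps" where "U i \<equiv> S.expser (hX i)"
abbreviation W :: "'n mod_ring \<Rightarrow> 'v endo fps" where "W j \<equiv> S.expser (hY j)"

lemma linear_UW: "S.linear_elt (U i $ a)" "S.linear_elt (W i $ a)"
  using linear_h by (auto intro: S.linear_expser)

lemma k_UW: "kp i * U j $ a = U j $ a * kp i" "kp i * W j $ a = W j $ a * kp i"
  "km i * U j $ a = U j $ a * km i" "km i * W j $ a = W j $ a * km i"
  by (intro commute_expser linear_zero_mode k_h)+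

lemma exchange_Kp_Km:
  "kp i * U i $ a * (km j * W j $ b) = (\<Sum>l\<le>min a b.
     sc ((fps_const ((root_factor qh i j)^4) * (fps_dilate q (G_normalized i j) * G_normalized i j)) $ l) *
       (km j * W j $ (b - l) * (kp i * U i $ (a - l))))" (is "_ = ?R")
proof (rule endo_ext)
  fix v
  let ?G = "G_series q d i j"
  let ?Gn = "G_normalized i j" and ?r = "root_factor qh i j"
  have dil: "fps_dilate q ?G = fps_const (?r^2) * fps_dilate q ?Gn"
    unfolding G_series_eq fps_dilate_def by (rule fps_ext) simp
  have GG: "(\<Sum>m\<le>l. fps_nth ?G (l - m) * fps_nth ?G m * q ^ m) =
      (fps_const (?r^4) * (fps_dilate q ?Gn * ?Gn)) $ l" for l
  proof -
    have "(\<Sum>m\<le>l. fps_nth ?G (l - m) * fps_nth ?G m * q ^ m) = (fps_dilate q ?G * ?G) $ l"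
      unfolding fps_mult_nth fps_dilate_def atMost_atLeast0 by (rule sum.cong) auto
    also have "fps_dilate q ?G * ?G = fps_const (?r^2 * ?r^2) * (fps_dilate q ?Gn * ?Gn)"
      unfolding dil unfolding G_series_eq fps_const_mult[symmetric] by (simp only: mult_ac)
    finally show ?thesis by (simp flip: power_add)
  qed
  have "endo_apply (kp i * U i $ a * (km j * W j $ b)) v = Kp i a (Km j b v)"
    by (simp add: Kp_eq Km_eq)
  also have "\<dots> = (\<Sum>l\<le>min a b. (\<Sum>m\<le>l. fps_nth ?G (l - m) * fps_nth ?G m * q ^ m) *s
      Km j (b - l) (Kp i (a - l) v))"
    unfolding Kp_Km C_power scale_sum_left by (simp add: power_mult)
  also have "\<dots> = endo_apply ?R v" unfolding GG by (simp add: Kp_eq Km_eq)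
  finally show "endo_apply (kp i * U i $ a * (km j * W j $ b)) v = endo_apply ?R v" .
qed

lemma sc_left_commute: "S.linear_elt x \<Longrightarrow> x * (sc c * y) = sc c * (x * y)"
  unfolding S.linear_elt_def mult.assoc[symmetric] by simp

lemma root_factor_nz: "root_factor qh i j \<noteq> 0" by (simp add: root_factor_def)

lemma kp_km: "kp i * km j = sc ((root_factor qh i j)^4) * (km j * kp i)"
proof -
  have *: "U i $ 0 = 1" "W j $ 0 = 1" by (simp_all add: S.expser_def)
  have "log_deriv (fps_dilate q (G_normalized i j) * G_normalized i j) (log_KK i j)" by (rule log_deriv_KK)
  then show ?thesis using exchange_Kp_Km[of i 0 j 0] by (simp add: * log_deriv_def)
qed

text \<open>
  The constant terms of the exchange relation of \<open>K\<^sub>i\<^sup>+\<close> and \<open>K\<^sub>j\<^sup>-\<close> give the exchange of the zero modes;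
  dividing by it leaves the exchange of the exponentials.
\<close>

lemma exchange_UW:
  "U i $ a * W j $ b = (\<Sum>l\<le>min a b.
     sc ((fps_dilate q (G_normalized i j) * G_normalized i j) $ l) * (W j $ (b - l) * U i $ (a - l)))"
proof -
  let ?\<gamma> = "fps_dilate q (G_normalized i j) * G_normalized i j" and ?r = "root_factor qh i j"
  have L: "kp i * U i $ a * (km j * W j $ b) = sc (?r^4) * (km j * (kp i * (U i $ a * W j $ b)))"
    unfolding mult_swap_middle[OF k_UW(3)[symmetric]] kp_km by (simp only: mult.assoc)
  have "sc ((fps_const (?r^4) * ?\<gamma>) $ l) * (km j * W j $ b' * (kp i * U i $ a')) =
      sc (?r^4) * (km j * (kp i * (sc (?\<gamma> $ l) * (W j $ b' * U i $ a'))))" for l a' b'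
    unfolding mult_swap_middle[OF k_UW(2)[symmetric]] fps_mult_left_const_nth S.\<sigma>_mult
    by (simp only: mult.assoc sc_left_commute linear_zero_mode)
  note R = this
  have "sc (?r^4) * (km j * (kp i * (U i $ a * W j $ b))) =
    sc (?r^4) * (km j * (kp i * (\<Sum>l\<le>min a b. sc (?\<gamma> $ l) * (W j $ (b - l) * U i $ (a - l)))))"
    unfolding L[symmetric] exchange_Kp_Km R sum_distrib_left ..
  then have "sc (inverse (?r^4)) * (sc (?r^4) * (km j * (kp i * (U i $ a * W j $ b)))) =
    sc (inverse (?r^4)) * (sc (?r^4) * (km j * (kp i * (\<Sum>l\<le>min a b. sc (?\<gamma> $ l) * (W j $ (b - l) * U i $ (a - l))))))"
    by simp
  moreover have "inverse (?r^4) * ?r^4 = 1" using root_factor_nz[of i j] by simp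
  ultimately show ?thesis
    unfolding mult.assoc[symmetric] S.\<sigma>_mult[symmetric] by (simp add: mult.assoc zero_mode_cancel del: left_inverse)
qed

lemma is_exp_UW: "is_fps_exp (hX i) (U i)" "is_fps_exp (hY j) (W j)"
  by (rule S.is_fps_exp_expser; (rule linear_h hX_0 hX_hX hY_hY))+

text \<open>
  The Heisenberg relation, recovered from the exchange of the exponentials.
\<close>

lemma commutator_h:
  "fps_deriv (hX i) $ a * fps_deriv (hY j) $ b - fps_deriv (hY j) $ b * fps_deriv (hX i) $ a =
    (if a = b then sc (of_nat (Suc a) * log_KK i j a) else 0)"
proof -
  have "(fps_dilate q (G_normalized i j) * G_normalized i j) $ 0 = 1"
    "fps_deriv (fps_dilate q (G_normalized i j) * G_normalized i j) =
      Abs_fps (log_KK i j) * (fps_dilate q (G_normalized i j) * G_normalized i j)"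
    using log_deriv_KK[of i j] unfolding log_deriv_def by blast+
  from S.exponents_from_exchange[OF is_exp_UW linear_UW this exchange_UW]
  show ?thesis by (simp only: fps_nth_Abs_fps)
qed

lemma deriv_rescale: "fps_deriv (S.rescale c X) $ n = sc (c (Suc n)) * fps_deriv X $ n"
  by (simp add: S.of_nat_mult_left_commute del: of_nat_Suc)

text \<open>
  Rescaling the exponents rescales their commutators, and only the commutators enter the exchange
  of the exponentials.
\<close>

lemma exchange_rescaled:
  assumes \<gamma>: "log_deriv \<gamma> lam" and lam: "\<And>n. lam n = c (Suc n) * c' (Suc n) * log_KK i j n"
  shows "S.expser (S.rescale c (hX i)) $ a * S.expser (S.rescale c' (hY j)) $ b =
    (\<Sum>l\<le>min a b. sc (\<gamma> $ l) *
       (S.expser (S.rescale c' (hY j)) $ (b - l) * S.expser (S.rescale c (hX i)) $ (a - l)))"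
proof (rule S.exchange_from_exponents)
  show "is_fps_exp (S.rescale c (hX i)) (S.expser (S.rescale c (hX i)))"
    by (rule S.is_fps_exp_rescale; (rule linear_h hX_0 hX_hX))
  show "is_fps_exp (S.rescale c' (hY j)) (S.expser (S.rescale c' (hY j)))"
    by (rule S.is_fps_exp_rescale; (rule linear_h hX_0 hY_hY))
  show "S.linear_elt (S.rescale c (hX i) $ n)" "S.linear_elt (S.rescale c' (hY j) $ n)" for n
    by (rule S.linear_rescale; rule linear_h)+
  show "\<gamma> $ 0 = 1" "fps_deriv \<gamma> = Abs_fps lam * \<gamma>" using \<gamma> by (simp_all add: log_deriv_def)
  fix a b
  have lin: "S.linear_elt (fps_deriv (hX i) $ a)" "S.linear_elt (fps_deriv (hY j) $ b)"
    by (rule S.linear_deriv; rule linear_h)+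
  have "sc s * x * (sc t * y) - sc t * y * (sc s * x) = sc (s * t) * (x * y - y * x)"
    if "S.linear_elt x" "S.linear_elt y" for s t x y
  proof -
    have "sc s * x * (sc t * y) = sc (s * t) * (x * y)"
      by (simp only: mult.assoc sc_left_commute[OF that(1)] S.\<sigma>_mult)
    moreover have "sc t * y * (sc s * x) = sc (t * s) * (y * x)"
      by (simp only: mult.assoc sc_left_commute[OF that(2)] S.\<sigma>_mult)
    ultimately show ?thesis by (simp add: right_diff_distrib mult.commute)
  qed
  from this[OF lin] show "fps_deriv (S.rescale c (hX i)) $ a * fps_deriv (S.rescale c' (hY j)) $ b -
      fps_deriv (S.rescale c' (hY j)) $ b * fps_deriv (S.rescale c (hX i)) $ a =
      (if a = b then sc (of_nat (Suc a) * Abs_fps lam $ a) else 0)"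
    unfolding deriv_rescale commutator_h
    by (auto simp: lam S.\<sigma>_mult[symmetric] mult_ac simp del: of_nat_Suc)
qed

text \<open>
  Attaching zero modes multiplies the exchange series by the factor that the zero modes exchange
  with.
\<close>

lemma dressed_exchange:
  assumes z: "z * z' = sc g * (z' * z)"
    and zw: "\<And>n. z * w $ n = w $ n * z" and zu: "\<And>n. z' * u $ n = u $ n * z'"
    and lin: "S.linear_elt z" "S.linear_elt z'"
    and ex: "\<And>a b. u $ a * w $ b = (\<Sum>l\<le>min a b. sc (\<gamma> $ l) * (w $ (b - l) * u $ (a - l)))"
  shows "z * u $ a * (z' * w $ b) =
    (\<Sum>l\<le>min a b. sc ((fps_const g * \<gamma>) $ l) * (z' * w $ (b - l) * (z * u $ (a - l))))"
proof -
  have "z * u $ a * (z' * w $ b) = sc g * (z' * (z * (u $ a * w $ b)))"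
    unfolding mult_swap_middle[OF zu[symmetric]] z by (simp only: mult.assoc)
  also have "\<dots> = (\<Sum>l\<le>min a b. sc ((fps_const g * \<gamma>) $ l) * (z' * w $ (b - l) * (z * u $ (a - l))))"
    unfolding ex sum_distrib_left
  proof (rule sum.cong, rule refl)
    fix l
    show "sc g * (z' * (z * (sc (\<gamma> $ l) * (w $ (b - l) * u $ (a - l))))) =
        sc ((fps_const g * \<gamma>) $ l) * (z' * w $ (b - l) * (z * u $ (a - l)))"
      unfolding mult_swap_middle[OF zw[symmetric]] fps_mult_left_const_nth S.\<sigma>_mult
      by (simp only: mult.assoc sc_left_commute lin)
  qed
  finally show ?thesis .
qed

abbreviation tw :: "nat \<Rightarrow> complex" where "tw n \<equiv> 1 / (1 + q ^ n)"

text \<open>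
  The coefficients of the root of \<open>K\<^sub>i\<^sup>+\<close> at \<open>q z\<close> and of the root of \<open>K\<^sub>i\<^sup>-\<close> at \<open>z\<close>.
\<close>

definition P :: "'n mod_ring \<Rightarrow> nat \<Rightarrow> 'v endo" where
  "P i a = rp i * S.expser (S.rescale tw (hX i)) $ a"

definition M :: "'n mod_ring \<Rightarrow> nat \<Rightarrow> 'v endo" where
  "M i b = rm i * S.expser (S.rescale tw (hY i)) $ b"

lemma rescale_1: "S.rescale (\<lambda>n. 1) X = X"
  by (rule fps_ext) simp

lemma r_expser: "rp i * S.expser (S.rescale c (hX j)) $ a = S.expser (S.rescale c (hX j)) $ a * rp i"
    "rp i * S.expser (S.rescale c (hY j)) $ a = S.expser (S.rescale c (hY j)) $ a * rp i"
    "rm i * S.expser (S.rescale c (hX j)) $ a = S.expser (S.rescale c (hX j)) $ a * rm i"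
    "rm i * S.expser (S.rescale c (hY j)) $ a = S.expser (S.rescale c (hY j)) $ a * rm i"
  by (rule commute_expser linear_zero_mode; simp add: sc_left_commute linear_zero_mode mult.assoc rp_h rm_h)+

lemma k_expser: "kp i * S.expser (S.rescale c (hX j)) $ a = S.expser (S.rescale c (hX j)) $ a * kp i"
    "kp i * S.expser (S.rescale c (hY j)) $ a = S.expser (S.rescale c (hY j)) $ a * kp i"
    "km i * S.expser (S.rescale c (hX j)) $ a = S.expser (S.rescale c (hX j)) $ a * km i"
    "km i * S.expser (S.rescale c (hY j)) $ a = S.expser (S.rescale c (hY j)) $ a * km i"
  by (rule commute_expser linear_zero_mode; simp add: sc_left_commute linear_zero_mode mult.assoc k_h)+

lemma linear_expser_h: "S.linear_elt (S.expser (S.rescale c (hX j)) $ a)" "S.linear_elt (S.expser (S.rescale c (hY j)) $ a)"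
  by (intro S.linear_expser S.linear_rescale linear_h)+

definition theta :: "'n mod_ring \<Rightarrow> 'n mod_ring \<Rightarrow> complex fps" where
  "theta i j = fps_const (root_factor qh i j) * theta_normalized i j"

lemma q1_nz: "1 + q ^ Suc n \<noteq> 0" using q_power_neq(2)[of "Suc n"] by blast

lemma P_M: "P i a * M j b = (\<Sum>l\<le>min a b. sc (theta i j $ l) * (M j (b - l) * P i (a - l)))"
  unfolding P_def M_def theta_def
  by (rule dressed_exchange[OF r_commute(3) r_expser(2) r_expser(3) linear_zero_mode(3,4)],
      rule exchange_rescaled[OF log_deriv_theta])
    (use q1_nz in \<open>simp add: log_KK_def divide_simps del: power_Suc\<close>)

lemma kp_rm: "kp i * rm j = sc ((root_factor qh i j)^2) * (rm j * kp i)"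
proof -
  have "rp i * (rp i * rm j) = sc ((root_factor qh i j)^2) * (rm j * (rp i * rp i))"
    unfolding r_commute(3) sc_left_commute[OF linear_zero_mode(3)]
    unfolding mult.assoc[symmetric, of "rp i" "rm j"] r_commute(3) power2_eq_square S.\<sigma>_mult
    by (simp only: mult.assoc)
  then show ?thesis unfolding r_square mult.assoc[symmetric] .
qed

lemma rp_km: "rp i * km j = sc ((root_factor qh i j)^2) * (km j * rp i)"
proof -
  have "rp i * rm j * rm j = sc ((root_factor qh i j)^2) * (rm j * rm j * rp i)"
    unfolding r_commute(3) unfolding mult.assoc r_commute(3) sc_left_commute[OF linear_zero_mode(4)]
      power2_eq_square S.\<sigma>_mult ..
  then show ?thesis unfolding mult.assoc[of "rp i"] r_square .
qed

definition KP :: "'n mod_ring \<Rightarrow> nat \<Rightarrow> 'v endo" where "KP i a = kp i * U i $ a"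
definition KM :: "'n mod_ring \<Rightarrow> nat \<Rightarrow> 'v endo" where "KM i b = km i * W i $ b"

lemma KP_M: "KP i a * M j b = (\<Sum>l\<le>min a b. sc (G_series q d i j $ l) * (M j (b - l) * KP i (a - l)))"
  unfolding KP_def M_def G_series_eq
  by (rule dressed_exchange[OF kp_rm k_expser(2) _ linear_zero_mode(1,4)], rule r_expser(3)[where c = "\<lambda>n. 1", unfolded rescale_1],
      rule exchange_rescaled[OF log_deriv_G, where c = "\<lambda>n. 1", unfolded rescale_1])
    (use q1_nz in \<open>simp add: log_KK_def divide_simps del: power_Suc\<close>)

lemma P_KM: "P i a * KM j b = (\<Sum>l\<le>min a b. sc (G_series q d i j $ l) * (KM j (b - l) * P i (a - l)))"
  unfolding KM_def P_def G_series_eq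
  by (rule dressed_exchange[OF rp_km _ k_expser(3) linear_zero_mode(3,2)], rule r_expser(2)[where c = "\<lambda>n. 1", unfolded rescale_1],
      rule exchange_rescaled[OF log_deriv_G, where c' = "\<lambda>n. 1", unfolded rescale_1])
    (use q1_nz in \<open>simp add: log_KK_def divide_simps del: power_Suc\<close>)

end

section \<open>The commutators of the Heisenberg generators\<close>

lemma matrix_inverse_exists:
  fixes A :: "'i::finite \<Rightarrow> 'i \<Rightarrow> complex"
  assumes ker: "\<And>x. (\<And>i. (\<Sum>j\<in>UNIV. A i j * x j) = 0) \<Longrightarrow> (\<And>i. x i = 0)"
  shows "\<exists>B. (\<forall>i k. (\<Sum>j\<in>UNIV. A i j * B j k) = (if i = k then 1 else 0)) \<and>
    (\<forall>i k. (\<Sum>j\<in>UNIV. B i j * A j k) = (if i = k then 1 else 0))"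
proof -
  define m where "m = vec_lambda (\<lambda>i. vec_lambda (A i))"
  have "m *v x = 0 \<longrightarrow> x = 0" for x
  proof
    assume "m *v x = 0"
    then have "vec_nth (m *v x) i = 0" for i by simp
    then have "(\<Sum>j\<in>UNIV. A i j * vec_nth x j) = 0" for i
      by (simp add: matrix_vector_mult_def m_def)
    then show "x = 0" using ker[of "vec_nth x"] by (simp add: vec_eq_iff)
  qed
  then obtain b where b: "b ** m = mat 1" using matrix_left_invertible_ker by blast
  then have b': "m ** b = mat 1" using matrix_left_right_inverse by blast
  show ?thesis
  proof (intro exI conjI allI)
    fix i k
    show "(\<Sum>j\<in>UNIV. A i j * vec_nth (vec_nth b j) k) = (if i = k then 1 else 0)"
      using arg_cong[OF b', of "\<lambda>m. vec_nth (vec_nth m i) k"]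
      by (simp add: matrix_matrix_mult_def mat_def m_def)
    show "(\<Sum>j\<in>UNIV. vec_nth (vec_nth b i) j * A j k) = (if i = k then 1 else 0)"
      using arg_cong[OF b, of "\<lambda>m. vec_nth (vec_nth m i) k"]
      by (simp add: matrix_matrix_mult_def mat_def m_def)
  qed
qed

text \<open>
  Going once around the cycle multiplies \<open>f i\<close> by \<open>c\<^sup>n\<close>.
\<close>

lemma cyclic_geometric_zero:
  fixes f :: "'n::nontriv mod_ring \<Rightarrow> complex"
  assumes rec: "\<And>i. f (i + 1) = c * f i" and c: "c ^ CARD('n) \<noteq> 1"
  shows "f i = 0"
proof -
  have "f (i + of_nat k) = c ^ k * f i" for k
  proof (induction k)
    case (Suc k)
    have "f (i + of_nat (Suc k)) = f ((i + of_nat k) + 1)" by (simp add: ac_simps)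
    also have "\<dots> = c * (c ^ k * f i)" unfolding rec Suc.IH ..
    finally show ?case by simp
  qed simp
  from this[of "CARD('n)"] have "f i = c ^ CARD('n) * f i"
    by simp
  then have "(1 - c ^ CARD('n)) * f i = 0" by (simp add: algebra_simps)
  then show ?thesis using c by simp
qed

context boundary_module
begin

lemma index_distinct: "(1 :: 'n mod_ring) \<noteq> - 1" "(1 :: 'n mod_ring) \<noteq> 0"
proof -
  show "(1 :: 'n mod_ring) \<noteq> 0" by simp
  show "(1 :: 'n mod_ring) \<noteq> - 1"
  proof
    assume "(1 :: 'n mod_ring) = - 1"
    then have "of_int_mod_ring 2 = (0 :: 'n mod_ring)"
      by (metis add.right_inverse o_apply of_int_numeral of_nat_numeral of_nat_of_int_mod_ring one_add_one)
    then have "2 mod int CARD('n) = 0"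
      by (metis of_int_mod_ring.rep_eq zero_mod_ring.rep_eq)
    then show False using card_n by simp
  qed
qed

text \<open>
  Since \<open>n \<ge> 3\<close>, the two neighbours of an index are distinct.
\<close>

lemma index_neq [simp]: "i + 1 \<noteq> (i :: 'n mod_ring)" "i \<noteq> i + 1" "i - 1 \<noteq> (i :: 'n mod_ring)" "i \<noteq> i - 1"
  "i + 1 \<noteq> (i - 1 :: 'n mod_ring)" "i - 1 \<noteq> (i + 1 :: 'n mod_ring)"
proof -
  show "i + 1 \<noteq> i" "i \<noteq> i + 1" "i - 1 \<noteq> i" "i \<noteq> i - 1" by (simp_all add: algebra_simps)
  have "i + 1 = i - 1 \<longleftrightarrow> (1 :: 'n mod_ring) = - 1" by (metis add_left_cancel diff_conv_add_uminus)
  then show "i + 1 \<noteq> i - 1" "i - 1 \<noteq> i + 1" using index_distinct by metis+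
qed

abbreviation qq :: complex where "qq \<equiv> q - inverse q"

lemma qq_nz: "qq \<noteq> 0"
  using q_power_neq(1)[of 2] by (simp add: field_simps power2_eq_square)

text \<open>
  The commutator of \<open>H\<^bsub>i,r\<^esub>\<close> with \<open>H\<^bsub>j,-r\<^esub>\<close>.
\<close>

definition hc :: "'n mod_ring \<Rightarrow> 'n mod_ring \<Rightarrow> nat \<Rightarrow> complex" where
  "hc i j r = - log_KK i j (r - 1) / (of_nat r * qq^2)"

lemma lin_H: "r \<noteq> 0 \<Longrightarrow> H i r (x + y) = H i r x + H i r y" "r \<noteq> 0 \<Longrightarrow> H i r (c *s x) = c *s H i r x"
  "r \<noteq> 0 \<Longrightarrow> H i r 0 = 0" "r \<noteq> 0 \<Longrightarrow> H i r (x - y) = H i r x - H i r y"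
  "r \<noteq> 0 \<Longrightarrow> H i r (sum g A) = (\<Sum>a\<in>A. H i r (g a))"
  using lin_simps[OF linear_H] by blast+

lemma H_H_same_sign:
  assumes "r * s > 0"
  shows "H i r (H j s v) = H j s (H i r v)"
proof -
  have *: "(c * c) *s x = (c * c) *s y \<Longrightarrow> x = y" if "c = qq \<or> c = - qq" for c and x y :: 'v
    using that qq_nz by auto
  consider "r > 0" "s > 0" | "r < 0" "s < 0" using assms by (auto simp: zero_less_mult_iff)
  then show ?thesis
  proof cases
    case 1
    have "endo_apply (hX i $ nat r * hX j $ nat s) v = endo_apply (hX j $ nat s * hX i $ nat r) v"
      using hX_hX by simp
    then show ?thesis using 1 *[of qq] by (simp add: hX_apply lin_H)
  next
    case 2
    have "endo_apply (hY i $ nat (-r) * hY j $ nat (-s)) v = endo_apply (hY j $ nat (-s) * hY i $ nat (-r)) v"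
      using hY_hY by simp
    then show ?thesis using 2 *[of "-qq"] by (simp add: hY_apply lin_H del: scale_minus_left minus_diff_eq)
  qed
qed

lemma H_H_opposite:
  assumes "r > 0" "s > 0"
  shows "H i (int r) (H j (- int s) v) - H j (- int s) (H i (int r) v) = (if r = s then hc i j r else 0) *s v"
proof -
  obtain a b where ab: "r = Suc a" "s = Suc b" using assms by (cases r; cases s) auto
  have n: "of_nat k = sc (of_nat k)" for k by (rule S.\<sigma>_of_nat[symmetric])
  define x where "x = H i (int r) (H j (- int s) v) - H j (- int s) (H i (int r) v)"
  have "endo_apply (fps_deriv (hX i) $ a * fps_deriv (hY j) $ b - fps_deriv (hY j) $ b * fps_deriv (hX i) $ a) v =
      (of_nat r * of_nat s * qq * (- qq)) *s x"
    unfolding x_def ab fps_deriv_nth n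
    by (simp add: hX_apply hY_apply lin_H scale_right_diff_distrib mult_ac
        del: of_nat_Suc of_nat_add scale_minus_left minus_diff_eq)
  then have *: "(of_nat r * of_nat s * qq * (- qq)) *s x = (if a = b then of_nat r * log_KK i j a else 0) *s v"
    unfolding commutator_h by (auto simp: ab simp del: of_nat_Suc)
  have nz: "of_nat r * of_nat s * qq * (- qq) \<noteq> 0" using qq_nz assms by simp
  have "(of_nat r * of_nat s * qq * (- qq)) * (if r = s then hc i j r else 0) =
      (if a = b then of_nat r * log_KK i j a else 0)"
  proof -
    have "n * n * c * (- c) * (- l / (n * c^2)) = n * l" if "n \<noteq> 0" "c \<noteq> 0" for n c l :: complex
      using that by (simp add: power2_eq_square)
    from this[of "of_nat r" qq "log_KK i j a"] assms qq_nz
    have "(of_nat r * of_nat r * qq * (- qq)) * hc i j r = of_nat r * log_KK i j (r - 1)"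
      unfolding ab(1) hc_def by (simp only: of_nat_eq_0_iff diff_Suc_1 nat.distinct simp_thms)
    moreover have "r - 1 = a" "(r = s) = (a = b)" by (simp_all add: ab)
    ultimately show ?thesis by (cases "r = s") (simp_all only: if_True if_False mult_zero_right simp_thms)
  qed
  from *[folded this] have "(of_nat r * of_nat s * qq * (- qq)) *s x =
      (of_nat r * of_nat s * qq * (- qq)) *s ((if r = s then hc i j r else 0) *s v)"
    by (simp only: scale_scale)
  then show ?thesis using nz unfolding x_def[symmetric] by (simp only: scale_cancel_left simp_thms)

qed

lemma log_G_values:
  "log_G i i n = (q^2) ^ Suc n - inverse (q^2) ^ Suc n"
  "log_G i (i + 1) n = (inverse q * d) ^ Suc n - (q * d) ^ Suc n"
  "log_G i (i - 1) n = (inverse q * inverse d) ^ Suc n - (q * inverse d) ^ Suc n"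
  by (simp_all only: log_G_def index_neq if_True if_False simp_thms)

text \<open>
  A kernel vector satisfies a linear recurrence of second order along the cycle, with characteristic
  roots \<open>q\<^sup>r d\<^sup>-\<^sup>r\<close> and \<open>q\<^sup>-\<^sup>r d\<^sup>-\<^sup>r\<close>.  Genericity says that neither is a root of unity, so no nonzero solution
  closes up after \<open>n\<close> steps.
\<close>

lemma hc_kernel:
  assumes r: "r > 0" and ker: "\<And>i. (\<Sum>j\<in>UNIV. hc i j r * x j) = 0"
  shows "x i = 0"
proof -
  define t D where t: "t = q ^ r" and D: "D = d ^ r"
  have nz: "t \<noteq> 0" "D \<noteq> 0" by (auto simp: t D)
  have Suc: "Suc (r - 1) = r" using r by simp
  have rec: "D * x (i + 1) = (t + inverse t) * x i - inverse D * x (i - 1)" for i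
  proof -
    have "(\<Sum>j\<in>UNIV. hc i j r * x j) = (\<Sum>j\<in>{i, i + 1, i - 1}. hc i j r * x j)"
      by (rule sum.mono_neutral_right) (auto simp: hc_def log_KK_def log_G_def)
    also have "\<dots> = hc i i r * x i + hc i (i + 1) r * x (i + 1) + hc i (i - 1) r * x (i - 1)"
      by simp
    finally have 1: "hc i i r * x i + hc i (i + 1) r * x (i + 1) + hc i (i - 1) r * x (i - 1) = 0"
      using ker by simp
    define k where "k = - (1 + t) / (of_nat r * qq^2)"
    have k: "k \<noteq> 0" using q_power_neq(2)[OF r] qq_nz r by (simp add: k_def t neg_eq_iff_add_eq_0)
    have pw: "(q^2) ^ r = t^2" "inverse (q^2) ^ r = inverse t ^ 2" "(inverse q * d) ^ r = inverse t * D"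
      "(q * d) ^ r = t * D" "(inverse q * inverse d) ^ r = inverse t * inverse D"
      "(q * inverse d) ^ r = t * inverse D"
    proof -
      have sq: "(a^2) ^ r = (a ^ r)^2" for a :: complex by (simp add: power_mult[symmetric] mult.commute)
      show "(q^2) ^ r = t^2" "inverse (q^2) ^ r = inverse t ^ 2"
        unfolding t sq[symmetric] by (simp_all only: power_inverse sq)
    qed (simp_all only: power_mult_distrib power_inverse t D)
    have hc': "hc i i r = k * (t^2 - inverse t ^ 2)" "hc i (i + 1) r = k * (D * (inverse t - t))"
      "hc i (i - 1) r = k * (inverse D * (inverse t - t))"
      unfolding hc_def log_KK_def log_G_values Suc pw k_def
      by (simp_all add: t[symmetric] algebra_simps del: power_inverse)
    have tt: "t^2 \<noteq> 1" unfolding t by (rule q_power_square_neq_1[OF r])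
    have fac: "k * (t^2 - inverse t ^ 2) * a + k * (D * (inverse t - t)) * b + k * (E * (inverse t - t)) * c =
       k * ((t - inverse t) * ((t + inverse t) * a - D * b - E * c))" for a b c E
      by (simp add: algebra_simps power2_eq_square)
    have "k * ((t - inverse t) * ((t + inverse t) * x i - D * x (i + 1) - inverse D * x (i - 1))) = 0"
      using 1 unfolding hc' fac .
    moreover have "t - inverse t \<noteq> 0"
    proof
      assume "t - inverse t = 0"
      then have "t * t = inverse t * t" by simp
      then show False using tt nz by (simp add: power2_eq_square)
    qed
    ultimately have "(t + inverse t) * x i - D * x (i + 1) - inverse D * x (i - 1) = 0"
      using k by (metis mult_eq_0_iff)
    then show ?thesis by (simp add: algebra_simps)
  qed
  define y where "y i = D * x (i + 1) - t * x i" for i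
  \<comment> \<open>dividing the recurrence by one characteristic root leaves a geometric sequence for the other\<close>
  have yrec: "y (i + 1) = inverse (t * D) * y i" for i
  proof -
    have "y (i + 1) = inverse t * x (i + 1) - inverse D * x i"
      unfolding y_def rec[of "i + 1"] by (simp add: algebra_simps)
    then show ?thesis using nz by (simp add: y_def field_simps)
  qed
  have rn: "r * CARD('n) > 0" using r by simp
  have p: "inverse q * d * q^2 = q * d" by (simp add: power2_eq_square field_simps)
  have 1: "inverse (t * D) ^ CARD('n) \<noteq> 1"
  proof
    assume "inverse (t * D) ^ CARD('n) = 1"
    then have "(t * D) ^ CARD('n) = 1" by (simp only: power_inverse inverse_eq_1_iff)
    then have "(q * d) ^ (r * CARD('n)) = 1"
      by (simp only: t D power_mult power_mult_distrib)
    then have "(inverse q * d) powi int (r * CARD('n)) * (q^2) powi int (r * CARD('n)) = 1"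
      unfolding p[symmetric] power_int_of_nat by (simp add: power_mult_distrib)
    then show False using genericD rn by (metis of_nat_0_eq_iff less_numeral_extra(3))
  qed
  have y0: "y i = 0" for i by (rule cyclic_geometric_zero[of y, OF yrec 1])
  have xrec: "x (i + 1) = (t * inverse D) * x i" for i
    using y0[of i] nz by (simp add: y_def field_simps)
  have 2: "(t * inverse D) ^ CARD('n) \<noteq> 1"
  proof
    assume *: "(t * inverse D) ^ CARD('n) = 1"
    have "(inverse q * d) ^ (r * CARD('n)) = inverse ((t * inverse D) ^ CARD('n))"
      by (simp add: t D power_inverse power_mult power_mult_distrib)
    then have "(inverse q * d) powi int (r * CARD('n)) * (q^2) powi 0 = 1"
      unfolding power_int_of_nat using * by simp
    then show False using genericD rn by (metis of_nat_0_eq_iff less_numeral_extra(3))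
  qed
  show ?thesis by (rule cyclic_geometric_zero[of x, OF xrec 2])
qed

lemma hB_exists: "\<exists>B. r > 0 \<longrightarrow>
    (\<forall>i k. (\<Sum>j\<in>UNIV. hc i j r * B j k) = (if i = k then 1 else 0)) \<and>
    (\<forall>i k. (\<Sum>j\<in>UNIV. B i j * hc j k r) = (if i = k then 1 else 0))"
  using matrix_inverse_exists[of "\<lambda>i j. hc i j r"] hc_kernel[of r] by blast

text \<open>
  The inverse of the matrix of commutators in degree \<open>r\<close>.
\<close>

definition hB :: "nat \<Rightarrow> 'n mod_ring \<Rightarrow> 'n mod_ring \<Rightarrow> complex" where
  "hB r = (SOME B. r > 0 \<longrightarrow>
    (\<forall>i k. (\<Sum>j\<in>UNIV. hc i j r * B j k) = (if i = k then 1 else 0)) \<and>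
    (\<forall>i k. (\<Sum>j\<in>UNIV. B i j * hc j k r) = (if i = k then 1 else 0)))"

lemma hB: assumes "r > 0"
  shows "(\<Sum>j\<in>UNIV. hc i j r * hB r j k) = (if i = k then 1 else 0)"
    "(\<Sum>j\<in>UNIV. hB r i j * hc j k r) = (if i = k then 1 else 0)"
  using someI_ex[OF hB_exists[of r]] assms unfolding hB_def[symmetric] by blast+

definition euler_part :: "nat \<Rightarrow> 'v \<Rightarrow> 'v" where
  "euler_part r v = (\<Sum>j\<in>UNIV. \<Sum>k\<in>UNIV. (of_nat r * hB r j k) *s H j (- int r) (H k (int r) v))"

text \<open>
  The inverse matrix in the quadratic expression cancels the commutator that is produced when the
  generator is moved through it.
\<close>

lemma euler_part_H:
  assumes r: "r > 0" and s: "s \<noteq> 0"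
  shows "euler_part r (H i s v) = H i s (euler_part r v) -
    (if int r = \<bar>s\<bar> then of_int s *s H i s v else 0)"
proof (cases "s > 0")
  case True
  then obtain p where p: "s = int p" "p > 0" by (metis zero_less_imp_eq_int)
  have HHH: "H j (- int r) (H k (int r) (H i s v)) = H i s (H j (- int r) (H k (int r) v)) -
      (if r = p then hc i j r else 0) *s H k (int r) v" for j k
    using H_H_opposite[OF p(2) r, of i j "H k (int r) v"] H_H_same_sign[of "int r" s k i v] r p
    by (auto simp: algebra_simps)
  have "euler_part r (H i s v) = H i s (euler_part r v) -
     (\<Sum>j\<in>UNIV. \<Sum>k\<in>UNIV. (of_nat r * hB r j k) *s (if r = p then hc i j r else 0) *s H k (int r) v)"
    unfolding euler_part_def HHH using s
    by (simp add: lin_H sum_subtractf scale_right_diff_distrib)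
  also have "(\<Sum>j\<in>UNIV. \<Sum>k\<in>UNIV. (of_nat r * hB r j k) *s (if r = p then hc i j r else 0) *s H k (int r) v) =
     (\<Sum>k\<in>UNIV. (if r = p then of_nat r * (\<Sum>j\<in>UNIV. hc i j r * hB r j k) else 0) *s H k (int r) v)"
    by (subst sum.swap) (auto simp: scale_sum_left sum_distrib_left mult_ac intro!: sum.cong)
  also have "\<dots> = (if r = p then of_nat r *s H i (int r) v else 0)"
  proof -
    have "(\<Sum>k\<in>UNIV. (of_nat r * (if i = k then 1 else 0)) *s H k (int r) v) =
        (\<Sum>k\<in>UNIV. if i = k then of_nat r *s H k (int r) v else 0)"
      by (intro sum.cong refl) auto
    also have "\<dots> = of_nat r *s H i (int r) v" by simp
    finally show ?thesis unfolding hB[OF r]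
      by (cases "r = p") (simp_all only: if_True if_False simp_thms refl scale_zero_left sum.neutral_const)
  qed
  finally show ?thesis using p by simp
next
  case False
  then obtain p where p: "s = - int p" "p > 0" using s by (metis linorder_neqE_linordered_idom neg_0_less_iff_less zero_less_imp_eq_int minus_minus)
  have HHH: "H j (- int r) (H k (int r) (H i s v)) = H i s (H j (- int r) (H k (int r) v)) +
      (if r = p then hc k i r else 0) *s H j (- int r) v" for j k
  proof -
    have "H k (int r) (H i s v) = H i s (H k (int r) v) + (if r = p then hc k i r else 0) *s v"
      using H_H_opposite[OF r p(2), of k i v] p by (simp add: algebra_simps)
    moreover have "H j (- int r) (H i s u) = H i s (H j (- int r) u)" for u
      using H_H_same_sign[of "- int r" s j i u] r p by simp
    ultimately show ?thesis using r by (simp add: lin_H)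
  qed
  have "euler_part r (H i s v) = H i s (euler_part r v) +
     (\<Sum>j\<in>UNIV. \<Sum>k\<in>UNIV. (of_nat r * hB r j k) *s (if r = p then hc k i r else 0) *s H j (- int r) v)"
    unfolding euler_part_def HHH using s
    by (simp add: lin_H sum.distrib scale_right_distrib)
  also have "(\<Sum>j\<in>UNIV. \<Sum>k\<in>UNIV. (of_nat r * hB r j k) *s (if r = p then hc k i r else 0) *s H j (- int r) v) =
     (\<Sum>j\<in>UNIV. (if r = p then of_nat r * (\<Sum>k\<in>UNIV. hB r j k * hc k i r) else 0) *s H j (- int r) v)"
    by (auto simp: scale_sum_left sum_distrib_left mult_ac intro!: sum.cong)
  also have "\<dots> = (if r = p then of_nat r *s H i (- int r) v else 0)"
  proof -
    have "(\<Sum>j\<in>UNIV. (of_nat r * (if j = i then 1 else 0)) *s H j (- int r) v) =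
        (\<Sum>j\<in>UNIV. if i = j then of_nat r *s H j (- int r) v else 0)"
      by (intro sum.cong refl) auto
    also have "\<dots> = of_nat r *s H i (- int r) v" by simp
    finally show ?thesis unfolding hB[OF r]
      by (cases "r = p") (simp_all only: if_True if_False simp_thms refl scale_zero_left sum.neutral_const)
  qed
  finally show ?thesis using p by simp
qed

end

context vector_space
begin

section \<open>The Euler operator and its eigenspaces\<close>

text \<open>
  An invariant subspace of the image pulls back to an invariant subspace.
\<close>

lemma irreducible_on_image:
  assumes irr: "irreducible_on ops S" and f: "Vector_Spaces.linear scale scale f"
    and com: "\<And>g v. g \<in> ops \<Longrightarrow> f (g v) = g (f v)" and nz: "f ` S \<noteq> {0}"
  shows "irreducible_on ops (f ` S)"
proof -
  interpret f: Vector_Spaces.linear scale scale f by fact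
  have S: "subspace S" "\<And>g. g \<in> ops \<Longrightarrow> g ` S \<subseteq> S"
    and min: "\<And>T. subspace T \<Longrightarrow> T \<subseteq> S \<Longrightarrow> (\<forall>g\<in>ops. g ` T \<subseteq> T) \<Longrightarrow> T = {0} \<or> T = S"
    using irr unfolding irreducible_on_def by auto
  have min': "T = {0} \<or> T = f ` S" if T: "subspace T" "T \<subseteq> f ` S" "\<forall>g\<in>ops. g ` T \<subseteq> T" for T
  proof -
    define T' where "T' = {s \<in> S. f s \<in> T}"
    have "subspace T'" unfolding T'_def using S(1) T(1)
      by (auto simp: subspace_def f.add f.scale f.zero)
    moreover have "\<forall>g\<in>ops. g ` T' \<subseteq> T'" using S(2) T(3) com by (auto simp: T'_def image_subset_iff)
    ultimately have "T' = {0} \<or> T' = S" using min[of T'] by (auto simp: T'_def)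
    moreover have "T = f ` T'" using T(2) by (auto simp: T'_def)
    ultimately show ?thesis by (auto simp: f.zero)
  qed
  have inv: "g ` f ` S \<subseteq> f ` S" if "g \<in> ops" for g
    using S(2)[OF that] by (auto simp: image_subset_iff simp flip: com[OF that])
  show ?thesis unfolding irreducible_on_def
  proof (intro conjI ballI allI impI)
    show "subspace (f ` S)" by (rule f.subspace_image[OF S(1)])
    show "T = {0} \<or> T = f ` S" if "subspace T \<and> T \<subseteq> f ` S \<and> (\<forall>g\<in>ops. g ` T \<subseteq> T)" for T
      by (rule min') (use that in simp_all)
  qed (use nz inv in simp_all)
qed

lemma span_UN_decompose:
  assumes V: "\<And>k. subspace (V k)" and x: "x \<in> span (\<Union>k\<in>K. V k)"
  shows "\<exists>c. (\<forall>k. c k \<in> V k) \<and> (\<forall>k. k \<notin> K \<longrightarrow> c k = 0) \<and> finite {k. c k \<noteq> 0} \<and> x = Sum_any c"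
  using x
proof (induction rule: span_induct_alt)
  case base
  show ?case by (rule exI[of _ "\<lambda>_. 0"]) (simp add: V subspace_0)
next
  case (step a x y)
  then obtain k c where k: "k \<in> K" "x \<in> V k" and
    c: "\<forall>k. c k \<in> V k" "\<forall>k. k \<notin> K \<longrightarrow> c k = 0" "finite {k. c k \<noteq> 0}" "y = Sum_any c" by auto
  let ?e = "\<lambda>j. if j = k then scale a x else 0"
  have fe: "finite {j. ?e j \<noteq> 0}" by (rule finite_subset[of _ "{k}"]) auto
  show ?case
  proof (intro exI[of _ "\<lambda>j. ?e j + c j"] conjI allI impI)
    show "?e j + c j \<in> V j" for j using k c by (auto intro!: subspace_add[OF V] subspace_scale[OF V])
    show "?e j + c j = 0" if "j \<notin> K" for j using that k c by auto
    show "finite {j. ?e j + c j \<noteq> 0}"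
      by (rule finite_subset[of _ "{j. ?e j \<noteq> 0} \<union> {j. c j \<noteq> 0}"]) (use fe c in auto)
    show "scale a x + y = (\<Sum>j. ?e j + c j)"
      unfolding Sum_any.distrib[OF fe c(3)] using c by simp
  qed
qed

end

context boundary_module
begin

text \<open>
  The square roots of the zero modes commute with the Heisenberg generators by hypothesis, hence so
  do the zero modes and all their inverses.
\<close>

lemma zero_mode_props:
  assumes "f \<in> zero_mode_ops"
  shows "lin f" "r \<noteq> 0 \<Longrightarrow> f (H i r v) = H i r (f v)"
proof -
  have inv_lin: "lin (inv_into UNIV g)"
    if "lin g" "bij g" for g
  proof (unfold_locales)
    fix x y c
    have *: "g (inv_into UNIV g z) = z" for z using that by (simp add: bij_is_surj surj_f_inv_f)
    have inj: "g x = g y \<Longrightarrow> x = y" for x y using that by (meson bij_is_inj injD)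
    show "inv_into UNIV g (x + y) = inv_into UNIV g x + inv_into UNIV g y"
      by (rule inj) (simp add: * lin_simps[OF that(1)])
    show "inv_into UNIV g (c *s x) = c *s inv_into UNIV g x"
      by (rule inj) (simp add: * lin_simps[OF that(1)])
  qed
  have inv_com: "inv_into UNIV g (H i r v) = H i r (inv_into UNIV g v)"
    if "bij g" "\<And>v. g (H i r v) = H i r (g v)" for g i r v
  proof -
    have *: "g (inv_into UNIV g z) = z" for z using that by (simp add: bij_is_surj surj_f_inv_f)
    have inj: "g x = g y \<Longrightarrow> x = y" for x y using that by (meson bij_is_inj injD)
    show ?thesis by (rule inj) (simp add: * that)
  qed
  have lin: "lin C" "lin (K0p j)"
    "lin (K0m j)" "lin (Rp j)"
    "lin (Rm j)" for j
    by (rule linear_C linear_K0 linear_R)+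
  have com: "C (H i r v) = H i r (C v)" "K0p j (H i r v) = H i r (K0p j v)"
    "K0m j (H i r v) = H i r (K0m j v)" "Rp j (H i r v) = H i r (Rp j v)" "Rm j (H i r v) = H i r (Rm j v)"
    if "r \<noteq> 0" for i j r v
    using that by (simp_all add: C_eq lin_H R_H flip: R_square)
  show "lin f"
    using assms unfolding zero_mode_ops_def by (auto intro: lin inv_lin invertible)
  show "f (H i r v) = H i r (f v)" if "r \<noteq> 0"
    using assms unfolding zero_mode_ops_def
    by (auto intro!: com[OF that] inv_com invertible)
qed

lemma H_gens_cases:
  assumes "(r, f) \<in> H_gens"
  obtains "r = 0" "f \<in> zero_mode_ops" | i where "r \<noteq> 0" "f = H i r"
  using assms unfolding H_gens_def by auto

lemma H_in_gens: "r \<noteq> 0 \<Longrightarrow> (r, H i r) \<in> H_gens"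
  by (auto simp: H_gens_def)

lemma linear_H_gens: "x \<in> H_gens \<Longrightarrow> lin (snd x)"
  by (cases x) (auto elim!: H_gens_cases intro: zero_mode_props linear_H)

lemma H_vanishes: "\<exists>N. \<forall>r>N. \<forall>i. H i (int r) v = 0"
proof -
  obtain N where N: "\<And>xs. xs \<in> lists H_gens \<Longrightarrow> sum_list (map fst xs) \<ge> N \<Longrightarrow> foldr (\<lambda>x. snd x) xs v = 0"
    using continuous_H unfolding continuous_action_def by blast
  have "H i (int r) v = 0" if "r > nat \<bar>N\<bar>" for r i
    using N[of "[(int r, H i (int r))]"] H_in_gens[of "int r" i] that by auto
  then show ?thesis by blast
qed

text \<open>
  On each vector only finitely many terms are nonzero (\<open>H_vanishes\<close>).  The eigenvalue is minus the degree,
  since the vacuum has the highest degree.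
\<close>

definition euler :: "'v \<Rightarrow> 'v" where
  "euler v = (\<Sum>r. if r = 0 then 0 else euler_part r v)"

lemma euler_part_vanishes: "(\<And>k. H k (int r) v = 0) \<Longrightarrow> r > 0 \<Longrightarrow> euler_part r v = 0"
  by (simp add: euler_part_def lin_H)

lemma euler_eq:
  assumes "\<And>r i. r > N \<Longrightarrow> H i (int r) v = 0"
  shows "euler v = (\<Sum>r=1..N. euler_part r v)"
proof -
  have "euler v = (\<Sum>r\<in>{1..N}. if r = 0 then 0 else euler_part r v)"
    unfolding euler_def
  proof (rule Sum_any.expand_superset)
    show "{r. (if r = 0 then 0 else euler_part r v) \<noteq> 0} \<subseteq> {1..N}"
    proof
      fix r assume r: "r \<in> {r. (if r = 0 then 0 else euler_part r v) \<noteq> 0}"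
      then have "r > 0" by (auto intro: gr0I)
      moreover have "r \<le> N"
      proof (rule ccontr)
        assume "\<not> r \<le> N"
        then have "H k (int r) v = 0" for k by (intro assms) simp
        from euler_part_vanishes[OF this \<open>r > 0\<close>] r show False by (auto split: if_splits)
      qed
      ultimately show "r \<in> {1..N}" by simp
    qed
  qed simp
  also have "\<dots> = (\<Sum>r=1..N. euler_part r v)" by (rule sum.cong) auto
  finally show ?thesis .
qed

lemma euler_part_linear: "r > 0 \<Longrightarrow> euler_part r (x + y) = euler_part r x + euler_part r y"
  "r > 0 \<Longrightarrow> euler_part r (c *s x) = c *s euler_part r x"
  by (simp_all add: euler_part_def lin_H scale_right_distrib sum.distrib scale_sum_right mult_ac)

lemma euler_linear: "euler (x + y) = euler x + euler y" "euler (c *s x) = c *s euler x"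
proof -
  obtain N M where N: "\<And>r i. r > N \<Longrightarrow> H i (int r) x = 0" and M: "\<And>r i. r > M \<Longrightarrow> H i (int r) y = 0"
    using H_vanishes[of x] H_vanishes[of y] by blast
  let ?K = "max N M"
  have "euler (x + y) = (\<Sum>r=1..?K. euler_part r (x + y))"
    by (rule euler_eq) (simp add: lin_H N M)
  also have "\<dots> = (\<Sum>r=1..?K. euler_part r x + euler_part r y)"
    by (rule sum.cong) (auto simp: euler_part_linear)
  also have "\<dots> = euler x + euler y" unfolding sum.distrib
    using euler_eq[of ?K x] euler_eq[of ?K y] N M by simp
  finally show "euler (x + y) = euler x + euler y" .
  have "euler (c *s x) = (\<Sum>r=1..N. euler_part r (c *s x))" by (rule euler_eq) (simp add: lin_H N)
  also have "\<dots> = (\<Sum>r=1..N. c *s euler_part r x)"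
    by (rule sum.cong) (auto simp: euler_part_linear)
  also have "\<dots> = c *s (\<Sum>r=1..N. euler_part r x)" by (rule scale_sum_right[symmetric])
  also have "(\<Sum>r=1..N. euler_part r x) = euler x" by (rule euler_eq[symmetric]) (rule N)
  finally show "euler (c *s x) = c *s euler x" .
qed

lemma linear_euler: "lin euler"
  by (unfold_locales) (rule euler_linear)+

lemma euler_H:
  assumes s: "s \<noteq> 0"
  shows "euler (H i s v) = H i s (euler v) - of_int s *s H i s v"
proof -
  obtain N M where N: "\<And>r i. r > N \<Longrightarrow> H i (int r) v = 0" and M: "\<And>r j. r > M \<Longrightarrow> H j (int r) (H i s v) = 0"
    using H_vanishes[of v] H_vanishes[of "H i s v"] by blast
  define K where "K = max (max N M) (nat \<bar>s\<bar>)"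
  have "euler (H i s v) = (\<Sum>r=1..K. euler_part r (H i s v))"
    by (rule euler_eq) (simp add: M K_def)
  also have "\<dots> = (\<Sum>r=1..K. H i s (euler_part r v) - (if r = nat \<bar>s\<bar> then of_int s *s H i s v else 0))"
    by (rule sum.cong) (auto simp: euler_part_H s)
  also have "\<dots> = H i s (\<Sum>r=1..K. euler_part r v) - of_int s *s H i s v"
    unfolding sum_subtractf using s by (simp add: lin_H K_def Suc_le_eq)
  also have "(\<Sum>r=1..K. euler_part r v) = euler v"
    by (rule euler_eq[symmetric]) (simp add: N K_def)
  finally show ?thesis .
qed

lemma euler_zero_mode:
  assumes f: "f \<in> zero_mode_ops"
  shows "euler (f v) = f (euler v)"
proof -
  note lin = lin_simps[OF zero_mode_props(1)[OF f]]
  obtain N where N: "\<And>r i. r > N \<Longrightarrow> H i (int r) v = 0" using H_vanishes[of v] by blast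
  have "euler (f v) = (\<Sum>r=1..N. euler_part r (f v))"
    by (rule euler_eq) (simp add: N lin flip: zero_mode_props(2)[OF f])
  also have "\<dots> = (\<Sum>r=1..N. f (euler_part r v))"
    by (rule sum.cong) (auto simp: euler_part_def lin zero_mode_props(2)[OF f])
  also have "\<dots> = f (\<Sum>r=1..N. euler_part r v)" by (rule lin(5)[symmetric])
  also have "(\<Sum>r=1..N. euler_part r v) = euler v" by (rule euler_eq[symmetric]) (rule N)
  finally show ?thesis .
qed

definition comp :: "int \<Rightarrow> 'v set" where
  "comp k = {v. euler v = (- of_int k) *s v}"

lemma subspace_comp: "subspace (comp k)"
  unfolding subspace_def comp_def
  by (auto simp: euler_linear scale_right_distrib mult.commute lin_simps[OF linear_euler])

lemma H_comp: "s \<noteq> 0 \<Longrightarrow> v \<in> comp k \<Longrightarrow> H i s v \<in> comp (k + s)"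
proof -
  assume s: "s \<noteq> 0" and v: "v \<in> comp k"
  have "euler (H i s v) = (- of_int k) *s H i s v - of_int s *s H i s v"
    using v unfolding euler_H[OF s] comp_def by (simp only: mem_Collect_eq lin_H(2)[OF s])
  also have "\<dots> = (- of_int (k + s)) *s H i s v"
    by (simp only: scale_left_diff_distrib[symmetric] of_int_add) simp
  finally show ?thesis unfolding comp_def by blast
qed

lemma zero_mode_comp: "f \<in> zero_mode_ops \<Longrightarrow> v \<in> comp k \<Longrightarrow> f v \<in> comp k"
  by (auto simp: comp_def euler_zero_mode lin_simps[OF zero_mode_props(1)] simp del: scale_minus_left)

lemma H_gens_comp: "x \<in> H_gens \<Longrightarrow> v \<in> comp k \<Longrightarrow> snd x v \<in> comp (k + fst x)"
  by (cases x) (auto elim!: H_gens_cases intro: H_comp zero_mode_comp)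

lemma foldr_comp: "xs \<in> lists H_gens \<Longrightarrow> v \<in> comp k \<Longrightarrow>
    foldr (\<lambda>x. snd x) xs v \<in> comp (k + sum_list (map fst xs))"
proof (induction xs)
  case (Cons x xs)
  then have "snd x (foldr (\<lambda>x. snd x) xs v) \<in> comp (k + sum_list (map fst xs) + fst x)"
    by (intro H_gens_comp) auto
  then show ?case by (simp add: ac_simps)
qed simp

lemma vacuum_euler: "(\<And>i r. r > 0 \<Longrightarrow> H i (int r) v = 0) \<Longrightarrow> v \<in> comp 0"
  using euler_eq[of 0 v] by (simp add: comp_def)

text \<open>
  Continuity bounds the degrees of the monomials that do not kill \<open>v\<close>.  A monomial of maximal degree
  among them sends \<open>v\<close> to a vector that is killed by all raising operators.
\<close>

lemma vacuum_exists:
  assumes "v \<noteq> 0"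
  shows "\<exists>xs. xs \<in> lists H_gens \<and> foldr (\<lambda>x. snd x) xs v \<noteq> 0 \<and> sum_list (map fst xs) \<ge> 0 \<and>
    foldr (\<lambda>x. snd x) xs v \<in> comp 0"
proof -
  obtain N where N: "\<And>xs. xs \<in> lists H_gens \<Longrightarrow> sum_list (map fst xs) \<ge> N \<Longrightarrow> foldr (\<lambda>x. snd x) xs v = 0"
    using continuous_H unfolding continuous_action_def by blast
  \<comment> \<open>the degrees of the monomials that do not kill \<open>v\<close>\<close>
  define D where "D = {nat (sum_list (map fst xs)) | xs. xs \<in> lists H_gens \<and>
    foldr (\<lambda>x. snd x) xs v \<noteq> 0 \<and> sum_list (map fst xs) \<ge> 0}"
  have D0: "D \<noteq> {}"
  proof -
    have "nat (sum_list (map fst [])) \<in> D" unfolding D_def using assms by (force intro!: exI[of _ "[]"])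
    then show ?thesis by blast
  qed
  have "D \<subseteq> {..nat N}" unfolding D_def using N by (force simp: not_le)
  then have fin: "finite D" by (rule finite_subset) simp
  have "\<exists>xs. xs \<in> lists H_gens \<and> foldr (\<lambda>x. snd x) xs v \<noteq> 0 \<and> sum_list (map fst xs) \<ge> 0 \<and>
      nat (sum_list (map fst xs)) = m" if "m \<in> D" for m
    using that unfolding D_def by blast
  from this[OF Max_in[OF fin D0]] obtain xs where xs: "xs \<in> lists H_gens" "foldr (\<lambda>x. snd x) xs v \<noteq> 0"
    "sum_list (map fst xs) \<ge> 0" "nat (sum_list (map fst xs)) = Max D" by blast
  have "H i (int r) (foldr (\<lambda>x. snd x) xs v) = 0" if "r > 0" for i r
  proof (rule ccontr)
    assume nz: "H i (int r) (foldr (\<lambda>x. snd x) xs v) \<noteq> 0"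
    let ?ys = "(int r, H i (int r)) # xs"
    have "nat (sum_list (map fst ?ys)) \<in> D"
      unfolding D_def using nz xs that by (intro CollectI exI[of _ ?ys]) (auto simp: H_in_gens)
    then have "nat (sum_list (map fst ?ys)) \<le> nat (sum_list (map fst xs))"
      unfolding xs(4) by (rule Max_ge[OF fin])
    then show False using that xs(3) by simp
  qed
  then show ?thesis using xs vacuum_euler by blast
qed

lemma comp_disjoint: "v \<in> comp k \<Longrightarrow> v \<in> comp l \<Longrightarrow> v \<noteq> 0 \<Longrightarrow> k = l"
  by (auto simp: comp_def simp del: scale_minus_left)

text \<open>
  A nonzero vector of positive degree could be raised further, to a vacuum vector, which has
  degree zero.
\<close>

lemma comp_positive: "k > 0 \<Longrightarrow> comp k = {0}"
proof (rule ccontr)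
  assume k: "k > 0" "comp k \<noteq> {0}"
  then obtain v where v: "v \<in> comp k" "v \<noteq> 0" using subspace_0[OF subspace_comp] by blast
  from vacuum_exists[OF v(2)] obtain xs where xs: "xs \<in> lists H_gens" "foldr (\<lambda>x. snd x) xs v \<noteq> 0"
    "sum_list (map fst xs) \<ge> 0" "foldr (\<lambda>x. snd x) xs v \<in> comp 0" by blast
  from comp_disjoint[OF xs(4) foldr_comp[OF xs(1) v(1)] xs(2)] show False using k xs(3) by simp
qed

lemma comp_independent:
  assumes "finite A" "\<And>k. k \<in> A \<Longrightarrow> c k \<in> comp k" "(\<Sum>k\<in>A. c k) = 0" "k \<in> A"
  shows "c k = 0"
  using assms
proof (induction A arbitrary: c k)
  case (insert a A)
  have "0 = euler (\<Sum>k\<in>insert a A. c k) + of_int a *s (\<Sum>k\<in>insert a A. c k)"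
    using insert.prems by (simp add: lin_simps[OF linear_euler])
  also have "\<dots> = (\<Sum>k\<in>insert a A. (of_int a - of_int k) *s c k)"
    unfolding lin_simps[OF linear_euler] scale_sum_right sum.distrib[symmetric]
    by (rule sum.cong) (use insert.prems(1) in \<open>auto simp: comp_def scale_left_diff_distrib\<close>)
  also have "\<dots> = (\<Sum>k\<in>A. (of_int a - of_int k) *s c k)" using insert.hyps by simp
  finally have 0: "(\<Sum>k\<in>A. (of_int a - of_int k) *s c k) = 0" by simp
  have cA: "c l = 0" if "l \<in> A" for l
  proof -
    have "(of_int a - of_int l) *s c l = 0"
      by (rule insert.IH[OF _ 0 that]) (use insert.prems(1) in \<open>auto intro: subspace_scale[OF subspace_comp]\<close>)
    moreover have "a \<noteq> l" using insert.hyps that by auto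
    ultimately show ?thesis by simp
  qed
  then have "c a = 0" using insert.prems(2) insert.hyps by simp
  then show ?case using cA insert.prems(3) by auto
qed simp

lemma comp_unique:
  assumes "\<And>k. c k \<in> comp k" "\<And>k. c' k \<in> comp k" "finite {k. c k \<noteq> 0}" "finite {k. c' k \<noteq> 0}"
    and "Sum_any c = Sum_any c'"
  shows "c = c'"
proof
  fix k
  let ?A = "insert k ({k. c k \<noteq> 0} \<union> {k. c' k \<noteq> 0})"
  have fin: "finite ?A" using assms by simp
  have "Sum_any c = (\<Sum>k\<in>?A. c k)" "Sum_any c' = (\<Sum>k\<in>?A. c' k)"
    by (rule Sum_any.expand_superset[OF fin]; auto)+
  then have "(\<Sum>k\<in>?A. c k - c' k) = 0" using assms(5) by (simp only: sum_subtractf) simp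
  from comp_independent[OF fin _ this, of k] show "c k = c' k"
    using assms(1,2) by (auto intro: subspace_diff[OF subspace_comp])
qed

lemma linear_span_image:
  assumes f: "lin f" shows "f ` span S = span (f ` S)"
proof -
  interpret f: Vector_Spaces.linear scale scale f by fact
  show ?thesis by (rule f.span_image[symmetric])
qed

text \<open>
  This is the form in which irreducibility of the representation is used.
\<close>

lemma invariant_span_eq_UNIV:
  assumes inv: "\<And>x v. x \<in> H_gens \<Longrightarrow> v \<in> S \<Longrightarrow> snd x v \<in> span S" and nz: "v \<in> S" "v \<noteq> 0"
  shows "span S = UNIV"
proof -
  have min: "T = {0} \<or> T = UNIV" if "subspace T" "\<forall>f \<in> snd ` H_gens. f ` T \<subseteq> T" for T
    using irreducible that unfolding irreducible_H_module_def irreducible_on_def by simp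
  have "\<forall>f \<in> snd ` H_gens. f ` span S \<subseteq> span S"
  proof
    fix f assume "f \<in> snd ` H_gens"
    then obtain x where x: "x \<in> H_gens" "f = snd x" by blast
    have "span (f ` S) \<subseteq> span S"
      by (rule span_minimal) (use inv[OF x(1)] x(2) in auto)
    then show "f ` span S \<subseteq> span S"
      unfolding x linear_span_image[OF linear_H_gens[OF x(1)]] .
  qed
  from min[OF subspace_span this] have "span S = {0} \<or> span S = UNIV" .
  moreover have "span S \<noteq> {0}" using span_base[OF nz(1)] nz(2) by auto
  ultimately show ?thesis by simp
qed

lemma span_comp: "span (\<Union>k. comp k) = UNIV"
proof -
  obtain v :: 'v where "v \<noteq> 0" using nontrivial by blast
  from vacuum_exists[OF this] obtain w where w: "w \<in> comp 0" "w \<noteq> 0" by blast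
  show ?thesis
  proof (rule invariant_span_eq_UNIV)
    show "w \<in> (\<Union>k. comp k)" "w \<noteq> 0" using w by blast+
    fix x v assume "x \<in> H_gens" "v \<in> (\<Union>k. comp k)"
    then obtain k where "v \<in> comp k" by blast
    from H_gens_comp[OF \<open>x \<in> H_gens\<close> this] show "snd x v \<in> span (\<Union>k. comp k)"
      by (intro span_base) blast
  qed
qed

lemma decompose: "\<exists>c. (\<forall>k. c k \<in> comp k) \<and> finite {k. c k \<noteq> 0} \<and> v = Sum_any c"
  using span_UN_decompose[of comp v UNIV] subspace_comp span_comp by auto

lemma is_grading_comp: "is_grading comp"
  unfolding is_grading_def
proof (intro conjI allI)
  fix v
  obtain c where c: "\<forall>k. c k \<in> comp k" "finite {k. c k \<noteq> 0}" "v = Sum_any c" using decompose by blast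
  show "\<exists>!c. (\<forall>k. c k \<in> comp k) \<and> finite {k. c k \<noteq> 0} \<and> v = Sum_any c"
  proof (rule ex1I[of _ c])
    fix c' assume "(\<forall>k. c' k \<in> comp k) \<and> finite {k. c' k \<noteq> 0} \<and> v = Sum_any c'"
    then show "c' = c" using c by (intro comp_unique) auto
  qed (use c in simp)
qed (rule subspace_comp)

section \<open>Finiteness of the components over the zero modes\<close>

lemma comp_0_vacuum: "v \<in> comp 0 \<Longrightarrow> r > 0 \<Longrightarrow> H i (int r) v = 0"
  using H_comp[of "int r" v 0 i] comp_positive[of "int r"] by auto

definition lowering :: "(int \<times> ('v \<Rightarrow> 'v)) set" where
  "lowering = {(r, H i r) | i r. r < 0}"

lemma lowering_gens: "lowering \<subseteq> H_gens" by (auto simp: lowering_def H_gens_def)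

lemma lowering_degree: "xs \<in> lists lowering \<Longrightarrow> xs \<noteq> [] \<Longrightarrow> sum_list (map fst xs) < 0"
proof (induction xs)
  case (Cons x xs)
  have "fst x < 0" using Cons.prems by (auto simp: lowering_def)
  then show ?case using Cons by (cases "xs = []") auto
qed simp

text \<open>
  The vectors \<open>H\<^bsub>j\<^sub>1,-r\<^sub>1\<^esub> \<cdots> H\<^bsub>j\<^sub>k,-r\<^sub>k\<^esub> t\<close> of a Fock space over the vacuum space \<open>T\<close>.
\<close>

definition descendants :: "'v set \<Rightarrow> 'v set" where
  "descendants T = {foldr (\<lambda>x. snd x) xs t | xs t. xs \<in> lists lowering \<and> t \<in> T}"

lemma descendants_cons: "x \<in> lowering \<Longrightarrow> v \<in> span (descendants T) \<Longrightarrow> snd x v \<in> span (descendants T)"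
proof -
  assume x: "x \<in> lowering" and v: "v \<in> span (descendants T)"
  have "snd x ` descendants T \<subseteq> descendants T"
  proof
    fix u assume "u \<in> snd x ` descendants T"
    then obtain xs t where "u = snd x (foldr (\<lambda>x. snd x) xs t)" "xs \<in> lists lowering" "t \<in> T"
      unfolding descendants_def by blast
    then show "u \<in> descendants T"
      unfolding descendants_def using x by (intro CollectI exI[of _ "x # xs"] exI[of _ t]) simp
  qed
  then have "span (snd x ` descendants T) \<subseteq> span (descendants T)" by (rule span_mono)
  then show ?thesis using v linear_span_image[OF linear_H_gens, of x "descendants T"] x lowering_gens by blast
qed

text \<open>
  A raising operator can be commuted to the right through the lowering operators until it reaches the
  vacuum, so the span of the descendants is invariant under all generators.
\<close>

lemma descendants_UNIV:
  assumes T: "T \<subseteq> comp 0" "\<forall>f\<in>zero_mode_ops. f ` T \<subseteq> T" and t: "t \<in> T" "t \<noteq> 0"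
  shows "span (descendants T) = UNIV"
proof (rule invariant_span_eq_UNIV)
  have sub: "T \<subseteq> descendants T"
    unfolding descendants_def by (force intro: exI[of _ "[]"])
  show "t \<in> descendants T" "t \<noteq> 0" using t sub by auto
  fix x v assume x: "x \<in> H_gens" and "v \<in> descendants T"
  then obtain xs t where v: "v = foldr (\<lambda>x. snd x) xs t" "xs \<in> lists lowering" "t \<in> T"
    unfolding descendants_def by blast
  obtain r f where rf: "x = (r, f)" by (cases x)
  from x[unfolded rf] show "snd x v \<in> span (descendants T)"
  proof (cases rule: H_gens_cases)
    case 1
    have "f (foldr (\<lambda>x. snd x) xs t) = foldr (\<lambda>x. snd x) xs (f t)" using v(2)
      by (induction xs) (auto simp: lowering_def zero_mode_props(2)[OF 1(2)])
    moreover have "f t \<in> T" using T(2) 1 v(3) by blast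
    ultimately show ?thesis using v(2) unfolding v(1) rf
      by (auto intro!: span_base simp: descendants_def)
  next
    case (2 i)
    show ?thesis
    proof (cases "r < 0")
      case True
      then have "x \<in> lowering" using 2 rf by (auto simp: lowering_def)
      moreover have "v \<in> descendants T" using v unfolding descendants_def by blast
      ultimately show ?thesis by (intro descendants_cons span_base)
    next
      case False
      then have "r = int (nat r)" "nat r > 0" using 2(1) by auto
      then obtain p where p: "r = int p" "p > 0" by blast
      have "H i (int p) (foldr (\<lambda>x. snd x) xs t) \<in> span (descendants T)" using v(2)
      proof (induction xs)
        case Nil
        have "H i (int p) t = 0" using comp_0_vacuum T(1) v(3) p(2) by blast
        then show ?case by (simp add: span_zero)
      next
        case (Cons y ys)
        let ?w = "foldr (\<lambda>x. snd x) ys t"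
        have ys: "y \<in> lowering" "ys \<in> lists lowering" using Cons.hyps by simp_all
        then obtain j s where y: "y = (s, H j s)" "s < 0" unfolding lowering_def by blast
        then have "s = - int (nat (- s))" "nat (- s) > 0" by auto
        then obtain m where m: "s = - int m" "m > 0" by blast
        have "H i (int p) (H j s ?w) = H j s (H i (int p) ?w) + (if p = m then hc i j p else 0) *s ?w"
          using H_H_opposite[OF p(2) m(2), of i j ?w] m by (simp add: algebra_simps)
        moreover have "H j s (H i (int p) ?w) \<in> span (descendants T)"
          using descendants_cons[OF ys(1) Cons.IH] y by simp
        moreover have "?w \<in> span (descendants T)"
          using ys(2) v(3) unfolding descendants_def by (intro span_base) blast
        ultimately show ?case by (simp add: y span_add span_scale)
      qed
      then show ?thesis using 2 p rf v(1) by simp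
    qed
  qed
qed

text \<open>
  For an invariant subspace \<open>T\<close> of the vacuum space, everything is spanned by the descendants of \<open>T\<close>;
  those that are not in \<open>T\<close> have negative degree, so \<open>T\<close> is the full component of degree zero.
\<close>

lemma irreducible_vacuum: "irreducible_on zero_mode_ops (comp 0)"
  unfolding irreducible_on_def
proof (intro conjI allI impI ballI)
  show "subspace (comp 0)" by (rule subspace_comp)
  obtain v :: 'v where "v \<noteq> 0" using nontrivial by blast
  from vacuum_exists[OF this] show "comp 0 \<noteq> {0}" by blast
  show "f ` comp 0 \<subseteq> comp 0" if "f \<in> zero_mode_ops" for f using zero_mode_comp[OF that] by blast
  fix T assume T: "subspace T \<and> T \<subseteq> comp 0 \<and> (\<forall>f\<in>zero_mode_ops. f ` T \<subseteq> T)"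
  show "T = {0} \<or> T = comp 0"
  proof (cases "T = {0}")
    case False
    then obtain t where t: "t \<in> T" "t \<noteq> 0" using T subspace_0 by blast
    \<comment> \<open>modulo negative degrees, a descendant of \<open>T\<close> lies in \<open>T\<close>\<close>
    let ?N = "span (\<Union>k\<in>{..<0}. comp k)"
    have key: "\<exists>s\<in>T. u - s \<in> ?N" if "u \<in> span (descendants T)" for u
      using that
    proof (induction rule: span_induct_alt)
      case base
      show ?case using T by (intro bexI[of _ 0]) (auto simp: span_zero subspace_0)
    next
      case (step c x y)
      then obtain s where s: "s \<in> T" "y - s \<in> ?N" by blast
      from step obtain xs t where x: "x = foldr (\<lambda>x. snd x) xs t" "xs \<in> lists lowering" "t \<in> T"
        unfolding descendants_def by blast
      show ?case
      proof (cases "xs = []")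
        case True
        then show ?thesis using T s x
          by (intro bexI[of _ "c *s t + s"]) (auto intro: subspace_add subspace_scale)
      next
        case False
        have "x \<in> comp (0 + sum_list (map fst xs))" unfolding x(1)
          by (rule foldr_comp) (use x T lowering_gens in auto)
        then have "x \<in> ?N" using lowering_degree[OF x(2) False] by (intro span_base) auto
        then have "c *s x + (y - s) \<in> ?N" using s by (intro span_add span_scale)
        then show ?thesis using s by (intro bexI[of _ s]) (auto simp: algebra_simps)
      qed
    qed
    have "comp 0 \<subseteq> T"
    proof
      fix v assume v: "v \<in> comp 0"
      from key[of v] descendants_UNIV[of T t] T t obtain s where s: "s \<in> T" "v - s \<in> ?N" by blast
      have vs: "v - s \<in> comp 0" using v s T by (auto intro: subspace_diff[OF subspace_comp])
      obtain c where c: "\<forall>k. c k \<in> comp k" "\<forall>k. k \<notin> {..<0} \<longrightarrow> c k = 0" "finite {k. c k \<noteq> 0}" "v - s = Sum_any c"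
        using span_UN_decompose[of comp, OF subspace_comp s(2)] by blast
      let ?e = "\<lambda>k::int. if k = 0 then v - s else 0"
      have "?e = c"
      proof (rule comp_unique)
        show "?e k \<in> comp k" for k using vs subspace_0[OF subspace_comp] by auto
        show "finite {k. ?e k \<noteq> 0}" by (rule finite_subset[of _ "{0}"]) auto
        show "Sum_any ?e = Sum_any c" using c(4) by simp
      qed (use c in auto)
      then have "?e 0 = c 0" by (rule fun_cong)
      then have "v - s = c 0" by simp
      then show "v \<in> T" using c(2) s(1) by simp
    qed
    then show ?thesis using T by blast
  qed simp
qed

text \<open>
  On this component the Euler operator is multiplication by \<open>m > 0\<close>, and each of its summands ends
  with an operator \<open>H\<^bsub>j,-r\<^esub>\<close> applied to a vector of higher degree.
\<close>

lemma comp_negative: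
  assumes "m > 0"
  shows "comp (- int m) = span (\<Union>r\<in>{1..m}. \<Union>j. H j (- int r) ` comp (int r - int m))"
proof
  show "span (\<Union>r\<in>{1..m}. \<Union>j. H j (- int r) ` comp (int r - int m)) \<subseteq> comp (- int m)"
  proof (rule span_minimal[OF _ subspace_comp], safe)
    fix r j v assume "r \<in> {1..m}" "v \<in> comp (int r - int m)"
    then show "H j (- int r) v \<in> comp (- int m)" using H_comp[of "- int r" v "int r - int m" j] by simp
  qed
  show "comp (- int m) \<subseteq> span (\<Union>r\<in>{1..m}. \<Union>j. H j (- int r) ` comp (int r - int m))" (is "_ \<subseteq> span ?S")
  proof
    fix v assume v: "v \<in> comp (- int m)"
    have "H i (int r) v = 0" if "r > m" for r i
      using H_comp[of "int r" v "- int m" i] comp_positive[of "- int m + int r"] v that by auto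
    then have "of_nat m *s v = (\<Sum>r=1..m. euler_part r v)"
      using euler_eq[of m v] v by (simp add: comp_def)
    moreover have "euler_part r v \<in> span ?S" if r: "r \<in> {1..m}" for r
    proof -
      have "H j (- int r) (H k (int r) v) \<in> ?S" for j k
      proof -
        have "H k (int r) v \<in> comp (int r - int m)" using H_comp[of "int r" v "- int m" k] v r by simp
        then show ?thesis using r by blast
      qed
      then show ?thesis unfolding euler_part_def
        by (intro span_sum span_scale span_base)
    qed
    ultimately have "of_nat m *s v \<in> span ?S" by (simp only: span_sum)
    then have "inverse (of_nat m) *s of_nat m *s v \<in> span ?S" by (rule span_scale)
    then show "v \<in> span ?S" using assms by simp
  qed
qed

text \<open>
  The image of an irreducible module under an operator that commutes with the zero modes is zero or
  irreducible, so the finite decompositions of the higher components pass to the lower one.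
\<close>

lemma finite_comp_nonpositive: "finite_over_zero_modes (comp (- int m))"
proof (induction m rule: less_induct)
  case (less m)
  show ?case
  proof (cases "m = 0")
    case True
    have "irreducible_on zero_mode_ops (comp 0)" by (rule irreducible_vacuum)
    moreover have "comp (- int m) = span (\<Union>{comp 0})"
    proof -
      have "span (\<Union>{comp 0}) = comp 0" by (simp add: subspace_comp)
      then show ?thesis unfolding True by (simp only: of_nat_0 minus_zero)
    qed
    ultimately show ?thesis unfolding finite_over_zero_modes_def
      by (intro exI[of _ "{comp 0}"]) (simp only: finite.intros ball_simps simp_thms)
  next
    case False
    have "\<forall>r\<in>{1..m}. \<exists>\<S>. finite \<S> \<and> (\<forall>S\<in>\<S>. irreducible_on zero_mode_ops S) \<and> comp (int r - int m) = span (\<Union>\<S>)"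
    proof
      fix r assume "r \<in> {1..m}"
      then show "\<exists>\<S>. finite \<S> \<and> (\<forall>S\<in>\<S>. irreducible_on zero_mode_ops S) \<and> comp (int r - int m) = span (\<Union>\<S>)"
        using less.IH[of "m - r"] False unfolding finite_over_zero_modes_def by (simp add: of_nat_diff)
    qed
    from bchoice[OF this] obtain \<S> where \<S>: "\<And>r. r \<in> {1..m} \<Longrightarrow> finite (\<S> r)"
      "\<And>r S. r \<in> {1..m} \<Longrightarrow> S \<in> \<S> r \<Longrightarrow> irreducible_on zero_mode_ops S"
      "\<And>r. r \<in> {1..m} \<Longrightarrow> comp (int r - int m) = span (\<Union>(\<S> r))" by blast
    \<comment> \<open>all images of the irreducible summands of the higher components, possibly zero\<close>
    define \<T> where "\<T> = (\<Union>r\<in>{1..m}. \<Union>j. (\<lambda>S. H j (- int r) ` S) ` \<S> r)"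
    have lin: "lin (H j (- int r))" if "r \<in> {1..m}" for j r
      by (rule linear_H) (use that in auto)
    have irr: "irreducible_on zero_mode_ops T" if T: "T \<in> \<T> - {{0}}" for T
    proof -
      obtain r j S where T': "r \<in> {1..m}" "S \<in> \<S> r" "T = H j (- int r) ` S"
        using T unfolding \<T>_def by blast
      show ?thesis unfolding T'(3)
        by (rule irreducible_on_image[OF \<S>(2)[OF T'(1,2)] lin[OF T'(1)]])
          (use T T' zero_mode_props(2) in auto)
    qed
    have "comp (- int m) = span (\<Union>\<T>)"
    proof -
      have "(\<Union>r\<in>{1..m}. \<Union>j. H j (- int r) ` comp (int r - int m)) =
          (\<Union>r\<in>{1..m}. \<Union>j. span (H j (- int r) ` \<Union>(\<S> r)))"
        using \<S>(3) linear_span_image[OF lin] by auto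
      moreover have "span (\<Union>r\<in>{1..m}. \<Union>j. span (H j (- int r) ` \<Union>(\<S> r))) = span (\<Union>\<T>)"
      proof
        show "span (\<Union>r\<in>{1..m}. \<Union>j. span (H j (- int r) ` \<Union>(\<S> r))) \<subseteq> span (\<Union>\<T>)"
        proof (rule span_minimal[OF _ subspace_span], rule UN_least, rule UN_least)
          fix r j assume "r \<in> {1..m}"
          then have "H j (- int r) ` S \<in> \<T>" if "S \<in> \<S> r" for S
            unfolding \<T>_def using that by blast
          then show "span (H j (- int r) ` \<Union>(\<S> r)) \<subseteq> span (\<Union>\<T>)"
            by (intro span_mono) blast
        qed
        show "span (\<Union>\<T>) \<subseteq> span (\<Union>r\<in>{1..m}. \<Union>j. span (H j (- int r) ` \<Union>(\<S> r)))"
          unfolding \<T>_def by (intro span_mono) (auto intro!: span_base)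
      qed
      ultimately show ?thesis using comp_negative[of m] False by simp
    qed
    also have "\<dots> = span (\<Union>(\<T> - {{0}}))"
    proof
      show "span (\<Union>\<T>) \<subseteq> span (\<Union>(\<T> - {{0}}))"
      proof (rule span_minimal[OF _ subspace_span], safe)
        fix x X assume x: "x \<in> X" "X \<in> \<T>"
        show "x \<in> span (\<Union>(\<T> - {{0}}))"
        proof (cases "X = {0}")
          case True
          then show ?thesis using x by (simp add: span_zero)
        next
          case False
          then show ?thesis using x by (intro span_base) blast
        qed
      qed
      show "span (\<Union>(\<T> - {{0}})) \<subseteq> span (\<Union>\<T>)"
        by (rule span_mono) blast
    qed
    finally show ?thesis unfolding finite_over_zero_modes_def using irr \<S>(1)
      by (intro exI[of _ "\<T> - {{0}}"]) (auto simp: \<T>_def)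
  qed
qed

lemma finite_comp: "finite_over_zero_modes (comp k)"
proof (cases "k > 0")
  case True
  then show ?thesis unfolding comp_positive[OF True] finite_over_zero_modes_def
    by (intro exI[of _ "{}"]) simp
next
  case False
  then show ?thesis using finite_comp_nonpositive[of "nat (- k)"] by simp
qed

section \<open>The roots of the Cartan currents\<close>

text \<open>
  The coefficient with index \<open>a\<close> enters the \<open>a\<close>-th equation with the factor \<open>(1 + s\<^sup>a) R\<close>, which is
  injective.
\<close>

lemma tilde_unique:
  assumes K: "is_tilde scale s R K Kt" "is_tilde scale s R K Kt'"
    and R: "lin R" "inj R" and s: "\<And>n. n > 0 \<Longrightarrow> 1 + s ^ n \<noteq> 0"
  shows "Kt a v = Kt' a v"
proof (induction a arbitrary: v rule: less_induct)
  case (less a)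
  show ?case
  proof (cases "a = 0")
    case True
    then show ?thesis using K by (simp add: is_tilde_def)
  next
    case False
    have split: "{..a} = insert 0 (insert a {0<..<a})" using False by auto
    have main: "(1 + s ^ a) *s R (X a v) + (\<Sum>b\<in>{0<..<a}. s ^ (a - b) *s X b (X (a - b) v)) = K a v"
      if "is_tilde scale s R K X" for X
    proof -
      have X: "X 0 u = R u" "X a (R v) = R (X a v)" "(\<Sum>b\<le>a. s ^ (a - b) *s X b (X (a - b) v)) = K a v" for u
        using that unfolding is_tilde_def by (simp_all only: simp_thms)
      have "(\<Sum>b\<le>a. s ^ (a - b) *s X b (X (a - b) v)) =
          s ^ a *s R (X a v) + (R (X a v) + (\<Sum>b\<in>{0<..<a}. s ^ (a - b) *s X b (X (a - b) v)))"
        unfolding split using False by (simp add: X(1,2))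
      then show ?thesis unfolding X(3) by (simp add: scale_left_distrib add.assoc add.left_commute)
    qed
    have mid: "(\<Sum>b\<in>{0<..<a}. s ^ (a - b) *s Kt b (Kt (a - b) v)) = (\<Sum>b\<in>{0<..<a}. s ^ (a - b) *s Kt' b (Kt' (a - b) v))"
      by (rule sum.cong) (use less in auto)
    have "(1 + s ^ a) *s R (Kt a v) = (1 + s ^ a) *s R (Kt' a v)"
      using main[OF K(1)] unfolding main[OF K(2), symmetric] mid by (simp only: add_right_cancel)
    then have "R (Kt a v) = R (Kt' a v)" using s False by simp
    then show ?thesis by (rule injD[OF R(2)])
  qed
qed

lemma expser_dilate_h:
  assumes s: "\<And>n. n > 0 \<Longrightarrow> 1 + s ^ n \<noteq> 0"
  shows "S.expser (S.rescale (\<lambda>n. 1 / (1 + s ^ n)) (hX i)) * S.dilate s (S.expser (S.rescale (\<lambda>n. 1 / (1 + s ^ n)) (hX i))) = U i"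
    "S.expser (S.rescale (\<lambda>n. 1 / (1 + s ^ n)) (hY i)) * S.dilate s (S.expser (S.rescale (\<lambda>n. 1 / (1 + s ^ n)) (hY i))) = W i"
proof -
  show "S.expser (S.rescale (\<lambda>n. 1 / (1 + s ^ n)) (hX i)) * S.dilate s (S.expser (S.rescale (\<lambda>n. 1 / (1 + s ^ n)) (hX i))) = U i"
    by (rule S.expser_split[OF linear_h(1) hX_0(1) hX_hX s])
  show "S.expser (S.rescale (\<lambda>n. 1 / (1 + s ^ n)) (hY i)) * S.dilate s (S.expser (S.rescale (\<lambda>n. 1 / (1 + s ^ n)) (hY i))) = W i"
    by (rule S.expser_split[OF linear_h(2) hX_0(2) hY_hY s])
qed

text \<open>
  The equation \<open>T(x) T(s x) = V(x)\<close> for exponentials, with a zero mode attached to each factor.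
\<close>

lemma dressed_square:
  assumes TT: "T * S.dilate s T = V" and T: "\<And>n. S.linear_elt (T $ n)" and zT: "\<And>n. z * T $ n = T $ n * z" and z: "S.linear_elt z"
  shows "(\<Sum>b\<le>a. sc (s ^ (a - b)) * (z * T $ b * (z * T $ (a - b)))) = z * z * V $ a"
proof -
  have "sc (s ^ (a - b)) * (z * T $ b * (z * T $ (a - b))) = z * z * (T $ b * (sc (s ^ (a - b)) * T $ (a - b)))"
    for b
    unfolding mult_swap_middle[OF zT[symmetric]]
    by (simp only: mult.assoc sc_left_commute z T)
  then have "(\<Sum>b\<le>a. sc (s ^ (a - b)) * (z * T $ b * (z * T $ (a - b)))) =
      z * z * (\<Sum>b\<le>a. T $ b * (sc (s ^ (a - b)) * T $ (a - b)))"
    by (simp only: sum_distrib_left)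
  also have "(\<Sum>b\<le>a. T $ b * (sc (s ^ (a - b)) * T $ (a - b))) = (T * S.dilate s T) $ a"
    by (simp add: fps_mult_nth S.dilate_def atMost_atLeast0)
  finally show ?thesis unfolding TT .
qed

lemma linear_endo_apply:
  assumes "S.linear_elt e" shows "lin (endo_apply e)"
proof (unfold_locales)
  show "endo_apply e (x + y) = endo_apply e x + endo_apply e y" for x y
    by transfer auto
  fix c x
  have "endo_apply (sc c * e) x = endo_apply (e * sc c) x" using assms by (simp add: S.linear_elt_def)
  then show "endo_apply e (c *s x) = c *s endo_apply e x" by simp
qed

lemma tilde_candidate:
  assumes TT: "T * S.dilate s T = V" and T: "\<And>n. S.linear_elt (T $ n)" and T0: "T $ 0 = 1"
    and zT: "\<And>n. z * T $ n = T $ n * z" and z: "S.linear_elt z" "\<And>v. endo_apply z v = R v"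
    and K: "\<And>a v. K a v = endo_apply (z * z * V $ a) v"
  shows "is_tilde scale s R K (\<lambda>a v. endo_apply (z * T $ a) v)"
  unfolding is_tilde_def
proof (intro conjI allI)
  fix a v
  show "endo_apply (z * T $ 0) v = R v" by (simp add: T0 z)
  have "endo_apply (z * T $ a * z) v = endo_apply (z * (z * T $ a)) v"
    by (simp only: mult.assoc zT[symmetric])
  then show "endo_apply (z * T $ a) (R v) = R (endo_apply (z * T $ a) v)" by (simp add: z)
  have "(\<Sum>b\<le>a. s ^ (a - b) *s endo_apply (z * T $ b) (endo_apply (z * T $ (a - b)) v)) =
      endo_apply (\<Sum>b\<le>a. sc (s ^ (a - b)) * (z * T $ b * (z * T $ (a - b)))) v" by simp
  then show "(\<Sum>b\<le>a. s ^ (a - b) *s endo_apply (z * T $ b) (endo_apply (z * T $ (a - b)) v)) = K a v"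
    unfolding dressed_square[OF TT T zT z(1)] K .
qed

lemma expser_0 [simp]: "S.expser X $ 0 = 1" by (simp add: S.expser_def)

lemma Ktm_eq: "Ktm j b v = endo_apply (M j b) v"
proof -
  have T: "is_tilde scale q (Rm j) (Km j) (\<lambda>b v. endo_apply (M j b) v)"
    unfolding M_def
    by (rule tilde_candidate[OF expser_dilate_h(2)[OF q_power_neq(2)] linear_expser_h(2) expser_0 r_expser(4) linear_zero_mode(4) zero_mode_apply(4)])
      (simp_all only: r_square Km_eq)
  show ?thesis
    by (rule tilde_unique[OF tilde_m T linear_R(2) bij_is_inj[OF invertible(5)]]) (rule q_power_neq(2))
qed

text \<open>
  The root of \<open>K\<^sub>i\<^sup>+\<close> has the weights \<open>1 / (1 + q\<^sup>-\<^sup>n)\<close>; passing to the argument \<open>q z\<close> multiplies them by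
  \<open>q\<^sup>-\<^sup>n\<close>, which gives the same weights \<open>1 / (1 + q\<^sup>n)\<close> as for \<open>K\<^sub>i\<^sup>-\<close>.
\<close>

lemma Ktp_eq: "inverse q ^ a *s Ktp i a v = endo_apply (P i a) v"
proof -
  let ?T = "S.expser (S.rescale (\<lambda>n. 1 / (1 + inverse q ^ n)) (hX i))"
  have T: "is_tilde scale (inverse q) (Rp i) (Kp i) (\<lambda>a v. endo_apply (rp i * ?T $ a) v)"
    by (rule tilde_candidate[OF expser_dilate_h(1)[OF q_power_neq(3)] linear_expser_h(1) expser_0 r_expser(1) linear_zero_mode(3) zero_mode_apply(3)])
      (simp_all only: r_square Kp_eq)
  have "Ktp i a v = endo_apply (rp i * ?T $ a) v"
    by (rule tilde_unique[OF tilde_p T linear_R(1) bij_is_inj[OF invertible(4)]]) (rule q_power_neq(3))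
  then have "inverse q ^ a *s Ktp i a v = endo_apply (sc (inverse q ^ a) * (rp i * ?T $ a)) v" by simp
  also have "sc (inverse q ^ a) * (rp i * ?T $ a) = rp i * S.dilate (inverse q) ?T $ a"
    unfolding sc_left_commute[OF linear_zero_mode(3), symmetric] by (simp only: S.dilate_def fps_nth_Abs_fps)
  also have "S.dilate (inverse q) ?T = S.expser (S.rescale (\<lambda>n. inverse q ^ n * (1 / (1 + inverse q ^ n))) (hX i))"
    by (rule S.dilate_expser_rescale[OF linear_h(1) hX_0(1) hX_hX])
  also have "(\<lambda>n. inverse q ^ n * (1 / (1 + inverse q ^ n))) = tw"
  proof
    fix n
    have "inverse t * (1 / (1 + inverse t)) = 1 / (1 + t)" if "t \<noteq> 0" for t :: complex
      using that by (simp add: field_simps)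
    from this[of "q ^ n"] show "inverse q ^ n * (1 / (1 + inverse q ^ n)) = tw n"
      by (simp add: power_inverse)
  qed
  finally show ?thesis unfolding P_def .
qed

lemma KP_square: "KP i a = (\<Sum>b\<le>a. sc (q ^ (a - b)) * (P i b * P i (a - b)))"
  unfolding P_def KP_def r_square[symmetric]
  by (rule dressed_square[OF expser_dilate_h(1)[OF q_power_neq(2)] linear_expser_h(1) r_expser(1) linear_zero_mode(3), symmetric])

lemma KM_square: "KM i a = (\<Sum>b\<le>a. sc (q ^ (a - b)) * (M i b * M i (a - b)))"
  unfolding M_def KM_def r_square[symmetric]
  by (rule dressed_square[OF expser_dilate_h(2)[OF q_power_neq(2)] linear_expser_h(2) r_expser(4) linear_zero_mode(4), symmetric])

lemma Kp_KP: "Kp i a v = endo_apply (KP i a) v" by (simp only: Kp_eq KP_def)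
lemma Km_KM: "Km i a v = endo_apply (KM i a) v" by (simp only: Km_eq KM_def)

lemma expser_commute2:
  assumes "\<And>a b. X $ a * Y $ b = Y $ b * X $ a" "\<And>n. S.linear_elt (X $ n)" "\<And>n. S.linear_elt (Y $ n)"
  shows "S.expser X $ a * S.expser Y $ b = S.expser Y $ b * S.expser X $ a"
  by (rule commute_expser[OF S.linear_expser[OF assms(2)]])
    (rule commute_expser[OF assms(3), symmetric], rule assms(1)[symmetric])

lemma dressed_commute:
  assumes "z * z' = z' * z" "z * u' = u' * z" "z' * u = u * z'" "u * u' = u' * (u :: 'a::semigroup_mult)"
  shows "z * u * (z' * u') = z' * u' * (z * u)"
  unfolding mult_swap_middle[OF assms(3)[symmetric]] mult_swap_middle[OF assms(2)[symmetric]] assms(1,4) ..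

lemma P_P: "P i a * P j b = P j b * P i a"
  and M_M: "M i a * M j b = M j b * M i a"
proof -
  have X: "S.rescale tw (hX i) $ a * S.rescale tw (hX j) $ b = S.rescale tw (hX j) $ b * S.rescale tw (hX i) $ a"
    and Y: "S.rescale tw (hY i) $ a * S.rescale tw (hY j) $ b = S.rescale tw (hY j) $ b * S.rescale tw (hY i) $ a" for a b
    unfolding S.rescale_nth
    by (rule S.commute_\<sigma>_mult[OF linear_h(1) linear_h(1) hX_hX], rule S.commute_\<sigma>_mult[OF linear_h(2) linear_h(2) hY_hY])
  have lin: "S.linear_elt (S.rescale tw (hX i) $ n)" "S.linear_elt (S.rescale tw (hY i) $ n)" for i n
    by (rule S.linear_rescale, rule linear_h)+
  show "P i a * P j b = P j b * P i a"
    unfolding P_def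
    by (rule dressed_commute[OF r_commute(1) r_expser(1) r_expser(1)], rule expser_commute2[OF X lin(1) lin(1)])
  show "M i a * M j b = M j b * M i a"
    unfolding M_def
    by (rule dressed_commute[OF r_commute(2) r_expser(4) r_expser(4)], rule expser_commute2[OF Y lin(2) lin(2)])
qed

lemma KP_P: "KP i a * P j b = P j b * KP i a"
  unfolding KP_square sum_distrib_left sum_distrib_right
proof (rule sum.cong, rule refl)
  fix c
  have "P i c * P i (a - c) * P j b = P j b * (P i c * P i (a - c))" by (rule mult_commute2; rule P_P)
  moreover have "S.linear_elt (P j b)" unfolding P_def by (intro S.linear_elt_mult linear_zero_mode linear_expser_h)
  ultimately show "sc (q ^ (a - c)) * (P i c * P i (a - c)) * P j b = P j b * (sc (q ^ (a - c)) * (P i c * P i (a - c)))"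
    by (simp only: mult.assoc sc_left_commute)
qed

lemma linear_PM: "S.linear_elt (P i a)" "S.linear_elt (M i a)" "S.linear_elt (KP i a)" "S.linear_elt (KM i a)"
  unfolding P_def M_def KP_def KM_def by (intro S.linear_elt_mult linear_zero_mode linear_expser_h linear_UW)+

lemma KM_M: "KM i a * M j b = M j b * KM i a"
  unfolding KM_square sum_distrib_left sum_distrib_right
proof (rule sum.cong, rule refl)
  fix c
  have "M i c * M i (a - c) * M j b = M j b * (M i c * M i (a - c))" by (rule mult_commute2; rule M_M)
  then show "sc (q ^ (a - c)) * (M i c * M i (a - c)) * M j b = M j b * (sc (q ^ (a - c)) * (M i c * M i (a - c)))"
    by (simp only: mult.assoc sc_left_commute linear_PM)
qed

section \<open>Homogeneous operators\<close>

definition homog :: "'v endo \<Rightarrow> int \<Rightarrow> bool" where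
  "homog e r \<longleftrightarrow> S.linear_elt e \<and> (\<forall>k. \<forall>v\<in>comp k. endo_apply e v \<in> comp (k + r))"

lemma homog_mult: "homog x r \<Longrightarrow> homog y s \<Longrightarrow> homog (x * y) (r + s)"
proof -
  assume x: "homog x r" and y: "homog y s"
  have "endo_apply (x * y) v \<in> comp (k + (r + s))" if "v \<in> comp k" for k v
  proof -
    have "endo_apply y v \<in> comp (k + s)" using y that by (simp add: homog_def)
    then have "endo_apply x (endo_apply y v) \<in> comp (k + s + r)" using x by (simp add: homog_def)
    then show ?thesis by (simp add: ac_simps)
  qed
  then show ?thesis using x y by (simp add: homog_def S.linear_elt_mult)
qed

lemma homog_sum: "(\<And>x. x \<in> A \<Longrightarrow> homog (f x) r) \<Longrightarrow> homog (sum f A) r"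
  unfolding homog_def by (auto intro: S.linear_elt_sum subspace_sum[OF subspace_comp])

lemma homog_sc: "homog (sc c) 0"
  unfolding homog_def by (auto intro: subspace_scale[OF subspace_comp])

lemma homog_0: "homog 0 r" and homog_1: "homog 1 0"
  unfolding homog_def by (auto intro: subspace_0[OF subspace_comp])

lemma homog_power:
  assumes "\<And>a. homog (X $ a) (\<epsilon> * int a)"
  shows "homog ((X ^ m) $ a) (\<epsilon> * int a)"
proof (induction m arbitrary: a)
  case 0
  then show ?case by (cases "a = 0") (simp_all add: homog_0 homog_1)
next
  case (Suc m)
  show ?case unfolding power_Suc fps_mult_nth
  proof (rule homog_sum)
    fix c assume "c \<in> {0..a}"
    then have "\<epsilon> * int a = \<epsilon> * int c + \<epsilon> * int (a - c)" by (simp add: of_nat_diff algebra_simps)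
    then show "homog (X $ c * (X ^ m) $ (a - c)) (\<epsilon> * int a)" using homog_mult[OF assms Suc.IH] by simp
  qed
qed

lemma homog_expser:
  assumes "\<And>a. homog (X $ a) (\<epsilon> * int a)"
  shows "homog (S.expser X $ a) (\<epsilon> * int a)"
  unfolding S.expser_def fps_nth_Abs_fps
  using homog_mult[OF homog_sc homog_power[OF assms]] by (intro homog_sum) simp

lemma homog_h: "homog (hX i $ a) (int a)" "homog (hY i $ a) (- int a)"
proof -
  show "homog (hX i $ a) (int a)"
  proof (cases "a = 0")
    case False
    then show ?thesis unfolding homog_def using H_comp[of "int a" _ _ i] linear_h
      by (auto simp: hX_apply intro: subspace_scale[OF subspace_comp])
  qed (simp add: homog_0)
  have "endo_apply (hY i $ a) v \<in> comp (k + - int a)" if "v \<in> comp k" "a > 0" for k v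
    unfolding hY_apply[OF that(2)]
    by (rule subspace_scale[OF subspace_comp], rule H_comp) (use that in auto)
  then show "homog (hY i $ a) (- int a)"
    using linear_h homog_0[of 0] by (cases "a = 0") (simp_all add: homog_def)
qed

lemma homog_zero_mode: "homog (kp i) 0" "homog (km i) 0" "homog (rp i) 0" "homog (rm i) 0"
proof -
  have "K0p i \<in> zero_mode_ops" "K0m i \<in> zero_mode_ops" "Rp i \<in> zero_mode_ops" "Rm i \<in> zero_mode_ops"
    unfolding zero_mode_ops_def by blast+
  from this[THEN zero_mode_comp] show "homog (kp i) 0" "homog (km i) 0" "homog (rp i) 0" "homog (rm i) 0"
    unfolding homog_def by (simp_all add: linear_zero_mode)
qed

lemma homog_PM: "homog (P i a) (int a)" "homog (M i a) (- int a)" "homog (KP i a) (int a)" "homog (KM i a) (- int a)"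
proof -
  have 1: "homog (S.rescale c (hX i) $ a) (1 * int a)" "homog (S.rescale c (hY i) $ a) ((-1) * int a)" for c a
    using homog_mult[OF homog_sc homog_h(1)] homog_mult[OF homog_sc homog_h(2)] by simp_all
  have 2: "homog (hX i $ a) (1 * int a)" "homog (hY i $ a) ((-1) * int a)" for a
    using homog_h by simp_all
  show "homog (P i a) (int a)" "homog (M i a) (- int a)" "homog (KP i a) (int a)" "homog (KM i a) (- int a)"
    unfolding P_def M_def KP_def KM_def
    using homog_mult[OF homog_zero_mode(3) homog_expser[OF 1(1)]] homog_mult[OF homog_zero_mode(4) homog_expser[OF 1(2)]]
      homog_mult[OF homog_zero_mode(1) homog_expser[OF 2(1)]] homog_mult[OF homog_zero_mode(2) homog_expser[OF 2(2)]]
    by simp_all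
qed

text \<open>
  Quantifying over all homogeneous operators makes the bound hereditary: raising operators preserve
  it (\<open>bnd_apply\<close>).
\<close>

definition bnd :: "int \<Rightarrow> 'v \<Rightarrow> bool" where
  "bnd L v \<longleftrightarrow> (\<forall>e r. homog e r \<longrightarrow> r > L \<longrightarrow> endo_apply e v = 0)"

lemma endo_apply_lin: assumes "S.linear_elt e"
  shows "endo_apply e (x + y) = endo_apply e x + endo_apply e y" "endo_apply e (c *s x) = c *s endo_apply e x"
    "endo_apply e 0 = 0" "endo_apply e (sum g A) = (\<Sum>a\<in>A. endo_apply e (g a))"
  using lin_simps[OF linear_endo_apply[OF assms]] by blast+

text \<open>
  The least degree that occurs in \<open>v\<close>, up to sign, is a bound because there are no positive degrees.
\<close>

lemma bnd_exists: "\<exists>L. bnd L v"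
proof -
  obtain c where c: "\<forall>k. c k \<in> comp k" "finite {k. c k \<noteq> 0}" "v = Sum_any c" using decompose by blast
  \<comment> \<open>an operator of degree above \<open>- k\<close> sends \<open>comp k\<close> into positive degrees\<close>
  define L where "L = Max (uminus ` {k. c k \<noteq> 0})"
  have L: "- k \<le> L" if "c k \<noteq> 0" for k
    unfolding L_def by (rule Max_ge) (use c(2) that in auto)
  have "endo_apply e v = 0" if e: "homog e r" "r > L" for e r
  proof -
    have "endo_apply e (c k) = 0" for k
    proof (cases "c k = 0")
      case False
      then have "endo_apply e (c k) \<in> comp (k + r)" "k + r > 0" using e c(1) L[of k] unfolding homog_def by auto
      then show ?thesis using comp_positive by blast
    qed (use e in \<open>simp add: homog_def endo_apply_lin\<close>)
    then show ?thesis using e unfolding c(3) Sum_any.expand_set homog_def by (simp add: endo_apply_lin)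
  qed
  then show ?thesis unfolding bnd_def by blast
qed

lemma bnd_mono: "bnd L v \<Longrightarrow> L \<le> L' \<Longrightarrow> bnd L' v"
  unfolding bnd_def by auto

lemma bnd_apply: "bnd L v \<Longrightarrow> homog e r \<Longrightarrow> r \<ge> 0 \<Longrightarrow> bnd L (endo_apply e v)"
  unfolding bnd_def
proof (intro allI impI)
  fix e' s assume v: "\<forall>e r. homog e r \<longrightarrow> r > L \<longrightarrow> endo_apply e v = 0"
    and e: "homog e r" "r \<ge> 0" and e': "homog e' s" "s > L"
  have "s + r > L" using e e' by simp
  then have "endo_apply (e' * e) v = 0" using v homog_mult[OF e'(1) e(1)] by blast
  then show "endo_apply e' (endo_apply e v) = 0" by simp
qed

section \<open>Normal ordering of the boundary currents\<close>

notation endo_apply (infixr \<open>\<star>\<close> 76)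

lemma linI: "(\<And>x y. F (x + y) = F x + F y) \<Longrightarrow> (\<And>c x. F (c *s x) = c *s F x) \<Longrightarrow> lin F"
  by (unfold_locales) auto

text \<open>
  Coefficient sequences are extended by zero to the integers, so that indices can be shifted
  freely.
\<close>

definition zext :: "(nat \<Rightarrow> 'v endo) \<Rightarrow> int \<Rightarrow> 'v endo" where
  "zext f k = (if k < 0 then 0 else f (nat k))"

lemma zext_of_nat [simp]: "zext f (int n) = f n" and zext_neg: "k < 0 \<Longrightarrow> zext f k = 0"
  by (simp_all add: zext_def)

definition (in -) zcoeff :: "complex fps \<Rightarrow> int \<Rightarrow> complex" where
  "zcoeff g k = (if k < 0 then 0 else g $ nat k)"

lemma (in -) zcoeff_neg: "k < 0 \<Longrightarrow> zcoeff g k = 0" by (simp add: zcoeff_def)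

lemma linear_zext: "(\<And>n. S.linear_elt (f n)) \<Longrightarrow> S.linear_elt (zext f k)"
  by (simp add: zext_def)

lemma zext_commute: "(\<And>a. x * f a = f a * x) \<Longrightarrow> x * zext f k = zext f k * x"
  by (simp add: zext_def)

lemma zext_commute2: "(\<And>a b. f a * g b = g b * f a) \<Longrightarrow> zext f k * zext g l = zext g l * zext f k"
  by (simp add: zext_def)

abbreviation Pz :: "'n mod_ring \<Rightarrow> int \<Rightarrow> 'v endo" where "Pz i \<equiv> zext (P i)"
abbreviation Mz :: "'n mod_ring \<Rightarrow> int \<Rightarrow> 'v endo" where "Mz i \<equiv> zext (M i)"

lemma PMz_commute: "Pz i a \<star> Pz j b \<star> v = Pz j b \<star> Pz i a \<star> v" "Mz i a \<star> Mz j b \<star> v = Mz j b \<star> Mz i a \<star> v"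
proof -
  have "Pz i a * Pz j b = Pz j b * Pz i a" by (rule zext_commute2) (rule P_P)
  from arg_cong[OF this, of "\<lambda>e. e \<star> v"] show "Pz i a \<star> Pz j b \<star> v = Pz j b \<star> Pz i a \<star> v" by simp
  have "Mz i a * Mz j b = Mz j b * Mz i a" by (rule zext_commute2) (rule M_M)
  from arg_cong[OF this, of "\<lambda>e. e \<star> v"] show "Mz i a \<star> Mz j b \<star> v = Mz j b \<star> Mz i a \<star> v" by simp
qed

lemma linear_Pz: "S.linear_elt (Pz i a)" "S.linear_elt (Mz i a)"
  by (auto intro: linear_zext linear_PM)

lemmas PMz_lin = endo_apply_lin[OF linear_Pz(1)] endo_apply_lin[OF linear_Pz(2)]

lemma Pz_vanishes: "bnd L v \<Longrightarrow> c > L \<Longrightarrow> Pz j c \<star> v = 0"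
  using homog_PM(1)[of j "nat c"] by (cases "c < 0") (auto simp: zext_def bnd_def)

lemma Pz_Pz_vanishes: "bnd L v \<Longrightarrow> a + b > L \<Longrightarrow> Pz j a \<star> Pz i b \<star> v = 0"
proof (cases "a < 0 \<or> b < 0")
  case False
  assume "bnd L v" "a + b > L"
  then show ?thesis using homog_mult[OF homog_PM(1)[of j "nat a"] homog_PM(1)[of i "nat b"]] False
    unfolding bnd_def by (auto simp: zext_def simp flip: endo_apply_simps(6))
qed (auto simp: zext_def PMz_lin endo_apply_lin linear_PM)

lemma bnd_0: "bnd L 0"
  unfolding bnd_def homog_def by (auto simp: endo_apply_lin)

lemma bnd_Pz: "bnd L v \<Longrightarrow> bnd L (Pz j c \<star> v)"
  by (auto simp: zext_def bnd_0 intro: bnd_apply[OF _ homog_PM(1)])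

text \<open>
  The coefficient of \<open>z\<^sup>-\<^sup>n\<close> in \<open>M\<^sub>j(z) F P\<^sub>j(z)\<close>.  Nested insertions are normally ordered products.
\<close>

definition ins :: "'n mod_ring \<Rightarrow> int \<Rightarrow> ('v \<Rightarrow> 'v) \<Rightarrow> 'v \<Rightarrow> 'v" where
  "ins j n F v = (\<Sum>c. Mz j (c - n) \<star> F (Pz j c \<star> v))"

lemma ins_eq:
  assumes v: "bnd L v" and F: "lin F" and lo: "lo \<le> 0"
  shows "ins j n F v = (\<Sum>c\<in>{lo..L}. Mz j (c - n) \<star> F (Pz j c \<star> v))"
  unfolding ins_def
proof (rule Sum_any.expand_superset)
  show "{c. Mz j (c - n) \<star> F (Pz j c \<star> v) \<noteq> 0} \<subseteq> {lo..L}"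
  proof
    fix c assume c: "c \<in> {c. Mz j (c - n) \<star> F (Pz j c \<star> v) \<noteq> 0}"
    then have "Pz j c \<star> v \<noteq> 0" by (auto simp: lin_simps[OF F] PMz_lin)
    then have "\<not> c < 0" "\<not> c > L" using Pz_vanishes[OF v, of c j] by (auto simp: zext_def)
    then show "c \<in> {lo..L}" using lo by simp
  qed
qed simp

lemma lin_ins: assumes F: "lin F" shows "lin (ins j n F)"
proof (rule linI)
  fix x y c
  obtain L1 L2 where "bnd L1 x" "bnd L2 y" using bnd_exists by blast
  define L where "L = max L1 L2"
  have b: "bnd L x" "bnd L y" using \<open>bnd L1 x\<close> \<open>bnd L2 y\<close> by (auto simp: L_def intro: bnd_mono)
  have b': "bnd L (x + y)" "bnd L (c *s x)"
    using b unfolding bnd_def homog_def by (auto simp: endo_apply_lin)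
  show "ins j n F (x + y) = ins j n F x + ins j n F y"
    unfolding ins_eq[OF b(1) F order.refl] ins_eq[OF b(2) F order.refl] ins_eq[OF b'(1) F order.refl]
    by (simp add: lin_simps[OF F] PMz_lin sum.distrib)
  show "ins j n F (c *s x) = c *s ins j n F x"
    unfolding ins_eq[OF b(1) F order.refl] ins_eq[OF b'(2) F order.refl]
    by (simp add: lin_simps[OF F] PMz_lin scale_sum_right)
qed

lemma ins_vanishes: "bnd L v \<Longrightarrow> lin F \<Longrightarrow> n > L \<Longrightarrow> ins j n F v = 0"
  using ins_eq[of L v F 0 j n] by (simp add: zext_def)

lemma ins_cong:
  assumes "bnd L v" "lin F" "lin G" "\<And>u. bnd L u \<Longrightarrow> F u = G u"
  shows "ins j n F v = ins j n G v"
  unfolding ins_eq[OF assms(1,2) order.refl] ins_eq[OF assms(1,3) order.refl]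
  by (intro sum.cong refl arg_cong[where f = "endo_apply _"] assms bnd_Pz)

lemma lin_scaled_sum: "(\<And>b. b \<in> A \<Longrightarrow> lin (F b)) \<Longrightarrow> lin (\<lambda>u. \<Sum>b\<in>A. t b *s F b u)"
  by (rule linI) (simp_all add: lin_simps(1,2) scale_right_distrib sum.distrib scale_sum_right mult.commute cong: sum.cong)

lemma ins_scaled_sum:
  assumes F: "\<And>b. b \<in> A \<Longrightarrow> lin (F b)"
  shows "ins j n (\<lambda>u. \<Sum>b\<in>A. t b *s F b u) v = (\<Sum>b\<in>A. t b *s ins j n (F b) v)"
proof -
  obtain L where L: "bnd L v" using bnd_exists by blast
  have "ins j n (\<lambda>u. \<Sum>b\<in>A. t b *s F b u) v =
      (\<Sum>c\<in>{0..L}. \<Sum>b\<in>A. t b *s Mz j (c - n) \<star> F b (Pz j c \<star> v))"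
  proof -
    have "lin (\<lambda>u. \<Sum>b\<in>A. t b *s F b u)" by (rule lin_scaled_sum) (rule F)
    from ins_eq[OF L this order.refl] show ?thesis by (simp add: PMz_lin)
  qed
  also have "\<dots> = (\<Sum>b\<in>A. t b *s ins j n (F b) v)"
    by (subst sum.swap) (intro sum.cong refl, simp add: ins_eq[OF L F order.refl] scale_sum_right)
  finally show ?thesis .
qed

text \<open>
  Normally ordered products are symmetric, because the \<open>M\<close> commute with each other, and so do the \<open>P\<close>.
\<close>

lemma ins_commute:
  assumes F: "lin F" shows "ins k p (ins j n F) v = ins j n (ins k p F) v"
proof -
  obtain L where L: "bnd L v" using bnd_exists by blast
  have *: "ins k p (ins j n F) v = (\<Sum>c\<in>{0..L}. \<Sum>b\<in>{0..L}. Mz k (c - p) \<star> Mz j (b - n) \<star> F (Pz j b \<star> Pz k c \<star> v))"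
    for k p j n
    unfolding ins_eq[OF L lin_ins[OF F] order.refl] ins_eq[OF bnd_Pz[OF L] F order.refl]
    by (simp add: PMz_lin)
  show ?thesis unfolding *
    by (subst sum.swap) (intro sum.cong refl, simp only: PMz_commute(2)[of k] PMz_commute(1)[of j])
qed

text \<open>
  The boundary current without its constant factor.
\<close>

abbreviation EE :: "'n mod_ring \<Rightarrow> int \<Rightarrow> 'v \<Rightarrow> 'v" where
  "EE i m \<equiv> ins i m (\<lambda>u. u)"

lemma lin_id: "lin (\<lambda>u. u)" by (rule linI) auto
lemma lin_EE: "lin (EE i m)" by (rule lin_ins[OF lin_id])

lemma zext_exchange:
  assumes ex: "\<And>a b. X a * Z b = (\<Sum>l\<le>min a b. sc (g $ l) * (Z (b - l) * X (a - l)))" and K: "K \<ge> t"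
  shows "zext X a * zext Z t = (\<Sum>l\<in>{0..K}. sc (zcoeff g l) * (zext Z (t - l) * zext X (a - l)))"
proof (cases "a < 0 \<or> t < 0")
  case True
  then show ?thesis by (auto simp: zext_def intro!: sum.neutral[symmetric])
next
  case False
  then obtain a' t' where [simp]: "a = int a'" "t = int t'" by (metis not_less zero_le_imp_eq_int)
  have "(\<Sum>l\<in>{0..K}. sc (zcoeff g l) * (zext Z (t - l) * zext X (a - l))) =
      (\<Sum>l\<in>int ` {..min a' t'}. sc (zcoeff g l) * (zext Z (t - l) * zext X (a - l)))"
  proof (rule sum.mono_neutral_right)
    show "\<forall>l\<in>{0..K} - int ` {..min a' t'}. sc (zcoeff g l) * (zext Z (t - l) * zext X (a - l)) = 0"
    proof
      fix l assume l: "l \<in> {0..K} - int ` {..min a' t'}"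
      have "\<not> (l \<le> int a' \<and> l \<le> int t')"
      proof
        assume "l \<le> int a' \<and> l \<le> int t'"
        then have "l = int (nat l)" "nat l \<in> {..min a' t'}" using l by auto
        then show False using l by blast
      qed
      then show "sc (zcoeff g l) * (zext Z (t - l) * zext X (a - l)) = 0"
        by (auto simp: zext_def)
    qed
  qed (use K in auto)
  also have "\<dots> = (\<Sum>l\<le>min a' t'. sc (g $ l) * (Z (t' - l) * X (a' - l)))"
    by (subst sum.reindex) (auto simp: zcoeff_def zext_def of_nat_diff nat_diff_distrib intro!: sum.cong)
  finally show ?thesis by (simp add: ex)
qed

text \<open>
  Moving a current to the right past a current that commutes with \<open>M\<^sub>i\<close> costs only the exchange with
  \<open>P\<^sub>i\<close>.
\<close>

lemma EE_through:
  assumes ex: "\<And>a b. P i a * Z b = (\<Sum>l\<le>min a b. sc (g $ l) * (Z (b - l) * P i (a - l)))"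
    and com: "\<And>a b. M i a * Z b = Z b * M i a" and linZ: "\<And>b. S.linear_elt (Z b)" and K: "K \<ge> t"
  shows "EE i m (zext Z t \<star> w) = (\<Sum>l\<in>{0..K}. zcoeff g l *s zext Z (t - l) \<star> EE i (m - l) w)"
proof -
  obtain L1 L2 where L: "bnd L1 w" "bnd L2 (zext Z t \<star> w)" using bnd_exists by blast
  define L where "L = max L1 L2 + max K 0"
  have b: "bnd L (zext Z t \<star> w)" using L by (auto simp: L_def intro: bnd_mono)
  have Mc: "Mz i a \<star> zext Z b \<star> u = zext Z b \<star> Mz i a \<star> u" for a b u
  proof -
    have "Mz i a * zext Z b = zext Z b * Mz i a" by (rule zext_commute2) (rule com)
    from arg_cong[OF this, of "\<lambda>e. e \<star> u"] show ?thesis by simp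
  qed
  have PZ: "Pz i a \<star> zext Z t \<star> w = (\<Sum>l\<in>{0..K}. zcoeff g l *s zext Z (t - l) \<star> Pz i (a - l) \<star> w)" for a
    using arg_cong[OF zext_exchange[OF ex K, of a], of "\<lambda>e. e \<star> w"] by simp
  have "EE i m (zext Z t \<star> w) = (\<Sum>a\<in>{0..L}. \<Sum>l\<in>{0..K}. zcoeff g l *s zext Z (t - l) \<star> Mz i (a - m) \<star> Pz i (a - l) \<star> w)"
    unfolding ins_eq[OF b lin_id order.refl] PZ by (simp add: PMz_lin Mc)
  also have "\<dots> = (\<Sum>l\<in>{0..K}. zcoeff g l *s zext Z (t - l) \<star> (\<Sum>a\<in>{0..L}. Mz i (a - m) \<star> Pz i (a - l) \<star> w))"
    by (subst sum.swap) (simp add: endo_apply_lin[OF linear_zext[OF linZ]] scale_sum_right)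
  also have "\<dots> = (\<Sum>l\<in>{0..K}. zcoeff g l *s zext Z (t - l) \<star> EE i (m - l) w)"
  proof (intro sum.cong refl)
    fix l assume l: "l \<in> {0..K}"
    have "(\<Sum>a\<in>{0..L}. Mz i (a - m) \<star> Pz i (a - l) \<star> w) = (\<Sum>a\<in>{- l..L - l}. Mz i (a - (m - l)) \<star> Pz i a \<star> w)"
      by (rule sum.reindex_bij_witness[of _ "\<lambda>a. a + l" "\<lambda>a. a - l"]) (auto simp: algebra_simps)
    also have "\<dots> = EE i (m - l) w"
      by (rule ins_eq[OF _ lin_id, symmetric]) (use l L in \<open>auto simp: L_def intro: bnd_mono\<close>)
    finally show "zcoeff g l *s zext Z (t - l) \<star> (\<Sum>a\<in>{0..L}. Mz i (a - m) \<star> Pz i (a - l) \<star> w) =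
      zcoeff g l *s zext Z (t - l) \<star> EE i (m - l) w" by simp
  qed
  finally show ?thesis .
qed

abbreviation th :: "'n mod_ring \<Rightarrow> 'n mod_ring \<Rightarrow> int \<Rightarrow> complex" where
  "th i j \<equiv> zcoeff (theta i j)"

lemma lin_comp: "lin F \<Longrightarrow> lin G \<Longrightarrow> lin (\<lambda>u. F (G u))"
  by (rule linI) (simp_all add: lin_simps)

text \<open>
  Normal ordering of one further current.
\<close>

lemma EE_ins:
  assumes v: "bnd L v" and F: "lin F" and lo: "lo \<le> n"
  shows "EE i m (ins j n F v) = (\<Sum>b\<in>{lo..L}. th i j (b - n) *s ins j b (\<lambda>u. EE i (m + n - b) (F u)) v)"
proof -
  have A: "EE i m (Mz j (c - n) \<star> F (Pz j c \<star> v)) =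
      (\<Sum>l\<in>{0..L - n}. th i j l *s Mz j (c - n - l) \<star> EE i (m - l) (F (Pz j c \<star> v)))" if "c \<in> {0..L}" for c
    by (rule EE_through[OF P_M M_M linear_PM(2)]) (use that in simp)
  have "EE i m (ins j n F v) = (\<Sum>c\<in>{0..L}. \<Sum>l\<in>{0..L - n}. th i j l *s Mz j (c - n - l) \<star> EE i (m - l) (F (Pz j c \<star> v)))"
    unfolding ins_eq[OF v F order.refl] lin_simps[OF lin_EE] by (intro sum.cong refl A)
  also have "\<dots> = (\<Sum>l\<in>{0..L - n}. th i j l *s ins j (n + l) (\<lambda>u. EE i (m - l) (F u)) v)"
    by (subst sum.swap) (simp add: ins_eq[OF v lin_comp[OF lin_EE F] order.refl] scale_sum_right algebra_simps)
  also have "\<dots> = (\<Sum>b\<in>{n..L}. th i j (b - n) *s ins j b (\<lambda>u. EE i (m + n - b) (F u)) v)"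
    by (rule sum.reindex_bij_witness[of _ "\<lambda>b. b - n" "\<lambda>l. l + n"]) (auto simp: algebra_simps)
  also have "\<dots> = (\<Sum>b\<in>{lo..L}. th i j (b - n) *s ins j b (\<lambda>u. EE i (m + n - b) (F u)) v)"
    by (rule sum.mono_neutral_left) (use lo in \<open>auto simp: zcoeff_neg\<close>)
  finally show ?thesis .
qed

lemma EE_EE:
  assumes "bnd L v" "lo \<le> n"
  shows "EE i m (EE j n v) = (\<Sum>b\<in>{lo..L}. th i j (b - n) *s ins j b (EE i (m + n - b)) v)"
  by (rule EE_ins[OF assms(1) lin_id assms(2)])

text \<open>
  Normal ordering of three currents, with one exchange series for each pair.
\<close>

lemma EE_EE_EE:
  assumes v: "bnd L v" and lo: "lo \<le> p" "lo \<le> n + p - L"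
  shows "EE i m (EE j n (EE k p v)) = (\<Sum>c\<in>{lo..L}. \<Sum>e\<in>{lo..L}. \<Sum>b\<in>{lo..L}.
    (th j k (c - p) * th i k (e - c) * th i j (b + c - n - p)) *s ins k e (ins j b (EE i (m + n + p - e - b))) v)"
proof -
  have A: "ins k e (\<lambda>u. EE i (m + c - e) (EE j (n + p - c) u)) v =
      (\<Sum>b\<in>{lo..L}. th i j (b + c - n - p) *s ins k e (ins j b (EE i (m + n + p - e - b))) v)"
    if "c \<in> {lo..L}" for c e
  proof -
    have "ins k e (\<lambda>u. EE i (m + c - e) (EE j (n + p - c) u)) v =
      ins k e (\<lambda>u. \<Sum>b\<in>{lo..L}. th i j (b - (n + p - c)) *s ins j b (EE i (m + c - e + (n + p - c) - b)) u) v"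
    proof (rule ins_cong[OF v lin_comp[OF lin_EE lin_EE]])
      show "lin (\<lambda>u. \<Sum>b\<in>{lo..L}. th i j (b - (n + p - c)) *s ins j b (EE i (m + c - e + (n + p - c) - b)) u)"
        by (rule lin_scaled_sum) (rule lin_ins[OF lin_EE])
      fix u assume "bnd L u"
      then show "EE i (m + c - e) (EE j (n + p - c) u) =
          (\<Sum>b\<in>{lo..L}. th i j (b - (n + p - c)) *s ins j b (EE i (m + c - e + (n + p - c) - b)) u)"
        by (rule EE_EE) (use that lo in simp)
    qed
    also have "\<dots> = (\<Sum>b\<in>{lo..L}. th i j (b - (n + p - c)) *s ins k e (ins j b (EE i (m + c - e + (n + p - c) - b))) v)"
      by (rule ins_scaled_sum) (rule lin_ins[OF lin_EE])
    also have "\<dots> = (\<Sum>b\<in>{lo..L}. th i j (b + c - n - p) *s ins k e (ins j b (EE i (m + n + p - e - b))) v)"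
      by (rule sum.cong) (simp_all add: algebra_simps)
    finally show ?thesis .
  qed
  have "EE i m (EE j n (EE k p v)) = (\<Sum>c\<in>{lo..L}. th j k (c - p) *s EE i m (ins k c (EE j (n + p - c)) v))"
    unfolding EE_EE[OF v lo(1)] lin_simps[OF lin_EE] ..
  also have "\<dots> = (\<Sum>c\<in>{lo..L}. th j k (c - p) *s (\<Sum>e\<in>{lo..L}. th i k (e - c) *s
      (\<Sum>b\<in>{lo..L}. th i j (b + c - n - p) *s ins k e (ins j b (EE i (m + n + p - e - b))) v)))"
  proof (rule sum.cong, rule refl)
    fix c assume c: "c \<in> {lo..L}"
    then show "th j k (c - p) *s EE i m (ins k c (EE j (n + p - c)) v) =
        th j k (c - p) *s (\<Sum>e\<in>{lo..L}. th i k (e - c) *s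
      (\<Sum>b\<in>{lo..L}. th i j (b + c - n - p) *s ins k e (ins j b (EE i (m + n + p - e - b))) v))"
      using EE_ins[OF v lin_EE, of lo c i m k j "n + p - c"] A[OF c] by simp
  qed
  finally show ?thesis by (simp add: scale_sum_right mult.assoc)
qed

lemma q_powi_add: "q powi (a + b) = q powi a * q powi b"
  by (rule power_int_add) simp

text \<open>
  The square relation between a current and its root, in a form that allows larger summation
  ranges.
\<close>

lemma zext_square:
  assumes KX: "\<And>p. KX p = (\<Sum>b\<le>p. sc (q ^ (p - b)) * (X b * X (p - b)))" and AB: "A \<le> 0" "B \<ge> p"
  shows "zext KX p = (\<Sum>b\<in>{A..B}. sc (q powi (p - b)) * (zext X b * zext X (p - b)))"
proof (cases "p < 0")
  case True
  then have "zext X b * zext X (p - b) = 0" for b by (cases "b < 0") (simp_all add: zext_neg)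
  then show ?thesis using True by (simp add: zext_neg)
next
  case False
  then obtain p' where [simp]: "p = int p'" by (metis not_less zero_le_imp_eq_int)
  have "(\<Sum>b\<in>{A..B}. sc (q powi (p - b)) * (zext X b * zext X (p - b))) =
      (\<Sum>b\<in>int ` {..p'}. sc (q powi (p - b)) * (zext X b * zext X (p - b)))"
  proof (rule sum.mono_neutral_right)
    show "\<forall>b\<in>{A..B} - int ` {..p'}. sc (q powi (p - b)) * (zext X b * zext X (p - b)) = 0"
    proof
      fix b assume b: "b \<in> {A..B} - int ` {..p'}"
      have "\<not> (0 \<le> b \<and> b \<le> int p')"
      proof
        assume "0 \<le> b \<and> b \<le> int p'"
        then have "b = int (nat b)" "nat b \<in> {..p'}" by auto
        then show False using b by blast
      qed
      then show "sc (q powi (p - b)) * (zext X b * zext X (p - b)) = 0" by (auto simp: zext_def)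
    qed
  qed (use AB in auto)
  also have "\<dots> = (\<Sum>b\<le>p'. sc (q ^ (p' - b)) * (X b * X (p' - b)))"
    by (subst sum.reindex) (auto simp: of_nat_diff[symmetric] simp del: of_nat_diff intro!: sum.cong)
  finally show ?thesis by (simp add: KX)
qed

abbreviation KPz :: "'n mod_ring \<Rightarrow> int \<Rightarrow> 'v endo" where "KPz i \<equiv> zext (KP i)"
abbreviation KMz :: "'n mod_ring \<Rightarrow> int \<Rightarrow> 'v endo" where "KMz i \<equiv> zext (KM i)"

lemma KMz_coeff:
  assumes "A \<le> s - a" "b \<le> B"
  shows "(\<Sum>n\<in>{A..B}. sc (q powi (- n)) * (Mz i (a - s + n) * Mz i (b - n))) = sc (q powi (- b)) * KMz i (a + b - s)"
proof -
  have "KMz i (a + b - s) = (\<Sum>c\<in>{A + a - s..B + a - s}. sc (q powi (a + b - s - c)) * (Mz i c * Mz i (a + b - s - c)))"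
    by (rule zext_square[OF KM_square]) (use assms in auto)
  also have "\<dots> = (\<Sum>n\<in>{A..B}. sc (q powi (b - n)) * (Mz i (a - s + n) * Mz i (b - n)))"
    by (rule sum.reindex_bij_witness[of _ "\<lambda>n. n + a - s" "\<lambda>c. c - a + s"]) (auto simp: algebra_simps)
  finally have "sc (q powi (- b)) * KMz i (a + b - s) =
      (\<Sum>n\<in>{A..B}. sc (q powi (- b)) * (sc (q powi (b - n)) * (Mz i (a - s + n) * Mz i (b - n))))"
    by (simp only: sum_distrib_left)
  moreover have "sc (q powi (- b)) * (sc (q powi (b - n)) * x) = sc (q powi (- n)) * x" for n x
    unfolding mult.assoc[symmetric] S.\<sigma>_mult[symmetric] q_powi_add[symmetric] by simp
  ultimately show ?thesis by simp
qed

text \<open>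
  Summation against \<open>q\<^sup>-\<^sup>n\<close> restricts the two arguments of a normally ordered product to \<open>w = q z\<close>.  There
  the two factors \<open>M\<close> multiply to \<open>K\<^sup>-\<close> and the two factors \<open>P\<close> to \<open>K\<^sup>+\<close>.
\<close>

lemma ins_ins_diagonal:
  assumes v: "bnd L v" and F: "lin F" and A: "A \<le> s - L"
  shows "(\<Sum>n\<in>{A..L}. q powi (- n) *s ins i (s - n) (ins i n F) v) =
    (\<Sum>c\<in>{0..L}. q powi (- c) *s KMz i (c - s) \<star> F (KPz i c \<star> v))"
proof -
  have linK: "S.linear_elt (KMz i k)" for k by (intro linear_zext linear_PM)
  have "(\<Sum>n\<in>{A..L}. q powi (- n) *s ins i (s - n) (ins i n F) v) =
     (\<Sum>n\<in>{A..L}. \<Sum>a\<in>{0..L}. \<Sum>b\<in>{0..L}. q powi (- n) *s Mz i (a - s + n) \<star> Mz i (b - n) \<star> F (Pz i b \<star> Pz i a \<star> v))"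
    unfolding ins_eq[OF v lin_ins[OF F] order.refl] ins_eq[OF bnd_Pz[OF v] F order.refl]
    by (simp add: PMz_lin scale_sum_right algebra_simps)
  also have "\<dots> = (\<Sum>a\<in>{0..L}. \<Sum>b\<in>{0..L}. \<Sum>n\<in>{A..L}. q powi (- n) *s Mz i (a - s + n) \<star> Mz i (b - n) \<star> F (Pz i b \<star> Pz i a \<star> v))"
    by (subst sum.swap) (intro sum.cong refl sum.swap)
  also have "\<dots> = (\<Sum>a\<in>{0..L}. \<Sum>b\<in>{0..L}. q powi (- b) *s KMz i (a + b - s) \<star> F (Pz i b \<star> Pz i a \<star> v))"
  proof (intro sum.cong refl)
    fix a b assume "a \<in> {0..L}" "b \<in> {0..L}"
    then have "A \<le> s - a" "b \<le> L" using A by auto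
    from arg_cong[OF KMz_coeff[OF this, of i], of "\<lambda>e. e \<star> F (Pz i b \<star> Pz i a \<star> v)"]
    show "(\<Sum>n\<in>{A..L}. q powi (- n) *s Mz i (a - s + n) \<star> Mz i (b - n) \<star> F (Pz i b \<star> Pz i a \<star> v)) =
        q powi (- b) *s KMz i (a + b - s) \<star> F (Pz i b \<star> Pz i a \<star> v)" by simp
  qed
  also have "\<dots> = (\<Sum>b\<in>{0..L}. \<Sum>a\<in>{0..L}. q powi (- b) *s KMz i (a + b - s) \<star> F (Pz i b \<star> Pz i a \<star> v))"
    by (rule sum.swap)
  also have "\<dots> = (\<Sum>b\<in>{0..L}. \<Sum>c\<in>{0..L}. q powi (- b) *s KMz i (c - s) \<star> F (Pz i b \<star> Pz i (c - b) \<star> v))"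
  proof (rule sum.cong, rule refl)
    fix b assume b: "b \<in> {0..L}"
    have z: "a < 0 \<or> a + b > L \<Longrightarrow> Pz i b \<star> Pz i a \<star> v = 0" for a
      using Pz_Pz_vanishes[OF v, of b a i i] by (auto simp: zext_neg PMz_lin add.commute)
    have z': "a < 0 \<or> a + b > L \<Longrightarrow> KMz i (a + b - s) \<star> F (Pz i b \<star> Pz i a \<star> v) = 0" for a
      by (simp add: z lin_simps[OF F] endo_apply_lin[OF linK])
    have "(\<Sum>a\<in>{0..L}. q powi (- b) *s KMz i (a + b - s) \<star> F (Pz i b \<star> Pz i a \<star> v)) =
        (\<Sum>a\<in>{0..L - b}. q powi (- b) *s KMz i (a + b - s) \<star> F (Pz i b \<star> Pz i a \<star> v))"
      by (rule sum.mono_neutral_right) (use b in \<open>auto intro!: z'\<close>)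
    also have "\<dots> = (\<Sum>a\<in>{- b..L - b}. q powi (- b) *s KMz i (a + b - s) \<star> F (Pz i b \<star> Pz i a \<star> v))"
      by (rule sum.mono_neutral_left) (use b in \<open>auto intro!: z'\<close>)
    also have "\<dots> = (\<Sum>c\<in>{0..L}. q powi (- b) *s KMz i (c - s) \<star> F (Pz i b \<star> Pz i (c - b) \<star> v))"
      by (rule sum.reindex_bij_witness[of _ "\<lambda>c. c - b" "\<lambda>a. a + b"]) auto
    finally show "(\<Sum>a\<in>{0..L}. q powi (- b) *s KMz i (a + b - s) \<star> F (Pz i b \<star> Pz i a \<star> v)) =
      (\<Sum>c\<in>{0..L}. q powi (- b) *s KMz i (c - s) \<star> F (Pz i b \<star> Pz i (c - b) \<star> v))" .
  qed
  also have "\<dots> = (\<Sum>c\<in>{0..L}. \<Sum>b\<in>{0..L}. q powi (- b) *s KMz i (c - s) \<star> F (Pz i b \<star> Pz i (c - b) \<star> v))"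
    by (rule sum.swap)
  also have "\<dots> = (\<Sum>c\<in>{0..L}. q powi (- c) *s KMz i (c - s) \<star> F (KPz i c \<star> v))"
  proof (rule sum.cong, rule refl)
    fix c assume c: "c \<in> {0..L}"
    have "KPz i c = (\<Sum>b\<in>{0..L}. sc (q powi (c - b)) * (Pz i b * Pz i (c - b)))"
      by (rule zext_square[OF KP_square]) (use c in auto)
    then have "q powi (- c) *s KMz i (c - s) \<star> F (KPz i c \<star> v) =
       (\<Sum>b\<in>{0..L}. q powi (- c) *s q powi (c - b) *s KMz i (c - s) \<star> F (Pz i b \<star> Pz i (c - b) \<star> v))"
      by (simp add: lin_simps[OF F] endo_apply_lin[OF linK] scale_sum_right)
    also have "\<dots> = (\<Sum>b\<in>{0..L}. q powi (- b) *s KMz i (c - s) \<star> F (Pz i b \<star> Pz i (c - b) \<star> v))"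
      unfolding scale_scale q_powi_add[symmetric] by simp
    finally show "(\<Sum>b\<in>{0..L}. q powi (- b) *s KMz i (c - s) \<star> F (Pz i b \<star> Pz i (c - b) \<star> v)) =
      q powi (- c) *s KMz i (c - s) \<star> F (KPz i c \<star> v)" by simp
  qed
  finally show ?thesis .
qed

lemma KP_EE: "KP i a \<star> EE j m v = (\<Sum>l\<le>a. (G_series q d i j $ l) *s EE j (m + int l) (KP i (a - l) \<star> v))"
proof -
  obtain L where L: "bnd L v" using bnd_exists by blast
  have b: "bnd L (KP i c \<star> v)" for c by (rule bnd_apply[OF L homog_PM(3)]) simp
  have KPM: "KP i a * Mz j k = (\<Sum>l\<le>a. sc (G_series q d i j $ l) * (Mz j (k - int l) * KP i (a - l)))" for k
  proof (cases "k < 0")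
    case True
    then show ?thesis by (simp add: zext_def)
  next
    case False
    then obtain k' where [simp]: "k = int k'" by (metis not_less zero_le_imp_eq_int)
    have "(\<Sum>l\<le>a. sc (G_series q d i j $ l) * (Mz j (k - int l) * KP i (a - l))) =
        (\<Sum>l\<le>min a k'. sc (G_series q d i j $ l) * (M j (k' - l) * KP i (a - l)))"
      by (rule sum.mono_neutral_cong_right) (auto simp: zext_def nat_diff_distrib)
    then show ?thesis by (simp add: KP_M)
  qed
  have KPP: "KP i c \<star> Pz j k \<star> v = Pz j k \<star> KP i c \<star> v" for c k
    using arg_cong[OF zext_commute[of "KP i c" "P j" k, OF KP_P], of "\<lambda>e. e \<star> v"] by simp
  have KPMv: "KP i a \<star> Mz j k \<star> w = (\<Sum>l\<le>a. (G_series q d i j $ l) *s Mz j (k - int l) \<star> KP i (a - l) \<star> w)" for k w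
    using arg_cong[OF KPM[of k], of "\<lambda>e. e \<star> w"] by simp
  have "KP i a \<star> EE j m v = (\<Sum>c\<in>{0..L}. \<Sum>l\<le>a. (G_series q d i j $ l) *s Mz j (c - (m + int l)) \<star> Pz j c \<star> KP i (a - l) \<star> v)"
    unfolding ins_eq[OF L lin_id order.refl] endo_apply_lin[OF linear_PM(3)] KPMv KPP by (simp add: algebra_simps)
  also have "\<dots> = (\<Sum>l\<le>a. (G_series q d i j $ l) *s EE j (m + int l) (KP i (a - l) \<star> v))"
    by (subst sum.swap) (simp add: ins_eq[OF b lin_id order.refl] scale_sum_right)
  finally show ?thesis .
qed

lemma EE_KM: "EE j m (KM i b \<star> v) = (\<Sum>l\<le>b. (G_series q d j i $ l) *s KM i (b - l) \<star> EE j (m - int l) v)"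
proof -
  have "EE j m (zext (KM i) (int b) \<star> v) =
      (\<Sum>l\<in>{0..int b}. zcoeff (G_series q d j i) l *s zext (KM i) (int b - l) \<star> EE j (m - l) v)"
    by (rule EE_through[OF P_KM KM_M[symmetric] linear_PM(4)]) simp
  also have "\<dots> = (\<Sum>l\<in>int ` {..b}. zcoeff (G_series q d j i) l *s zext (KM i) (int b - l) \<star> EE j (m - l) v)"
    by (simp add: image_int_atLeastAtMost atMost_atLeast0)
  also have "\<dots> = (\<Sum>l\<le>b. (G_series q d j i $ l) *s KM i (b - l) \<star> EE j (m - int l) v)"
    by (subst sum.reindex) (auto simp: zcoeff_def zext_def nat_diff_distrib intro!: sum.cong)
  finally show ?thesis by simp
qed

end

section \<open>Scalar identities for the exchange series\<close>

text \<open>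
  Reindexing of sums whose ranges correspond to each other only where the terms are nonzero.
\<close>

lemma sum_reindex_support:
  fixes g h :: "int \<Rightarrow> 'c::comm_monoid_add"
  assumes fin: "finite S" "finite T"
    and inv: "\<And>x. i (j x) = x" "\<And>y. j (i y) = y"
    and S: "\<And>x. x \<in> S \<Longrightarrow> g x \<noteq> 0 \<Longrightarrow> j x \<in> T" and T: "\<And>y. y \<in> T \<Longrightarrow> h y \<noteq> 0 \<Longrightarrow> i y \<in> S"
    and eq: "\<And>x. h (j x) = g x"
  shows "sum g S = sum h T"
proof (rule sum.reindex_bij_witness_not_neutral[of "{x \<in> S. g x = 0}" "{y \<in> T. h y = 0}" _ i j])
  fix y assume y: "y \<in> T - {y \<in> T. h y = 0}"
  then have "g (i y) = h y" using eq[of "i y"] by (simp add: inv)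
  then show "i y \<in> S - {x \<in> S. g x = 0}" using y T by auto
next
  fix x assume "x \<in> S - {x \<in> S. g x = 0}"
  then show "j x \<in> T - {y \<in> T. h y = 0}" using S eq by auto
qed (use fin in \<open>auto simp: inv eq\<close>)

lemma ratio_nth: "ratio a b $ n = (if n = 0 then 1 else b ^ n - a * b ^ (n - 1))"
  unfolding ratio_def inverse_geometric
  by (cases n) (simp_all add: left_diff_distrib mult.assoc)

lemma fps_dilate_ratio: "fps_dilate s (ratio a b) = ratio (s * a) (s * b)"
proof (rule fps_ext)
  fix n show "fps_dilate s (ratio a b) $ n = ratio (s * a) (s * b) $ n"
    by (cases n) (simp_all add: fps_dilate_def ratio_nth power_mult_distrib algebra_simps)
qed

lemma ratio_mult_ratio: "ratio a b * ratio b c = ratio a c"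
proof -
  have "inverse (1 - fps_const b * fps_X) * (1 - fps_const b * fps_X) = 1"
    by (rule inverse_mult_eq_1) simp
  then have "(1 - fps_const a * fps_X) * (inverse (1 - fps_const b * fps_X) * (1 - fps_const b * fps_X)) *
      inverse (1 - fps_const c * fps_X) = (1 - fps_const a * fps_X) * inverse (1 - fps_const c * fps_X)"
    by simp
  then show ?thesis by (simp only: ratio_def mult.assoc)
qed

text \<open>
  The scalar identities to which the relations between the \<open>E\<^sub>i\<close> reduce involve only \<open>q\<close>.
\<close>

locale quantum_parameter =
  fixes q :: complex
  assumes q_nz: "q \<noteq> 0" and q_neq_1: "q \<noteq> 1" and q_neq_m1: "q \<noteq> - 1"
begin

lemma powi_Suc: "q powi (k + 1) = q * q powi k" and powi_pred: "q powi (k - 1) = q powi k / q"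
  using q_nz by (simp_all add: power_int_add power_int_diff)

lemma powi_nz [simp]: "q powi k \<noteq> 0" using q_nz by simp

text \<open>
  The coefficients of \<open>(1 - x) / (1 - x / q)\<close>, which up to a constant and a dilation is the exchange series
  of neighbouring indices.
\<close>

definition f :: "int \<Rightarrow> complex" where
  "f n = (if n < 0 then 0 else if n = 0 then 1 else (1 - q) * q powi (- n))"

text \<open>
  The coefficients of \<open>1 - x\<close>.
\<close>

definition e :: "int \<Rightarrow> complex" where
  "e n = (if n = 0 then 1 else if n = 1 then - 1 else 0)"

lemma f_rec: "f n = f (n - 1) / q + e n"
proof -
  consider "n < 0" | "n = 0" | "n = 1" | "n \<ge> 2" by linarith
  then show ?thesis
  proof cases
    case 4
    have "q powi (- n) = q powi (- (n - 1)) / q" using powi_pred[of "1 - n"] by simp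
    then show ?thesis using 4 by (simp add: f_def e_def)
  qed (use q_nz in \<open>simp_all add: f_def e_def divide_simps power_int_minus\<close>)
qed

lemma f_neg: "n < 0 \<Longrightarrow> f n = 0" by (simp add: f_def)

lemma e_reflect: "e (1 - n) = - e n" by (simp add: e_def)

text \<open>
  The weight of the normally ordered product of \<open>E\<^sub>i\<close>, \<open>E\<^sub>i\<close>, \<open>E\<^sub>j\<close> in the combination of their three
  orderings that occurs in the Serre relation, before the exchange of the two \<open>E\<^sub>i\<close> is taken into
  account.
\<close>

definition Q :: "int \<Rightarrow> int \<Rightarrow> complex" where
  "Q a b = (f (- a) * f (- b) - (q + 1 / q) * (f (- a) * f b) + f a * f b) / q"

text \<open>
  The product of \<open>Q\<close> with \<open>x - y / q\<^sup>2\<close>, a factor of the numerator of the exchange series of the two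
  \<open>E\<^sub>i\<close>.
\<close>

definition R :: "int \<Rightarrow> int \<Rightarrow> complex" where
  "R a b = Q (a - 1) b - Q a (b - 1) / q^2"

lemma Q_vanishes: "a > 0 \<Longrightarrow> b < 0 \<Longrightarrow> Q a b = 0"
  by (simp add: Q_def f_neg)

text \<open>
  The rational function behind the Serre relation: multiplied by this factor of the
  numerator, the sum over the three orderings is symmetric in the two arguments of \<open>E\<^sub>i\<close>.  On coefficients,
  the recursion of \<open>f\<close> turns \<open>R\<close> into a visibly symmetric expression.
\<close>

lemma R_symmetric: "R a b = R b a"
proof -
  have *: "((A / q - x) * B - (q + 1/q) * ((A / q - x) * (b0 / q + y)) + a0 * (b0 / q + y)) / q -
      (A * (B / q - y) - (q + 1/q) * (A * b0) + (a0 / q + x) * b0) / q / q^2 =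
    ((1/q - 1/q^3) * (A * B + a0 * b0) - x * B - y * A + x * b0 + y * a0 + (q + 1/q) * x * y) / q"
    for A B a0 b0 x y :: complex
    using q_nz by (simp add: divide_simps) (simp add: algebra_simps eval_nat_numeral)
  have r: "R a b = ((1/q - 1/q^3) * (f (- a) * f (- b) + f (a - 1) * f (b - 1)) - e a * f (- b) - e b * f (- a)
      + e a * f (b - 1) + e b * f (a - 1) + (q + 1/q) * e a * e b) / q" for a b
  proof -
    have 1: "f (1 - n) = f (- n) / q - e n" for n using f_rec[of "1 - n"] by (simp add: e_reflect)
    show ?thesis unfolding R_def Q_def
      unfolding minus_diff_eq 1 f_rec[of a] f_rec[of b] by (rule *)
  qed
  show ?thesis unfolding r by (simp add: algebra_simps)
qed

lemma powi_minus: "q powi (- k) = 1 / q powi k"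
  by (simp add: power_int_minus divide_inverse)

text \<open>
  The coefficients of \<open>(1 - x) / ((1 - q x) (1 - x / q))\<close>; multiplication by \<open>q (1 - x / q\<^sup>2)\<close> leads to
  the exchange series \<open>theta_ii\<close> of the currents with equal indices.
\<close>

definition g :: "int \<Rightarrow> complex" where
  "g l = (if l < 0 then 0 else (q / (q + 1)) * (q powi l + q powi (- l - 1)))"

definition theta_ii :: "int \<Rightarrow> complex" where
  "theta_ii l = zcoeff (fps_const q * (ratio 1 q * ratio (inverse (q^2)) (inverse q))) l"

lemma q1_nz: "q + 1 \<noteq> 0" using q_neq_m1 by (metis add_eq_0_iff2)

lemma powi_neg1: "q powi (- l - 1) = 1 / (q * q powi l)"
proof -
  have "- l - 1 = - (l + 1)" by simp
  then show ?thesis by (simp only: powi_minus powi_Suc)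
qed

lemma g_nonneg: "l \<ge> 0 \<Longrightarrow> g l = q / (q + 1) * (q powi l + 1 / (q * q powi l))"
  unfolding g_def powi_neg1 by simp

lemma g_rec: "l \<ge> 1 \<Longrightarrow> g l - g (l - 1) / q = (q - 1) * q powi (l - 1)"
proof -
  assume l: "l \<ge> 1"
  have "q / (q + 1) * (q * x + 1 / (q * (q * x))) - q / (q + 1) * (x + 1 / (q * x)) / q = (q - 1) * x"
    if "x \<noteq> 0" for x
    using that q_nz q1_nz by (simp add: divide_simps) (simp add: algebra_simps eval_nat_numeral)
  note * = this[of "q powi (l - 1)", OF powi_nz]
  have qx: "q powi l = q * q powi (l - 1)" using powi_Suc[of "l - 1"] by simp
  have "l \<ge> 0" "l - 1 \<ge> 0" using l by auto
  then show ?thesis using * by (simp only: g_nonneg qx)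
qed

lemma g_0: "g 0 = 1" using q1_nz q_nz by (simp add: g_nonneg divide_simps)

text \<open>
  The expression for \<open>g\<close> is the partial fraction decomposition of this product.
\<close>

lemma g_fps: "Abs_fps (\<lambda>n. g (int n)) = ratio 1 q * inverse (1 - fps_const (inverse q) * fps_X)"
proof -
  let ?G = "Abs_fps (\<lambda>n. g (int n))" and ?B = "1 - fps_const (inverse q) * fps_X"
  have "?G * ?B = ratio 1 q"
  proof (rule fps_ext)
    fix n
    show "(?G * ?B) $ n = ratio 1 q $ n"
    proof (cases n)
      case (Suc m)
      have "?G * ?B = ?G - fps_const (inverse q) * (fps_X * ?G)" by (simp add: algebra_simps)
      then have "(?G * ?B) $ n = g (int n) - g (int n - 1) / q"
        unfolding Suc by (simp add: divide_inverse mult.commute)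
      also have "\<dots> = (q - 1) * q ^ m" using g_rec[of "int n"] Suc by simp
      finally show ?thesis by (simp add: ratio_nth Suc algebra_simps)
    qed (simp add: g_0 ratio_nth)
  qed
  then have "?G * (?B * inverse ?B) = ratio 1 q * inverse ?B" by (simp only: mult.assoc[symmetric])
  then show ?thesis using inverse_mult_eq_1'[of ?B] by simp
qed

lemma theta_ii_g: "theta_ii l = q * g l - g (l - 1) / q"
proof (cases "l < 0")
  case True
  then show ?thesis by (simp add: theta_ii_def zcoeff_def g_def)
next
  case False
  then obtain n where n: "l = int n" by (metis not_less zero_le_imp_eq_int)
  have eq: "fps_const q * (ratio 1 q * ratio (inverse (q^2)) (inverse q)) =
      fps_const q * ((1 - fps_const (inverse (q^2)) * fps_X) * Abs_fps (\<lambda>n. g (int n)))"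
    unfolding g_fps ratio_def[of "inverse (q^2)"] by (simp only: mult_ac)
  have "theta_ii l = q * ((1 - fps_const (inverse (q^2)) * fps_X) * Abs_fps (\<lambda>n. g (int n))) $ n"
    unfolding theta_ii_def zcoeff_def n eq by simp
  also have "\<dots> = q * g l - g (l - 1) / q"
  proof (cases n)
    case 0
    then show ?thesis by (simp add: n) (simp add: g_def)
  next
    case (Suc m)
    then show ?thesis using q_nz
      by (simp add: n left_diff_distrib mult.assoc power2_eq_square right_diff_distrib divide_inverse)
  qed
  finally show ?thesis .
qed

lemma theta_ii_neg: "l < 0 \<Longrightarrow> theta_ii l = 0" by (simp add: theta_ii_def zcoeff_def)

lemma theta_ii_0: "theta_ii 0 = q" by (simp add: theta_ii_g g_0) (simp add: g_def)

lemma theta_ii_pos: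
  "l \<ge> 1 \<Longrightarrow> theta_ii l = (q / (q + 1)) * (q * q powi l + 1 / q powi l - q powi l / q^2 - 1 / (q * q powi l))"
proof -
  assume l: "l \<ge> 1"
  have gl: "g l = q / (q + 1) * (q powi l + 1 / (q * q powi l))" by (rule g_nonneg) (use l in simp)
  have gl': "g (l - 1) = q / (q + 1) * (q powi l / q + 1 / q powi l)"
  proof -
    have "l - 1 \<ge> 0" using l by simp
    moreover have "q * (q powi l / q) = q powi l"
      by (simp only: times_divide_eq_right nonzero_mult_div_cancel_left[OF q_nz])
    ultimately show ?thesis by (simp only: g_nonneg powi_pred)
  qed
  have *: "q * (k * (x + 1 / (q * x))) - k * (x / q + 1 / x) / q =
      k * (q * x + 1 / x - x / q^2 - 1 / (q * x))" if "x \<noteq> 0" for k x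
    using that q_nz by (simp add: divide_simps) (simp add: algebra_simps eval_nat_numeral)
  show ?thesis unfolding theta_ii_g gl gl' by (rule *) (rule powi_nz)
qed

text \<open>
  The exchange series satisfies \<open>(z - q\<^sup>2 w) \<theta>(w / z) = - (w - q\<^sup>2 z) \<theta>(z / w)\<close> as a rational function; the
  two expansions differ by delta functions at the poles \<open>w = q z\<close> and \<open>z = q w\<close>, with the residues on
  the right.
\<close>

lemma quadratic_delta:
  "theta_ii t - q^2 * theta_ii (t - 1) + theta_ii (1 - t) - q^2 * theta_ii (- t) =
    (q - 1) * (1 - q^3) / (q + 1) * (q powi (- t) + q powi (t - 1))" (is "?L t = ?R t")
proof -
  have refl: "?L (1 - t) = ?L t" "?R (1 - t) = ?R t" for t by (simp_all add: algebra_simps)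
  have pos: "?L t = ?R t" if "t \<ge> 1" for t
  proof (cases "t = 1")
    case True
    have "theta_ii 1 = (q / (q + 1)) * (q * q + 1 / q - q / q^2 - 1 / (q * q))" using theta_ii_pos[of 1] by simp
    then have "?L 1 = (q / (q + 1)) * (q * q + 1 / q - q / q^2 - 1 / (q * q)) - q^2 * q + q"
      using theta_ii_0 theta_ii_neg[of "- 1"] by simp
    also have "\<dots> = (q - 1) * (1 - q^3) / (q + 1) * (1 / q + 1)"
      using q_nz q1_nz by (simp add: divide_simps) (simp add: algebra_simps eval_nat_numeral)
    also have "\<dots> = ?R 1" using powi_minus[of 1] by simp
    finally show ?thesis unfolding True .
  next
    case False
    then have t: "t - 1 \<ge> 1" "1 - t < 0" "- t < 0" using that by auto
    have *: "k * (q * (q * x) + 1 / (q * x) - (q * x) / q^2 - 1 / (q * (q * x))) -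
        q^2 * (k * (q * x + 1 / x - x / q^2 - 1 / (q * x))) =
        k * ((q - 1) * (1 - q^3) / q * (1 / (q * x) + x))" if "x \<noteq> 0" for k x
      using that q_nz by (simp add: divide_simps) (simp add: algebra_simps eval_nat_numeral)
    have qt: "q powi t = q * q powi (t - 1)" using powi_Suc[of "t - 1"] by simp
    show ?thesis
      unfolding theta_ii_pos[OF \<open>t \<ge> 1\<close>] theta_ii_pos[OF t(1)] theta_ii_neg[OF t(2)] theta_ii_neg[OF t(3)]
        powi_minus[of t] qt
      using *[of "q powi (t - 1)" "q / (q + 1)"] q_nz by simp
  qed
  show ?thesis
  proof (cases "t \<ge> 1")
    case False
    then show ?thesis using pos[of "1 - t"] unfolding refl by simp
  qed (rule pos)
qed

lemma f_fps: "f n = zcoeff (ratio 1 (inverse q)) n"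
proof (cases "n < 0 \<or> n = 0")
  case False
  then obtain m where m: "n = int (Suc m)" by (metis not_less not0_implies_Suc of_nat_0 zero_le_imp_eq_int)
  have "q powi (- n) = inverse q ^ Suc m" unfolding m by (simp only: power_int_minus power_int_of_nat power_inverse)
  then have "f n = (1 - q) * (inverse q * inverse q ^ m)" using False by (simp add: f_def)
  also have "\<dots> = inverse q ^ Suc m - inverse q ^ m" using q_nz by (simp add: left_diff_distrib)
  also have "\<dots> = zcoeff (ratio 1 (inverse q)) n" by (simp add: zcoeff_def ratio_nth m nat_add_distrib)
  finally show ?thesis .
qed (auto simp: f_def zcoeff_def ratio_nth)

text \<open>
  The diagonal sum of a product of two series is a coefficient of the product of the series, one of
  them dilated.
\<close>

lemma f_convolution:
  assumes A: "finite A" "{0..s} \<subseteq> A" and t: "t \<noteq> 0"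
  shows "(\<Sum>k\<in>A. t powi k * (f (s - k) * f k)) = zcoeff (fps_dilate t (ratio 1 (inverse q)) * ratio 1 (inverse q)) s"
proof -
  let ?F = "ratio 1 (inverse q)"
  have "(\<Sum>k\<in>A. t powi k * (f (s - k) * f k)) = (\<Sum>k\<in>{0..s}. t powi k * (f (s - k) * f k))"
    by (rule sum.mono_neutral_right) (use A in \<open>auto simp: f_neg not_le\<close>)
  also have "\<dots> = zcoeff (fps_dilate t ?F * ?F) s"
  proof (cases "s < 0")
    case False
    then obtain n where n: "s = int n" by (metis not_less zero_le_imp_eq_int)
    have "(\<Sum>k\<in>{0..s}. t powi k * (f (s - k) * f k)) = (\<Sum>k\<in>int ` {0..n}. t powi k * (f (s - k) * f k))"
      by (simp add: n image_int_atLeastAtMost)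
    also have "\<dots> = (\<Sum>k=0..n. t ^ k * ?F $ k * ?F $ (n - k))"
      by (subst sum.reindex) (auto simp: n f_fps zcoeff_def nat_diff_distrib intro!: sum.cong)
    finally show ?thesis by (simp add: n zcoeff_def fps_mult_nth fps_dilate_def)
  qed (simp add: zcoeff_def)
  finally show ?thesis .
qed

text \<open>
  The coefficients, up to powers of \<open>d\<close>, of the sum of the two geometric series on the right hand side
  of the Serre relation, when the second argument of \<open>E\<^sub>i\<close> is \<open>q\<close> times the first.
\<close>

definition rho :: "int \<Rightarrow> complex" where
  "rho s = (if s \<ge> 0 then q powi (- s) else q powi (2 * s))"

lemma zcoeff_ratio: "s > 0 \<Longrightarrow> zcoeff (ratio a b) s = b ^ nat s - a * b ^ nat (s - 1)" "zcoeff (ratio a b) 0 = 1"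
  by (auto simp: zcoeff_def ratio_nth nat_diff_distrib)

text \<open>
  Each of the three terms of \<open>R\<close> is summed along the line by \<open>f_convolution\<close>.  The products
  \<open>(1 - x) (1 - q x) / ((1 - x / q) (1 - x))\<close> and \<open>(1 - x) (1 - x / q) / ((1 - x / q) (1 - x / q\<^sup>2))\<close> that arise collapse to a
  single pole, and the mixed term telescopes.
\<close>

lemma R_line_sum:
  assumes N: "N \<ge> \<bar>s\<bar>" and lo: "lo \<le> - N" and hi: "hi \<ge> N + 1"
  shows "(\<Sum>k\<in>{lo..hi}. q powi (k - 1) * R (s + 1 - k) k) = - ((q - 1)^2 * (q + 1) / q^3) * rho s"
proof -
  let ?A = "{lo..hi}"
  define Zp where "Zp = zcoeff (ratio q (inverse q)) s"
  define Zm where "Zm = zcoeff (ratio 1 (inverse q * inverse q)) (- s)"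
  define z :: complex where "z = (if s = 0 then 1 else 0)"
  have zp: "fps_dilate q (ratio 1 (inverse q)) * ratio 1 (inverse q) = ratio q (inverse q)"
    unfolding fps_dilate_ratio using q_nz by (simp add: ratio_mult_ratio)
  have zm: "fps_dilate (inverse q) (ratio 1 (inverse q)) * ratio 1 (inverse q) = ratio 1 (inverse q * inverse q)"
    unfolding fps_dilate_ratio using ratio_mult_ratio[of 1 "inverse q" "inverse q * inverse q"] by (simp add: mult.commute)
  have p1: "(\<Sum>k\<in>?A. q powi k * (f (s - k) * f k)) = Zp"
    unfolding Zp_def zp[symmetric] by (rule f_convolution) (use N lo hi q_nz in auto)
  have p2: "(\<Sum>k\<in>?A. q powi (k - 1) * (f (s - (k - 1)) * f (k - 1))) = Zp"
  proof -
    have "(\<Sum>k\<in>?A. q powi (k - 1) * (f (s - (k - 1)) * f (k - 1))) =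
        (\<Sum>k\<in>{lo - 1..hi - 1}. q powi k * (f (s - k) * f k))"
      by (rule sum.reindex_bij_witness[of _ "\<lambda>k. k + 1" "\<lambda>k. k - 1"]) auto
    also have "\<dots> = Zp" unfolding Zp_def zp[symmetric] by (rule f_convolution) (use N lo hi q_nz in auto)
    finally show ?thesis .
  qed
  have ipow: "inverse q powi (- k) = q powi k" for k by (simp add: power_int_inverse power_int_minus)
  have m: "(\<Sum>k\<in>{- b..- a}. q powi k * (f (k - s) * f (- k))) = Zm" if "a \<le> - N" "b \<ge> N" for a b
  proof -
    have "(\<Sum>k\<in>{- b..- a}. q powi k * (f (k - s) * f (- k))) =
        (\<Sum>k\<in>{a..b}. inverse q powi k * (f (- s - k) * f k))"
      by (rule sum.reindex_bij_witness[of _ uminus uminus]) (auto simp: ipow[symmetric] simp del: power_int_minus)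
    also have "\<dots> = Zm" unfolding Zm_def zm[symmetric] by (rule f_convolution) (use N that q_nz in auto)
    finally show ?thesis .
  qed
  have m1: "(\<Sum>k\<in>?A. q powi k * (f (k - s) * f (- k))) = Zm"
    using m[of "- hi" "- lo"] lo hi by simp
  have m2: "(\<Sum>k\<in>?A. q powi (k - 1) * (f (k - 1 - s) * f (1 - k))) = Zm"
  proof -
    have "(\<Sum>k\<in>?A. q powi (k - 1) * (f (k - 1 - s) * f (1 - k))) =
        (\<Sum>k\<in>{lo - 1..hi - 1}. q powi k * (f (k - s) * f (- k)))"
      by (rule sum.reindex_bij_witness[of _ "\<lambda>k. k + 1" "\<lambda>k. k - 1"]) auto
    then show ?thesis using m[of "1 - hi" "1 - lo"] lo hi by simp
  qed
  have x: "(\<Sum>k\<in>?A. q powi (k - 1) * (f (k - s) * f k - f (k - s - 1) * f (k - 1) / q^2)) = (1 - 1/q) * z"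
  proof -
    have trm: "f (k - s) * f k - f (k - s - 1) * f (k - 1) / q^2 = e (k - s) * f k + f (k - s - 1) / q * e k" for k
    proof -
      have "(u + a) * (w + b) - u * w = a * (w + b) + u * b" for u a w b :: complex by (simp add: algebra_simps)
      from this[of "f (k - s - 1) / q" "e (k - s)" "f (k - 1) / q" "e k"]
      show ?thesis unfolding f_rec[of k] f_rec[of "k - s"] by (simp add: power2_eq_square)
    qed
    have E: "(\<Sum>k\<in>?A. e (k - r) * h k) = h r - h (r + 1)" if "lo \<le> r" "r + 1 \<le> hi" for r and h :: "int \<Rightarrow> complex"
    proof -
      have "(\<Sum>k\<in>?A. e (k - r) * h k) = (\<Sum>k\<in>{r, r + 1}. e (k - r) * h k)"
        by (rule sum.mono_neutral_right) (use that in \<open>auto simp: e_def\<close>)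
      then show ?thesis by (simp add: e_def)
    qed
    have "(\<Sum>k\<in>?A. q powi (k - 1) * (f (k - s) * f k - f (k - s - 1) * f (k - 1) / q^2)) =
        (\<Sum>k\<in>?A. e (k - s) * (q powi (k - 1) * f k)) + (\<Sum>k\<in>?A. e (k - 0) * (q powi (k - 1) * (f (k - s - 1) / q)))"
      unfolding trm sum.distrib[symmetric] by (rule sum.cong) (simp_all add: algebra_simps)
    also have "\<dots> = (q powi (s - 1) * f s - q powi s * f (s + 1)) + (q powi (- 1) * (f (- s - 1) / q) - f (- s) / q)"
    proof -
      have s: "lo \<le> s" "s + 1 \<le> hi" "lo \<le> 0" "0 + 1 \<le> hi" using N lo hi by auto
      show ?thesis unfolding E[OF s(1,2)] E[OF s(3,4)] by simp
    qed
    also have "\<dots> = (1 - 1/q) * z"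
    proof -
      have 1: "f (s + 1) = f s / q + e (s + 1)" "f (- s) = f (- s - 1) / q + e (- s)"
        using f_rec[of "s + 1"] f_rec[of "- s"] by simp_all
      have "q powi (s - 1) * f s - q powi s * f (s + 1) = - (q powi s * e (s + 1))"
        unfolding 1 powi_pred by (simp add: algebra_simps)
      moreover have "q powi (- 1) * (f (- s - 1) / q) - f (- s) / q = - e (- s) / q"
        unfolding 1 by (simp add: power_int_minus divide_inverse algebra_simps)
      moreover have "- (q powi s * e (s + 1)) - e (- s) / q = (1 - 1/q) * z"
        using q_nz by (auto simp: e_def z_def power_int_minus divide_simps)
      ultimately show ?thesis by (simp only: minus_divide_left[symmetric] diff_conv_add_uminus)
    qed
    finally show ?thesis .
  qed
  have "(\<Sum>k\<in>?A. q powi (k - 1) * R (s + 1 - k) k) =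
    (\<Sum>k\<in>?A. (q powi k * (f (k - s) * f (- k)) / q - q powi (k - 1) * (f (k - 1 - s) * f (1 - k)) / q^2
      + q powi k * (f (s - k) * f k) / q - q powi (k - 1) * (f (s - (k - 1)) * f (k - 1)) / q^2
      - (q + 1/q) * (q powi (k - 1) * (f (k - s) * f k - f (k - s - 1) * f (k - 1) / q^2))) / q)"
  proof (rule sum.cong, rule refl)
    fix k
    have *: "p * ((A - c * B + D) / q - (A' - c * B' + D') / q / q^2) =
       (q * p * A / q - p * A' / q^2 + q * p * D / q - p * D' / q^2 - c * (p * (B - B' / q^2))) / q"
      for A B D A' B' D' c p
      using q_nz by (simp add: divide_simps) (simp add: algebra_simps eval_nat_numeral)
    have qk: "q powi k = q * q powi (k - 1)" using powi_Suc[of "k - 1"] by simp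
    have a: "- (s + 1 - k - 1) = k - s" "s + 1 - k - 1 = s - k" by simp_all
    have QA: "Q (s + 1 - k - 1) k = (f (k - s) * f (- k) - (q + 1/q) * (f (k - s) * f k) + f (s - k) * f k) / q"
      unfolding Q_def a(1) unfolding a(2) ..
    have b: "- (s + 1 - k) = k - s - 1" "- (k - 1) = 1 - k" and c: "s + 1 - k = s - (k - 1)" by simp_all
    have QB: "Q (s + 1 - k) (k - 1) = (f (k - s - 1) * f (1 - k) - (q + 1/q) * (f (k - s - 1) * f (k - 1)) + f (s - (k - 1)) * f (k - 1)) / q"
      unfolding Q_def b unfolding c ..
    have d: "k - 1 - s = k - s - 1" by simp
    show "q powi (k - 1) * R (s + 1 - k) k =
      (q powi k * (f (k - s) * f (- k)) / q - q powi (k - 1) * (f (k - 1 - s) * f (1 - k)) / q^2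
      + q powi k * (f (s - k) * f k) / q - q powi (k - 1) * (f (s - (k - 1)) * f (k - 1)) / q^2
      - (q + 1/q) * (q powi (k - 1) * (f (k - s) * f k - f (k - s - 1) * f (k - 1) / q^2))) / q"
      unfolding R_def QA QB qk d by (rule *)
  qed
  also have "\<dots> = (Zm / q - Zm / q^2 + Zp / q - Zp / q^2 - (q + 1/q) * ((1 - 1/q) * z)) / q"
    unfolding sum_divide_distrib[symmetric] sum_subtractf sum.distrib sum_distrib_left[symmetric] p1 p2 m1 m2 x ..
  also have "\<dots> = - ((q - 1)^2 * (q + 1) / q^3) * rho s"
  proof -
    consider "s > 0" | "s = 0" | "s < 0" by linarith
    then show ?thesis
    proof cases
      case 1
      have "inverse q ^ nat s = q powi (- s)" "inverse q ^ nat (s - 1) = q * q powi (- s)"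
      proof -
        obtain m where m: "s = int (Suc m)" using 1 by (metis gr0_implies_Suc zero_less_imp_eq_int)
        have "q powi (- s) = inverse q ^ Suc m"
          unfolding m by (simp only: power_int_minus power_int_of_nat power_inverse)
        moreover have "nat s = Suc m" "nat (s - 1) = m" by (simp_all add: m)
        ultimately show "inverse q ^ nat s = q powi (- s)" "inverse q ^ nat (s - 1) = q * q powi (- s)"
          using q_nz by simp_all
      qed
      then have "Zp = q powi (- s) * (1 - q^2)" "Zm = 0" "z = 0" "rho s = q powi (- s)"
        using 1 by (simp_all add: Zp_def Zm_def z_def rho_def zcoeff_ratio zcoeff_neg algebra_simps power2_eq_square)
      then show ?thesis using q_nz by (simp add: divide_simps) (simp add: algebra_simps eval_nat_numeral)
    next
      case 2
      then have "Zp = 1" "Zm = 1" "z = 1" "rho s = 1" by (simp_all add: Zp_def Zm_def z_def rho_def zcoeff_ratio)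
      then show ?thesis using q_nz by (simp add: divide_simps) (simp add: algebra_simps eval_nat_numeral)
    next
      case 3
      have sq: "(inverse q * inverse q) ^ n = q powi (- 2 * int n)" for n
      proof -
        have "q powi (- 2 * int n) = inverse (q ^ (2 * n))"
          using power_int_minus[of q "int (2 * n)"] power_int_of_nat[of q "2 * n"] by simp
        also have "\<dots> = (inverse q * inverse q) ^ n"
          by (simp only: power_mult power2_eq_square power_inverse inverse_mult_distrib[symmetric])
        finally show ?thesis ..
      qed
      have "(inverse q * inverse q) ^ nat (- s) = q powi (2 * s)" "(inverse q * inverse q) ^ nat (- s - 1) = q powi (2 * s + 2)"
        unfolding sq using 3 by (simp_all add: algebra_simps)
      moreover have "q powi (2 * s + 2) = q^2 * q powi (2 * s)"
        using q_nz by (simp add: power_int_add)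
      ultimately have "Zm = q powi (2 * s) * (1 - q^2)" "Zp = 0" "z = 0" "rho s = q powi (2 * s)"
        using 3 by (simp_all add: Zp_def Zm_def z_def rho_def zcoeff_ratio zcoeff_neg algebra_simps)
      then show ?thesis using q_nz by (simp add: divide_simps) (simp add: algebra_simps eval_nat_numeral)
    qed
  qed
  finally show ?thesis .
qed

text \<open>
  The weight of the normally ordered product of \<open>E\<^sub>i\<close>, \<open>E\<^sub>i\<close>, \<open>E\<^sub>j\<close> in one half of the Serre relation.  The
  cutoff is immaterial once it is large enough, since \<open>Q\<close> vanishes on one side of the line.
\<close>

definition cubic :: "nat \<Rightarrow> int \<Rightarrow> int \<Rightarrow> complex" where
  "cubic K a b = (\<Sum>l\<in>{0..int K}. theta_ii l * Q (a + l) (b - l))"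

text \<open>
  The factor \<open>1 - x / q\<^sup>2\<close> of the exchange series is moved to \<open>Q\<close> by summation by parts.
\<close>

lemma cubic_R:
  assumes K: "int K \<ge> \<bar>a\<bar> + \<bar>b\<bar>"
  shows "cubic K a b = q * (\<Sum>l\<in>{0..int K}. g l * R (a + l + 1) (b - l))"
proof -
  have "cubic K a b = q * (\<Sum>l\<in>{0..int K}. g l * Q (a + l) (b - l)) - (\<Sum>l\<in>{0..int K}. g (l - 1) * Q (a + l) (b - l)) / q"
    unfolding cubic_def theta_ii_g sum_distrib_left sum_divide_distrib sum_subtractf[symmetric]
    by (rule sum.cong) (simp_all add: algebra_simps)
  also have "(\<Sum>l\<in>{0..int K}. g (l - 1) * Q (a + l) (b - l)) = (\<Sum>l\<in>{0..int K}. g l * Q (a + l + 1) (b - l - 1))"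
  proof (rule sum_reindex_support[where j = "\<lambda>l. l - 1" and i = "\<lambda>l. l + 1"])
    fix l assume "l \<in> {0..int K}" "g (l - 1) * Q (a + l) (b - l) \<noteq> 0"
    then show "l - 1 \<in> {0..int K}" by (auto simp: g_def split: if_splits)
  next
    fix l assume l: "l \<in> {0..int K}" "g l * Q (a + l + 1) (b - l - 1) \<noteq> 0"
    then have "\<not> (a + l + 1 > 0 \<and> b - l - 1 < 0)" using Q_vanishes[of "a + l + 1" "b - l - 1"] by auto
    then show "l + 1 \<in> {0..int K}" using l K by auto
  qed (auto simp: algebra_simps)
  also have "q * (\<Sum>l\<in>{0..int K}. g l * Q (a + l) (b - l)) - (\<Sum>l\<in>{0..int K}. g l * Q (a + l + 1) (b - l - 1)) / q =
      q * (\<Sum>l\<in>{0..int K}. g l * R (a + l + 1) (b - l))"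
  proof -
    have "q * (g l * R (a + l + 1) (b - l)) = q * (g l * Q (a + l) (b - l)) - g l * Q (a + l + 1) (b - l - 1) / q" for l
      using q_nz by (simp add: R_def right_diff_distrib power2_eq_square)
    then show ?thesis by (simp add: sum_distrib_left sum_divide_distrib sum_subtractf)
  qed
  finally show ?thesis .
qed

text \<open>
  For the symmetric weight \<open>R\<close>, the two halves of the Serre relation involve the two expansions of the
  same rational function with coefficients \<open>g\<close>.  Their sum is a sum over a full line against the exponentials
  \<open>q\<^sup>l\<close> and \<open>q\<^sup>-\<^sup>l\<^sup>-\<^sup>1\<close>, which are the two delta functions.
\<close>

lemma cubic_delta:
  assumes K: "int K \<ge> 2 * (\<bar>a\<bar> + \<bar>b\<bar>)"
  shows "cubic K a b + cubic K b a = - ((q - 1)^2 / q) * (q powi (- a) + q powi (- b)) * rho (a + b)"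
proof -
  \<comment> \<open>\<open>G\<close> continues \<open>g\<close> from the nonnegative to all integers, and the reflection \<open>l \<mapsto> -1 - l\<close> exchanges the two halves\<close>
  define k where "k = q / (q + 1)"
  define G where "G l = k * (q powi l + q powi (- l - 1))" for l
  have gG: "l \<ge> 0 \<Longrightarrow> g l = G l" for l by (simp add: g_def G_def k_def)
  have Gr: "G (- 1 - l) = G l" for l
  proof -
    have eq: "- 1 - l = - l - 1" "- (- l - 1) - 1 = l" by simp_all
    show ?thesis by (simp only: G_def eq add.commute)
  qed
  have "cubic K b a = q * (\<Sum>l\<in>{- 1 - int K..- 1}. G l * R (a + l + 1) (b - l))"
  proof -
    have "(\<Sum>l\<in>{0..int K}. g l * R (b + l + 1) (a - l)) = (\<Sum>l\<in>{- 1 - int K..- 1}. G l * R (a + l + 1) (b - l))"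
    proof (rule sum.reindex_bij_witness[of _ "\<lambda>l. - 1 - l" "\<lambda>l. - 1 - l"])
      fix l assume l: "l \<in> {0..int K}"
      have "a + (- 1 - l) + 1 = a - l" "b - (- 1 - l) = b + l + 1" by simp_all
      then have "R (a + (- 1 - l) + 1) (b - (- 1 - l)) = R (b + l + 1) (a - l)"
        using R_symmetric[of "a - l" "b + l + 1"] by (simp only:)
      then show "G (- 1 - l) * R (a + (- 1 - l) + 1) (b - (- 1 - l)) = g l * R (b + l + 1) (a - l)"
        using l by (simp only: Gr gG atLeastAtMost_iff)
    qed auto
    then show ?thesis using cubic_R[of b a K] K by simp
  qed
  moreover have "cubic K a b = q * (\<Sum>l\<in>{0..int K}. G l * R (a + l + 1) (b - l))"
  proof -
    have "(\<Sum>l\<in>{0..int K}. g l * R (a + l + 1) (b - l)) = (\<Sum>l\<in>{0..int K}. G l * R (a + l + 1) (b - l))"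
      by (rule sum.cong) (simp_all add: gG)
    then show ?thesis using cubic_R[of a b K] K by simp
  qed
  moreover have "(\<Sum>l\<in>{- 1 - int K..- 1}. G l * R (a + l + 1) (b - l)) + (\<Sum>l\<in>{0..int K}. G l * R (a + l + 1) (b - l)) =
      (\<Sum>l\<in>{- 1 - int K..int K}. G l * R (a + l + 1) (b - l))"
  proof -
    have "{- 1 - int K..int K} = {- 1 - int K..- 1} \<union> {0..int K}" by auto
    then show ?thesis by (subst sum.union_disjoint[symmetric]) auto
  qed
  ultimately have "cubic K a b + cubic K b a = q * (\<Sum>l\<in>{- 1 - int K..int K}. G l * R (a + l + 1) (b - l))"
    by (simp only: distrib_left[symmetric] add.commute)
  also have "(\<Sum>l\<in>{- 1 - int K..int K}. G l * R (a + l + 1) (b - l)) =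
     k * ((\<Sum>l\<in>{- 1 - int K..int K}. q powi l * R (a + l + 1) (b - l)) +
          (\<Sum>l\<in>{- 1 - int K..int K}. q powi (- l - 1) * R (a + l + 1) (b - l)))"
    unfolding G_def sum.distrib[symmetric] sum_distrib_left by (rule sum.cong) (simp_all only: mult.assoc distrib_right)
  also have "(\<Sum>l\<in>{- 1 - int K..int K}. q powi l * R (a + l + 1) (b - l)) =
      q powi (- a) * (\<Sum>l\<in>{a - int K..a + int K + 1}. q powi (l - 1) * R (a + b + 1 - l) l)"
    unfolding sum_distrib_left
  proof (rule sum.reindex_bij_witness[of _ "\<lambda>l. l - a - 1" "\<lambda>l. l + a + 1"])
    fix l
    have "q powi l = q powi (- a) * q powi (l + a)" using power_int_add[of q "- a" "l + a"] q_nz by simp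
    moreover have "l + a + 1 - 1 = l + a" "a + b + 1 - (l + a + 1) = b - l" "l + a + 1 = a + l + 1" by simp_all
    ultimately show "q powi (- a) * (q powi (l + a + 1 - 1) * R (a + b + 1 - (l + a + 1)) (l + a + 1)) = q powi l * R (a + l + 1) (b - l)"
      using R_symmetric[of "b - l" "a + l + 1"] by (simp only: mult.assoc)
  qed auto
  also have "(\<Sum>l\<in>{- 1 - int K..int K}. q powi (- l - 1) * R (a + l + 1) (b - l)) =
      q powi (- b) * (\<Sum>l\<in>{b - int K..b + int K + 1}. q powi (l - 1) * R (a + b + 1 - l) l)"
    unfolding sum_distrib_left
  proof (rule sum.reindex_bij_witness[of _ "\<lambda>l. b - l" "\<lambda>l. b - l"])
    fix l
    have "q powi (- l - 1) = q powi (- b) * q powi (b - l - 1)" using power_int_add[of q "- b" "b - l - 1"] q_nz by simp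
    moreover have "a + b + 1 - (b - l) = a + l + 1" by simp
    ultimately show "q powi (- b) * (q powi (b - l - 1) * R (a + b + 1 - (b - l)) (b - l)) = q powi (- l - 1) * R (a + l + 1) (b - l)"
      by (simp only: mult.assoc)
  qed auto
  also have "(\<Sum>l\<in>{a - int K..a + int K + 1}. q powi (l - 1) * R (a + b + 1 - l) l) = - ((q - 1)^2 * (q + 1) / q^3) * rho (a + b)"
    by (rule R_line_sum[of "a + b" "\<bar>a + b\<bar>"]) (use K in auto)
  also have "(\<Sum>l\<in>{b - int K..b + int K + 1}. q powi (l - 1) * R (a + b + 1 - l) l) = - ((q - 1)^2 * (q + 1) / q^3) * rho (a + b)"
    by (rule R_line_sum[of "a + b" "\<bar>a + b\<bar>"]) (use K in auto)
  also have "q * (k * (q powi (- a) * (- ((q - 1)^2 * (q + 1) / q^3) * rho (a + b)) +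
      q powi (- b) * (- ((q - 1)^2 * (q + 1) / q^3) * rho (a + b)))) =
      - ((q - 1)^2 / q) * (q powi (- a) + q powi (- b)) * rho (a + b)"
  proof -
    have "q * (q / (q + 1) * (x * (- ((q - 1)^2 * (q + 1) / q^3) * r) + y * (- ((q - 1)^2 * (q + 1) / q^3) * r))) =
        - ((q - 1)^2 / q) * (x + y) * r" for x y r
      using q_nz q1_nz by (simp add: divide_simps) (simp add: algebra_simps eval_nat_numeral)
    then show ?thesis unfolding k_def .
  qed
  finally show ?thesis .
qed

end

context boundary_module
begin

sublocale Qp: quantum_parameter q
proof
  show "q \<noteq> 0" by simp
  show "q \<noteq> 1" using q_power_neq(1)[of 1] by simp
  show "q \<noteq> - 1" using q_power_neq(2)[of 1] by (metis add.right_inverse power_one_right zero_less_one)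
qed

section \<open>The quadratic relations\<close>

lemma zcoeff_const: "zcoeff (fps_const c * g) l = c * zcoeff g l"
  by (simp add: zcoeff_def)

lemma zcoeff_dilate: "t \<noteq> 0 \<Longrightarrow> zcoeff (fps_dilate t g) l = t powi l * zcoeff g l"
  by (simp add: zcoeff_def fps_dilate_def power_int_def)

lemma th_diag: "th i i l = Qp.theta_ii l"
  unfolding theta_def theta_normalized_def root_factor_def Qp.theta_ii_def by simp

text \<open>
  The two signs in the relations are treated uniformly by the parameter \<open>\<epsilon> = d\<^sup>\<plusminus>\<^sup>1\<close>.
\<close>

definition neighbour :: "complex \<Rightarrow> 'n mod_ring \<Rightarrow> 'n mod_ring \<Rightarrow> bool" where
  "neighbour \<epsilon> i j \<longleftrightarrow> (j = i + 1 \<and> \<epsilon> = d) \<or> (j = i - 1 \<and> \<epsilon> = inverse d)"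

lemma neighbour_sym: "neighbour \<epsilon> i j \<Longrightarrow> neighbour (inverse \<epsilon>) j i"
  by (auto simp: neighbour_def)

lemma neighbour_nz: "neighbour \<epsilon> i j \<Longrightarrow> \<epsilon> \<noteq> 0" by (auto simp: neighbour_def)

lemma th_neighbour:
  assumes "neighbour \<epsilon> i j" shows "th i j l = inverse qh * \<epsilon> powi l * Qp.f l"
proof -
  have nz: "\<epsilon> \<noteq> 0" by (rule neighbour_nz[OF assms])
  have "theta i j = fps_const (inverse qh) * ratio \<epsilon> (inverse q * \<epsilon>)"
    using assms unfolding neighbour_def theta_def theta_normalized_def root_factor_def
    by (elim disjE conjE) (simp_all only: index_neq if_True if_False simp_thms)
  also have "ratio \<epsilon> (inverse q * \<epsilon>) = fps_dilate \<epsilon> (ratio 1 (inverse q))"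
    unfolding fps_dilate_ratio by (simp add: mult.commute)
  finally show ?thesis
    by (simp add: zcoeff_const zcoeff_dilate[OF nz] Qp.f_fps mult.assoc)
qed

lemma th_distant: "j \<noteq> i \<Longrightarrow> j \<noteq> i + 1 \<Longrightarrow> j \<noteq> i - 1 \<Longrightarrow> th i j l = (if l = 0 then 1 else 0)"
  by (auto simp: theta_def theta_normalized_def root_factor_def zcoeff_def)

text \<open>
  The constant factor \<open>k\<close> of the boundary current.
\<close>

definition kap :: complex where "kap = 1 / (qh - inverse qh)"

lemma kap_square: "kap^2 = q / (q - 1)^2"
proof -
  have "kap = qh / (q - 1)" using Qp.q_neq_1 unfolding kap_def by (simp add: field_simps power2_eq_square)
  then show ?thesis by (simp add: power_divide)
qed

abbreviation EB :: "'n mod_ring \<Rightarrow> int \<Rightarrow> 'v \<Rightarrow> 'v" where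
  "EB \<equiv> boundary_E scale qh Ktp Ktm"

lemma EB_eq: "EB i m v = kap *s EE i m v"
proof -
  obtain L where L: "bnd L v" using bnd_exists by blast
  let ?g = "\<lambda>(a::nat, b::nat). if int a - int b = m then inverse q ^ a *s Ktm i b (Ktp i a v) else 0"
  have g: "?g (a, b) = (if int a - int b = m then M i b \<star> P i a \<star> v else 0)" for a b
    using Ktp_eq[of a i v] Ktm_eq by (simp add: endo_apply_lin(2)[OF linear_PM(2), symmetric] del: power_inverse)
  let ?C = "{c \<in> {0..L}. c \<ge> m}" and ?j = "\<lambda>c. (nat c, nat (c - m))"
  have inj: "inj_on ?j ?C" by (auto simp: inj_on_def)
  have "Sum_any ?g = sum ?g (?j ` ?C)"
  proof (rule Sum_any.expand_superset)
    show "finite (?j ` ?C)" by (intro finite_imageI finite_subset[of ?C "{0..L}"]) auto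
    show "{x. ?g x \<noteq> 0} \<subseteq> ?j ` ?C"
    proof
      fix x assume x: "x \<in> {x. ?g x \<noteq> 0}"
      obtain a b where ab: "x = (a, b)" by (cases x)
      have 1: "int a - int b = m" "M i b \<star> P i a \<star> v \<noteq> 0"
        using x g[of a b] unfolding ab by (auto split: if_splits)
      then have "P i a \<star> v \<noteq> 0" using endo_apply_lin(3)[OF linear_PM(2)] by auto
      then have "int a \<le> L" using Pz_vanishes[OF L, of "int a" i] by (metis zext_of_nat not_le)
      then show "x \<in> ?j ` ?C" unfolding ab using 1(1) by (intro image_eqI[of _ _ "int a"]) auto
    qed
  qed
  also have "sum ?g (?j ` ?C) = (\<Sum>c\<in>?C. Mz i (c - m) \<star> Pz i c \<star> v)"
    unfolding sum.reindex[OF inj] o_def g by (rule sum.cong) (auto simp: zext_def)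
  also have "\<dots> = (\<Sum>c\<in>{0..L}. Mz i (c - m) \<star> Pz i c \<star> v)"
    by (rule sum.mono_neutral_left) (auto simp: zext_def)
  also have "\<dots> = EE i m v" by (rule ins_eq[OF L lin_id order.refl, symmetric])
  finally show ?thesis unfolding boundary_E_def kap_def by simp
qed

lemma lin_EB: "lin (EB i m)"
  by (rule linI) (simp_all add: EB_eq lin_simps[OF lin_EE] scale_right_distrib mult.commute)

text \<open>
  The weight of the normally ordered product in the left hand side of the quadratic relation.
\<close>

definition phi :: "'n mod_ring \<Rightarrow> 'n mod_ring \<Rightarrow> int \<Rightarrow> complex" where
  "phi i j t = d_coeff d i j * (th i j t - g_root q d i j * th i j (t - 1)) + (th j i (1 - t) - g_root q d j i * th j i (- t))"

lemma phi_diag: "phi i i t = (q - 1) * (1 - q^3) / (q + 1) * (q powi (- t) + q powi (t - 1))"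
proof -
  have "d_coeff d i i = 1" "g_root q d i i = q^2"
    by (simp_all only: d_coeff_def g_root_def index_neq if_True if_False simp_thms)
  then show ?thesis unfolding phi_def th_diag using Qp.quadratic_delta[of t] by (simp add: algebra_simps)
qed

text \<open>
  The polynomials \<open>g\<close> cancel the pole of the exchange series and leave \<open>1 - x\<close> for one
  order of the factors and \<open>x - 1\<close> for the other.
\<close>

lemma phi_neighbour: assumes "neighbour \<epsilon> i j" shows "phi i j t = 0"
proof -
  have nz: "\<epsilon> \<noteq> 0" by (rule neighbour_nz[OF assms])
  have dg: "d_coeff d i j = inverse \<epsilon>" "g_root q d i j = inverse q * \<epsilon>" "g_root q d j i = inverse q * inverse \<epsilon>"
  proof -
    consider "j = i + 1" "\<epsilon> = d" | "j = i - 1" "\<epsilon> = inverse d" using assms by (auto simp: neighbour_def)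
    then have "d_coeff d i j = inverse \<epsilon> \<and> g_root q d i j = inverse q * \<epsilon> \<and> g_root q d j i = inverse q * inverse \<epsilon>"
    proof cases
      case 1
      show ?thesis unfolding d_coeff_def g_root_def 1 using index_neq(5)[of "i + 1"] by (simp add: add.assoc)
    next
      case 2
      show ?thesis unfolding d_coeff_def g_root_def 2 by (simp add: diff_diff_eq)
    qed
    then show "d_coeff d i j = inverse \<epsilon>" "g_root q d i j = inverse q * \<epsilon>" "g_root q d j i = inverse q * inverse \<epsilon>" by auto
  qed
  have f: "Qp.f t - Qp.f (t - 1) / q = Qp.e t" "Qp.f (1 - t) - Qp.f (- t) / q = - Qp.e t"
  proof -
    show "Qp.f t - Qp.f (t - 1) / q = Qp.e t" unfolding Qp.f_rec[of t] by (rule add_diff_cancel_left')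
    have "1 - t - 1 = - t" by simp
    then show "Qp.f (1 - t) - Qp.f (- t) / q = - Qp.e t"
      unfolding Qp.f_rec[of "1 - t"] Qp.e_reflect[of t, symmetric] by (simp only: add_diff_cancel_left')
  qed
  have e1: "\<epsilon> powi t = \<epsilon> * \<epsilon> powi (t - 1)" using nz power_int_add[of \<epsilon> 1 "t - 1"] by simp
  have ipow: "inverse \<epsilon> powi (- k) = \<epsilon> powi k" for k
    unfolding power_int_inverse power_int_minus by (rule inverse_inverse_eq)
  have e2: "inverse \<epsilon> powi (1 - t) = \<epsilon> powi (t - 1)" "inverse \<epsilon> powi (- t) = \<epsilon> * \<epsilon> powi (t - 1)"
    using ipow[of "t - 1"] ipow[of t] e1 by (simp_all only: minus_diff_eq)
  have "phi i j t = inverse qh * \<epsilon> powi (t - 1) *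
      ((Qp.f t - Qp.f (t - 1) / q) + (Qp.f (1 - t) - Qp.f (- t) / q))"
  proof -
    have *: "inverse \<epsilon> * (w * (\<epsilon> * X) * f1 - (inverse u * \<epsilon>) * (w * X * f2)) + (w * X * f3 - (inverse u * inverse \<epsilon>) * (w * (\<epsilon> * X) * f4)) =
        w * X * ((f1 - f2 / u) + (f3 - f4 / u))" for w X f1 f2 f3 f4 u
    proof -
      have "inverse \<epsilon> * (w * (\<epsilon> * X) * f1 - (inverse u * \<epsilon>) * (w * X * f2)) = (inverse \<epsilon> * \<epsilon>) * (w * X * (f1 - f2 / u))"
        "(inverse u * inverse \<epsilon>) * (w * (\<epsilon> * X) * f4) = (inverse \<epsilon> * \<epsilon>) * (w * X * (f4 / u))"
        unfolding divide_inverse by (simp_all only: right_diff_distrib mult_ac)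
      then show ?thesis using nz by (simp only: left_inverse mult_1_left ring_distribs) simp
    qed
    have th: "th i j t = inverse qh * (\<epsilon> * \<epsilon> powi (t - 1)) * Qp.f t" "th i j (t - 1) = inverse qh * \<epsilon> powi (t - 1) * Qp.f (t - 1)"
      unfolding th_neighbour[OF assms] e1[symmetric] by (rule refl)+
    have th': "th j i (1 - t) = inverse qh * \<epsilon> powi (t - 1) * Qp.f (1 - t)" "th j i (- t) = inverse qh * (\<epsilon> * \<epsilon> powi (t - 1)) * Qp.f (- t)"
      unfolding th_neighbour[OF neighbour_sym[OF assms]] e2 by (rule refl)+
    show ?thesis unfolding phi_def dg th th' by (rule *)
  qed
  then show ?thesis unfolding f by simp
qed

lemma phi_distant:
  assumes "j \<noteq> i" "j \<noteq> i + 1" "j \<noteq> i - 1" shows "phi i j t = 0"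
proof -
  have ji: "i \<noteq> j" "i \<noteq> j + 1" "i \<noteq> j - 1" using assms by auto
  have "d_coeff d i j = 1" "g_root q d i j = 1" "g_root q d j i = 1"
    using assms ji by (simp_all only: d_coeff_def g_root_def if_False simp_thms)
  then show ?thesis unfolding phi_def th_distant[OF assms] th_distant[OF ji] by simp
qed

lemma phi_off_diagonal: "i \<noteq> j \<Longrightarrow> phi i j t = 0"
  using phi_neighbour[of d i j] phi_neighbour[of "inverse d" i j] phi_distant[of j i t]
  by (auto simp: neighbour_def)

text \<open>
  After normal ordering, the four products are compared on the same operators, whose second index
  \<open>y\<close> runs through all values for which they do not vanish.
\<close>

lemma EE_quadratic:
  assumes v: "bnd L v" and lo: "lo \<le> a" "lo \<le> b" "lo \<le> a + b + 1 - L"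
  shows "d_coeff d i j *s (EE i (a + 1) (EE j b v) - g_root q d i j *s EE i a (EE j (b + 1) v)) +
      (EE j (b + 1) (EE i a v) - g_root q d j i *s EE j b (EE i (a + 1) v)) =
    (\<Sum>y\<in>{lo..L}. phi i j (y - b) *s ins j y (EE i (a + b + 1 - y)) v)"
proof -
  let ?N = "\<lambda>y. ins j y (EE i (a + b + 1 - y)) v"
  have lo': "lo - 1 \<le> b" "lo - 1 \<le> b + 1" "lo - 1 \<le> a" "lo - 1 \<le> a + 1" "lo \<le> b + 1" "lo \<le> a + 1" using lo by auto
  have 1: "EE i (a + 1) (EE j b v) = (\<Sum>y\<in>{lo..L}. th i j (y - b) *s ?N y)"
    unfolding EE_EE[OF v lo(2)] by (rule sum.cong) (simp_all add: algebra_simps)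
  have 2: "EE i a (EE j (b + 1) v) = (\<Sum>y\<in>{lo..L}. th i j (y - b - 1) *s ?N y)"
    unfolding EE_EE[OF v lo'(5)] by (rule sum.cong) (simp_all add: algebra_simps)
  have swap: "ins i x (EE j (a + b + 1 - x)) v = ?N (a + b + 1 - x)" for x
    using ins_commute[OF lin_id, of i x j "a + b + 1 - x" v] by simp
  have van: "?N y = 0" if "y > L \<or> a + b + 1 - y > L" for y
    using that ins_vanishes[OF v lin_EE, of y j i "a + b + 1 - y"]
      ins_vanishes[OF v lin_EE, of "a + b + 1 - y" i j y] swap[of "a + b + 1 - y"] by auto
  have re: "(\<Sum>x\<in>{lo..L}. h x *s ins i x (EE j (a + b + 1 - x)) v) = (\<Sum>y\<in>{lo..L}. h (a + b + 1 - y) *s ?N y)" for h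
    unfolding swap
  proof (rule sum_reindex_support[where j = "\<lambda>x. a + b + 1 - x" and i = "\<lambda>y. a + b + 1 - y"])
    fix x assume x: "x \<in> {lo..L}" "h x *s ?N (a + b + 1 - x) \<noteq> 0"
    then have "?N (a + b + 1 - x) \<noteq> 0" by auto
    then have "\<not> a + b + 1 - x > L" using van[of "a + b + 1 - x"] by auto
    then show "a + b + 1 - x \<in> {lo..L}" using x lo by auto
  next
    fix y assume y: "y \<in> {lo..L}" "h (a + b + 1 - y) *s ?N y \<noteq> 0"
    then have "?N y \<noteq> 0" by auto
    then have "\<not> a + b + 1 - y > L" using van[of y] by auto
    then show "a + b + 1 - y \<in> {lo..L}" using y lo by auto
  qed auto
  have 3: "EE j (b + 1) (EE i a v) = (\<Sum>y\<in>{lo..L}. th j i (1 - (y - b)) *s ?N y)"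
  proof -
    have "EE j (b + 1) (EE i a v) = (\<Sum>x\<in>{lo..L}. th j i (x - a) *s ins i x (EE j (a + b + 1 - x)) v)"
      unfolding EE_EE[OF v lo(1)] by (rule sum.cong) (simp_all add: algebra_simps)
    also have "\<dots> = (\<Sum>y\<in>{lo..L}. th j i (1 - (y - b)) *s ?N y)"
      unfolding re by (rule sum.cong) (simp_all add: algebra_simps)
    finally show ?thesis .
  qed
  have 4: "EE j b (EE i (a + 1) v) = (\<Sum>y\<in>{lo..L}. th j i (- (y - b)) *s ?N y)"
  proof -
    have "EE j b (EE i (a + 1) v) = (\<Sum>x\<in>{lo..L}. th j i (x - a - 1) *s ins i x (EE j (a + b + 1 - x)) v)"
      unfolding EE_EE[OF v lo'(6)] by (rule sum.cong) (simp_all add: algebra_simps)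
    also have "\<dots> = (\<Sum>y\<in>{lo..L}. th j i (- (y - b)) *s ?N y)"
      unfolding re by (rule sum.cong) (simp_all add: algebra_simps)
    finally show ?thesis .
  qed
  show ?thesis
    unfolding 1 2 3 4 phi_def
    by (simp add: scale_sum_right sum_subtractf[symmetric] sum.distrib[symmetric] scale_left_distrib
        scale_left_diff_distrib scale_right_diff_distrib right_diff_distrib)
qed

sublocale K: K_data scale qh dh C K0p K0m Rp Rm H EB ..

lemma op_powi_C: "op_powi C k v = qh powi k *s v"
proof -
  have inv: "inv_into UNIV C u = inverse qh *s u" for u
  proof -
    have "C (inverse qh *s u) = u" by (simp add: C_eq)
    then show ?thesis using inv_f_f[OF bij_is_inj[OF invertible(1)], of "inverse qh *s u"] by simp
  qed
  have "((inv_into UNIV C) ^^ n) v = inverse qh ^ n *s v" for n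
    by (induction n) (simp_all add: inv)
  then show ?thesis by (simp add: op_powi_def C_power power_int_def)
qed

lemma op_powi_C_even: "op_powi C (2 * k) v = q powi k *s v" "op_powi C (- 2 * k) v = q powi (- k) *s v"
proof -
  have "qh powi (2 * k) = q powi k" for k by (simp add: power_int_mult)
  from this[of k] this[of "- k"] show "op_powi C (2 * k) v = q powi k *s v" "op_powi C (- 2 * k) v = q powi (- k) *s v"
    unfolding op_powi_C by simp_all
qed

lemma KPz_vanishes: "bnd L v \<Longrightarrow> c > L \<Longrightarrow> KPz j c \<star> v = 0"
  using homog_PM(3)[of j "nat c"] by (cases "c < 0") (auto simp: zext_def bnd_def)

text \<open>
  At \<open>C\<^sup>2 = q\<close> the delta function leaves one free summation index.
\<close>

lemma delta_KK_eq:
  assumes L: "bnd L v"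
  shows "K.delta_KK i a b v = q powi b *s (\<Sum>c\<in>{0..L}. q powi (- c) *s KMz i (c - (a + b)) \<star> KPz i c \<star> v)"
proof -
  let ?g = "\<lambda>(k :: int, p :: nat, c :: nat). if k + int p - int c = - a \<and> - k = - b
     then op_powi C (2 * k) (Km i p (op_powi C (- 2 * int c) (Kp i c v))) else 0"
  have g: "?g (k, p, c) = (if k + int p - int c = - a \<and> - k = - b
     then q powi k *s q powi (- int c) *s KM i p \<star> KP i c \<star> v else 0)" for k p c
    unfolding op_powi_C_even Kp_KP Km_KM by (simp add: endo_apply_lin[OF linear_PM(4)] op_powi_C_even del: scale_scale)
  let ?C = "{c \<in> {0..L}. c \<ge> a + b}" and ?j = "\<lambda>c. (b, nat (c - (a + b)), nat c)"
  have inj: "inj_on ?j ?C" by (auto simp: inj_on_def)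
  have "Sum_any ?g = sum ?g (?j ` ?C)"
  proof (rule Sum_any.expand_superset)
    show "finite (?j ` ?C)" by (intro finite_imageI finite_subset[of ?C "{0..L}"]) auto
    show "{x. ?g x \<noteq> 0} \<subseteq> ?j ` ?C"
    proof
      fix x assume x: "x \<in> {x. ?g x \<noteq> 0}"
      obtain k p c where kpc: "x = (k, p, c)" by (cases x)
      have 1: "k + int p - int c = - a" "k = b" "KM i p \<star> KP i c \<star> v \<noteq> 0"
        using x g[of k p c] unfolding kpc by (auto split: if_splits)
      then have "KP i c \<star> v \<noteq> 0" using endo_apply_lin(3)[OF linear_PM(4)] by auto
      then have "int c \<le> L" using KPz_vanishes[OF L, of "int c" i] by (metis zext_of_nat not_le)
      then show "x \<in> ?j ` ?C" unfolding kpc using 1(1,2) by (intro image_eqI[of _ _ "int c"]) auto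
    qed
  qed
  also have "sum ?g (?j ` ?C) = (\<Sum>c\<in>?C. q powi b *s q powi (- c) *s KMz i (c - (a + b)) \<star> KPz i c \<star> v)"
    unfolding sum.reindex[OF inj] o_def g by (rule sum.cong) (auto simp: zext_def)
  also have "\<dots> = (\<Sum>c\<in>{0..L}. q powi b *s q powi (- c) *s KMz i (c - (a + b)) \<star> KPz i c \<star> v)"
    by (rule sum.mono_neutral_left) (auto simp: zext_def)
  finally show ?thesis unfolding K.delta_KK_def scale_sum_right .
qed

text \<open>
  For \<open>i = j\<close> the weight is a sum of two exponentials (\<open>phi_diag\<close>), which the symmetry of the
  normally ordered product identifies; \<open>ins_ins_diagonal\<close> evaluates the result.
\<close>

lemma E_E_relation:
  "d_coeff d i j *s (EB i (a + 1) (EB j b v) - g_root q d i j *s EB i a (EB j (b + 1) v))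
      + (EB j (b + 1) (EB i a v) - g_root q d j i *s EB j b (EB i (a + 1) v)) =
      (if i = j then inverse (q - inverse q) *s
         ((K.delta_KK i (a + 1) b v - g_root q d i i *s K.delta_KK i a (b + 1) v)
          + (K.delta_KK i (b + 1) a v - g_root q d i i *s K.delta_KK i b (a + 1) v))
       else 0)"
proof -
  obtain L where L: "bnd L v" using bnd_exists by blast
  \<comment> \<open>any sufficiently small lower end of the summation range works\<close>
  define lo where "lo = - (\<bar>a\<bar> + \<bar>b\<bar> + \<bar>L\<bar>)"
  have lo: "lo \<le> a" "lo \<le> b" "lo \<le> a + b + 1 - L" by (auto simp: lo_def)
  have EBEB: "EB i m (EB j n v) = kap^2 *s EE i m (EE j n v)" for i j m n
    by (simp add: EB_eq lin_simps[OF lin_EE] power2_eq_square)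
  have pull: "D *s (k *s A1 - G *s k *s A2) + (k *s A3 - G' *s k *s A4) =
      k *s (D *s (A1 - G *s A2) + (A3 - G' *s A4))" for D k G G' and A1 A2 A3 A4 :: 'v
    by (simp add: scale_right_distrib scale_right_diff_distrib mult_ac)
  have lhs: "d_coeff d i j *s (EB i (a + 1) (EB j b v) - g_root q d i j *s EB i a (EB j (b + 1) v))
      + (EB j (b + 1) (EB i a v) - g_root q d j i *s EB j b (EB i (a + 1) v)) =
      kap^2 *s (\<Sum>y\<in>{lo..L}. phi i j (y - b) *s ins j y (EE i (a + b + 1 - y)) v)"
    unfolding EBEB pull EE_quadratic[OF L lo] ..
  show ?thesis
  proof (cases "i = j")
    case False
    then show ?thesis unfolding lhs phi_off_diagonal[OF False] by simp
  next
    case True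
    define Z where "Z = (\<Sum>c\<in>{0..L}. q powi (- c) *s KMz i (c - (a + b + 1)) \<star> KPz i c \<star> v)"
    have dK: "K.delta_KK i (a + 1) b v = q powi b *s Z" "K.delta_KK i a (b + 1) v = q powi (b + 1) *s Z"
      "K.delta_KK i (b + 1) a v = q powi a *s Z" "K.delta_KK i b (a + 1) v = q powi (a + 1) *s Z"
      unfolding delta_KK_eq[OF L] Z_def by (simp_all add: ac_simps)
    have Z: "Z = (\<Sum>y\<in>{lo..L}. q powi (- y) *s ins i y (EE i (a + b + 1 - y)) v)"
    proof -
      have "Z = (\<Sum>y\<in>{lo..L}. q powi (- y) *s ins i (a + b + 1 - y) (EE i y) v)"
        unfolding Z_def by (rule ins_ins_diagonal[OF L lin_id lo(3), symmetric])
      then show ?thesis by (simp add: ins_commute[OF lin_id, of i _ i "_::int"])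
    qed
    have g: "g_root q d i i = q^2" by (simp only: g_root_def if_True simp_thms)
    have c: "kap^2 * phi i i (y - b) = inverse (q - inverse q) * ((1 - q^3) * (q powi b + q powi a)) * q powi (- y)
        + (kap^2 * ((q - 1) * (1 - q^3) / (q + 1)) * (q powi (y - b - 1) - q powi (a - y)))" for y
    proof -
      have k: "kap^2 * ((q - 1) * (1 - q^3) / (q + 1)) = inverse (q - inverse q) * (1 - q^3)"
      proof -
        have "t / (t - 1)^2 * ((t - 1) * u / (t + 1)) = inverse (t - inverse t) * u" if "t \<noteq> 0" "t \<noteq> 1" "t + 1 \<noteq> 0" for t u :: complex
        proof -
          have "t * t - 1 = (t - 1) * (t + 1)" by (simp add: algebra_simps)
          then have "t * t - 1 \<noteq> 0" using that by simp
          then show ?thesis using that by (simp add: divide_simps) (simp add: algebra_simps eval_nat_numeral)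
        qed
        from this[OF Qp.q_nz Qp.q_neq_1 Qp.q1_nz] show ?thesis unfolding kap_square .
      qed
      have pw: "q powi (- (y - b)) = q powi b * q powi (- y)" "q powi (a - y) = q powi a * q powi (- y)"
        using power_int_add[of q b "- y"] power_int_add[of q a "- y"] by simp_all
      have alg: "\<kappa> * (\<mu> * (B * y' + Y)) = I * (\<nu> * (B + A)) * y' + \<kappa> * \<mu> * (Y - A * y')"
        if "\<kappa> * \<mu> = I * \<nu>" for \<kappa> \<mu> I \<nu> A B Y y' :: complex
      proof -
        have "\<kappa> * (\<mu> * (B * y' + Y)) = (\<kappa> * \<mu>) * (B * y' + Y)" by (rule mult.assoc[symmetric])
        then show ?thesis unfolding that by (simp add: algebra_simps)
      qed
      show ?thesis unfolding phi_diag pw by (rule alg[OF k])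
    qed
    let ?N = "\<lambda>y. ins i y (EE i (a + b + 1 - y)) v"
    have anti: "(\<Sum>y\<in>{lo..L}. q powi (y - b - 1) *s ?N y) = (\<Sum>y\<in>{lo..L}. q powi (a - y) *s ?N y)"
    proof (rule sum_reindex_support[where j = "\<lambda>x. a + b + 1 - x" and i = "\<lambda>y. a + b + 1 - y"])
      have swap: "?N (a + b + 1 - y) = ?N y" for y
        using ins_commute[OF lin_id, of i y i "a + b + 1 - y" v] by simp
      have van: "?N y = 0" if "y > L \<or> a + b + 1 - y > L" for y
        using that ins_vanishes[OF L lin_EE, of y i i "a + b + 1 - y"]
          ins_vanishes[OF L lin_EE, of "a + b + 1 - y" i i y] swap[of y] by auto
      have in_range: "a + b + 1 - x \<in> {lo..L}" if "x \<in> {lo..L}" "?N x \<noteq> 0" for x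
        using van[of x] that lo by fastforce
      show "a + b + 1 - x \<in> {lo..L}" if "x \<in> {lo..L}" "q powi (x - b - 1) *s ?N x \<noteq> 0" for x
        using in_range[of x] that by auto
      show "a + b + 1 - x \<in> {lo..L}" if "x \<in> {lo..L}" "q powi (a - x) *s ?N x \<noteq> 0" for x
        using in_range[of x] that by auto
      show "q powi (a - (a + b + 1 - x)) *s ?N (a + b + 1 - x) = q powi (x - b - 1) *s ?N x" for x
        unfolding swap by (simp add: algebra_simps)
    qed auto
    have "kap^2 *s (\<Sum>y\<in>{lo..L}. phi i i (y - b) *s ?N y) =
        (inverse (q - inverse q) * ((1 - q^3) * (q powi b + q powi a))) *s (\<Sum>y\<in>{lo..L}. q powi (- y) *s ?N y)
        + (kap^2 * ((q - 1) * (1 - q^3) / (q + 1))) *s ((\<Sum>y\<in>{lo..L}. q powi (y - b - 1) *s ?N y) - (\<Sum>y\<in>{lo..L}. q powi (a - y) *s ?N y))"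
      (is "_ = ?x *s _ + ?y *s (_ - _)")
    proof -
      have trm: "kap^2 *s phi i i (y - b) *s w = ?x *s q powi (- y) *s w + ?y *s (q powi (y - b - 1) *s w - q powi (a - y) *s w)" for y and w :: 'v
        by (simp only: scale_scale c scale_left_distrib scale_left_diff_distrib[symmetric])
      show ?thesis by (simp only: scale_sum_right trm sum.distrib sum_subtractf[symmetric])
    qed
    also have "\<dots> = (inverse (q - inverse q) * ((1 - q^3) * (q powi b + q powi a))) *s Z"
      unfolding anti Z[symmetric] by simp
    also have "\<dots> = inverse (q - inverse q) *s ((K.delta_KK i (a + 1) b v - g_root q d i i *s K.delta_KK i a (b + 1) v)
          + (K.delta_KK i (b + 1) a v - g_root q d i i *s K.delta_KK i b (a + 1) v))"
    proof -
      have "(1 - q^3) * (q powi b + q powi a) = (q powi b - q^2 * q powi (b + 1)) + (q powi a - q^2 * q powi (a + 1))"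
        unfolding Qp.powi_Suc by (simp add: algebra_simps eval_nat_numeral)
      then show ?thesis unfolding dK g
        by (simp only: scale_scale scale_left_distrib[symmetric] scale_left_diff_distrib[symmetric])
    qed
    finally show ?thesis unfolding lhs using True by simp
  qed
qed

section \<open>The Serre relation\<close>

text \<open>
  The normally ordered product of \<open>E\<^sub>i\<close>, \<open>E\<^sub>i\<close>, \<open>E\<^sub>j\<close> of total degree \<open>T\<close>.
\<close>

abbreviation NN :: "'n mod_ring \<Rightarrow> 'n mod_ring \<Rightarrow> int \<Rightarrow> 'v \<Rightarrow> int \<Rightarrow> int \<Rightarrow> 'v" where
  "NN i j T v x y \<equiv> ins i x (ins i y (EE j (T - x - y))) v"

lemma EE_swap: "ins j e (EE i x) = ins i x (EE j e)"
  by (rule ext) (rule ins_commute[OF lin_id])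

lemma NN_sym: "NN i j T v x y = NN i j T v y x"
proof -
  have "T - x - y = T - y - x" by simp
  then show ?thesis using ins_commute[OF lin_EE, of i x i y j "T - x - y" v] by (simp only:)
qed

lemma NN_last: "ins i x (ins i y (EE j z)) v = ins j z (ins i x (EE i y)) v"
  unfolding EE_swap[of i y j z] by (rule ins_commute[OF lin_EE])

text \<open>
  By symmetry each of the three factors can be made the outermost one.
\<close>

lemma NN_vanishes:
  assumes v: "bnd L v" and "x > L \<or> y > L \<or> T - x - y > L"
  shows "NN i j T v x y = 0"
proof -
  consider "x > L" | "y > L" | "T - x - y > L" using assms(2) by blast
  then show ?thesis
  proof cases
    case 1 then show ?thesis by (rule ins_vanishes[OF v lin_ins[OF lin_EE]])
  next
    case 2 then show ?thesis unfolding NN_sym[of i x] by (rule ins_vanishes[OF v lin_ins[OF lin_EE]])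
  next
    case 3 then show ?thesis unfolding NN_last[of i x y j "T - x - y"] by (rule ins_vanishes[OF v lin_ins[OF lin_EE]])
  qed
qed

text \<open>
  The three orderings produce different pairs of independent indices; the third index is determined
  by the total degree.
\<close>

lemma NN_reindex:
  assumes v: "bnd L v" and lo: "lo \<le> T - 2 * L" and y: "y \<in> {lo..L}"
  shows "(\<Sum>e\<in>{lo..L}. h e *s NN i j T v (T - e - y) y) = (\<Sum>x\<in>{lo..L}. h (T - x - y) *s NN i j T v x y)"
proof (rule sum_reindex_support[where j = "\<lambda>x. T - x - y" and i = "\<lambda>y'. T - y' - y"])
  have *: "T - e - y \<in> {lo..L}" if "e \<in> {lo..L}" "NN i j T v (T - e - y) y \<noteq> 0" for e
  proof -
    have "\<not> T - e - y > L" using NN_vanishes[OF v, of "T - e - y" y T i j] that(2) by blast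
    then show ?thesis using that(1) y lo by auto
  qed
  show "T - e - y \<in> {lo..L}" if "e \<in> {lo..L}" "h e *s NN i j T v (T - e - y) y \<noteq> 0" for e
    by (rule *[OF that(1)]) (use that(2) in auto)
  show "T - x - y \<in> {lo..L}" if "x \<in> {lo..L}" "h (T - x - y) *s NN i j T v x y \<noteq> 0" for x
  proof -
    have "\<not> T - x - y > L" using NN_vanishes[OF v, of x y T i j] that(2) by auto
    then show ?thesis using that(1) y lo by auto
  qed
qed auto

lemma Sum_swap_last: "(\<Sum>c\<in>A. \<Sum>e\<in>B. \<Sum>y\<in>D. F c e y) = (\<Sum>y\<in>D. \<Sum>e\<in>B. \<Sum>c\<in>A. (F c e y :: 'c::comm_monoid_add))"
  by (subst sum.swap[of _ D B], subst sum.swap[of _ D A], subst sum.swap[of _ B A]) (rule refl)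

text \<open>
  The bounds on \<open>lo\<close> and \<open>K\<close> say that the summation ranges contain the support of every term that arises
  in the normal ordering of the three products.
\<close>

context
  fixes i j :: "'n mod_ring" and \<epsilon> :: complex and a b m L lo :: int and K :: nat and v :: 'v
  assumes nb: "neighbour \<epsilon> i j" and v: "bnd L v"
    and lo: "lo \<le> a" "lo \<le> b" "lo \<le> m" "lo \<le> a + b - L" "lo \<le> a + m - L" "lo \<le> b + m - L" "lo \<le> a + b + m - 2 * L"
    and K: "int K \<ge> 4 * (\<bar>lo\<bar> + \<bar>L\<bar> + \<bar>a\<bar> + \<bar>b\<bar> + \<bar>m\<bar>)"
begin

text \<open>
  The index \<open>l\<close> is the exponent in the exchange series of the two \<open>E\<^sub>i\<close>; it shifts their arguments in
  opposite directions.
\<close>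

definition weight :: "(int \<Rightarrow> int \<Rightarrow> complex) \<Rightarrow> int \<Rightarrow> int \<Rightarrow> complex" where
  "weight w x y = (\<Sum>l\<in>{0..int K}. Qp.theta_ii l * w (x - a + l) (y - b - l))"

lemma eps_powi: "\<epsilon> powi s * \<epsilon> powi t = \<epsilon> powi (s + t)" "inverse \<epsilon> powi s * \<epsilon> powi t = \<epsilon> powi (t - s)"
  "inverse \<epsilon> powi s * inverse \<epsilon> powi t = \<epsilon> powi (- s - t)"
proof -
  have nz: "\<epsilon> \<noteq> 0" by (rule neighbour_nz[OF nb])
  have i: "inverse \<epsilon> powi s = \<epsilon> powi (- s)" for s by (simp add: power_int_inverse power_int_minus)
  show "\<epsilon> powi s * \<epsilon> powi t = \<epsilon> powi (s + t)" "inverse \<epsilon> powi s * \<epsilon> powi t = \<epsilon> powi (t - s)"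
    "inverse \<epsilon> powi s * inverse \<epsilon> powi t = \<epsilon> powi (- s - t)"
    unfolding i using nz by (simp_all flip: power_int_add)
qed

text \<open>
  The three lemmas for the three orderings differ only in the signs of the arguments of \<open>f\<close>: the sign is
  negative when \<open>E\<^sub>i\<close> stands to the left of \<open>E\<^sub>j\<close>.
\<close>

lemma product_iij:
  "EE i a (EE i b (EE j m v)) = (\<Sum>y\<in>{lo..L}. \<Sum>x\<in>{lo..L}.
    (\<epsilon> powi (a + b - x - y) / q * weight (\<lambda>x' y'. Qp.f (- x') * Qp.f (- y')) x y) *s NN i j (a + b + m) v x y)"
proof -
  let ?T = "a + b + m"
  have perm: "ins j e (ins i y (EE i x)) v = ins i x (ins i y (EE j e)) v" for e x y
    unfolding NN_last[of i x y j e] EE_swap[of i y i x] ..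
  have coef: "(\<Sum>c\<in>{lo..L}. th i j (c - m) * th i j (e - c) * th i i (y + c - b - m)) =
      \<epsilon> powi (a + b - (?T - e - y) - y) / q * weight (\<lambda>x' y'. Qp.f (- x') * Qp.f (- y')) (?T - e - y) y"
    if e: "e \<in> {lo..L}" and y: "y \<in> {lo..L}" for e y
    unfolding weight_def sum_distrib_left
  proof (rule sum_reindex_support[where j = "\<lambda>c. y + c - b - m" and i = "\<lambda>l. l + b + m - y"])
    fix c
    have "- (?T - e - y - a + (y + c - b - m)) = e - c" "- (y - b - (y + c - b - m)) = c - m"
      "c - m + (e - c) = a + b - (?T - e - y) - y" by simp_all
    then show "\<epsilon> powi (a + b - (?T - e - y) - y) / q * (Qp.theta_ii (y + c - b - m) * (Qp.f (- (?T - e - y - a + (y + c - b - m))) * Qp.f (- (y - b - (y + c - b - m))))) =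
        th i j (c - m) * th i j (e - c) * th i i (y + c - b - m)"
      unfolding th_neighbour[OF nb] th_diag using eps_powi(1)[of "c - m" "e - c"]
      by (simp add: power2_eq_square divide_inverse mult_ac)
  next
    fix c assume c: "c \<in> {lo..L}" "th i j (c - m) * th i j (e - c) * th i i (y + c - b - m) \<noteq> 0"
    then have "\<not> y + c - b - m < 0" by (auto simp: zcoeff_neg)
    then show "y + c - b - m \<in> {0..int K}" using c(1) y K by auto
  next
    fix l assume l: "l \<in> {0..int K}" "\<epsilon> powi (a + b - (?T - e - y) - y) / q *
      (Qp.theta_ii l * (Qp.f (- (?T - e - y - a + l)) * Qp.f (- (y - b - l)))) \<noteq> 0"
    have "Qp.f (- (?T - e - y - a + l)) \<noteq> 0" "Qp.f (- (y - b - l)) \<noteq> 0"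
      using l(2) by (simp_all only: mult_eq_0_iff de_Morgan_disj simp_thms)
    then have "\<not> - (?T - e - y - a + l) < 0" "\<not> - (y - b - l) < 0" using Qp.f_neg by blast+
    then show "l + b + m - y \<in> {lo..L}" using e lo by auto
  qed auto
  have "EE i a (EE i b (EE j m v)) = (\<Sum>y\<in>{lo..L}. \<Sum>e\<in>{lo..L}. \<Sum>c\<in>{lo..L}.
    (th i j (c - m) * th i j (e - c) * th i i (y + c - b - m)) *s NN i j ?T v (?T - e - y) y)"
    unfolding EE_EE_EE[OF v lo(3,6)] perm by (rule trans[OF Sum_swap_last]) (intro sum.cong refl, simp)
  also have "\<dots> = (\<Sum>y\<in>{lo..L}. \<Sum>e\<in>{lo..L}.
      (\<epsilon> powi (a + b - (?T - e - y) - y) / q * weight (\<lambda>x' y'. Qp.f (- x') * Qp.f (- y')) (?T - e - y) y) *s NN i j ?T v (?T - e - y) y)"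
    unfolding scale_sum_left[symmetric] by (intro sum.cong refl arg_cong[where f = "\<lambda>c. c *s _"] coef)
  also have "\<dots> = (\<Sum>y\<in>{lo..L}. \<Sum>x\<in>{lo..L}.
      (\<epsilon> powi (a + b - x - y) / q * weight (\<lambda>x' y'. Qp.f (- x') * Qp.f (- y')) x y) *s NN i j ?T v x y)"
  proof (rule sum.cong, rule refl)
    fix y assume y: "y \<in> {lo..L}"
    have "?T - (?T - x - y) - y = x" for x by simp
    then show "(\<Sum>e\<in>{lo..L}. (\<epsilon> powi (a + b - (?T - e - y) - y) / q * weight (\<lambda>x' y'. Qp.f (- x') * Qp.f (- y')) (?T - e - y) y) *s NN i j ?T v (?T - e - y) y) =
        (\<Sum>x\<in>{lo..L}. (\<epsilon> powi (a + b - x - y) / q * weight (\<lambda>x' y'. Qp.f (- x') * Qp.f (- y')) x y) *s NN i j ?T v x y)"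
      unfolding NN_reindex[OF v lo(7) y] by (simp only:)
  qed
  finally show ?thesis .
qed

lemma product_iji:
  "EE i a (EE j m (EE i b v)) = (\<Sum>y\<in>{lo..L}. \<Sum>x\<in>{lo..L}.
    (\<epsilon> powi (a + b - x - y) / q * weight (\<lambda>x' y'. Qp.f (- x') * Qp.f y') x y) *s NN i j (a + b + m) v x y)"
proof -
  let ?T = "a + b + m"
  have coef: "(\<Sum>c\<in>{lo..L}. th j i (c - b) * th i i (y - c) * th i j (z + c - m - b)) =
      \<epsilon> powi (a + b - (?T - z - y) - y) / q * weight (\<lambda>x' y'. Qp.f (- x') * Qp.f y') (?T - z - y) y"
    if z: "z \<in> {lo..L}" and y: "y \<in> {lo..L}" for z y
    unfolding weight_def sum_distrib_left
  proof (rule sum_reindex_support[where j = "\<lambda>c. y - c" and i = "\<lambda>l. y - l"])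
    fix c
    have eq: "- (?T - z - y - a + (y - c)) = z + c - m - b" "y - b - (y - c) = c - b"
      and ex: "(z + c - m - b) - (c - b) = a + b - (?T - z - y) - y" by simp_all
    then show "\<epsilon> powi (a + b - (?T - z - y) - y) / q * (Qp.theta_ii (y - c) * (Qp.f (- (?T - z - y - a + (y - c))) * Qp.f (y - b - (y - c)))) =
        th j i (c - b) * th i i (y - c) * th i j (z + c - m - b)"
      unfolding th_neighbour[OF nb] th_neighbour[OF neighbour_sym[OF nb]] th_diag eq ex[symmetric] eps_powi(2)[symmetric]
      by (simp only: power2_eq_square divide_inverse inverse_mult_distrib mult_ac)
  next
    fix c assume c: "c \<in> {lo..L}" "th j i (c - b) * th i i (y - c) * th i j (z + c - m - b) \<noteq> 0"
    then have "\<not> y - c < 0" by (auto simp: zcoeff_neg)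
    then show "y - c \<in> {0..int K}" using c(1) y K by auto
  next
    fix l assume l: "l \<in> {0..int K}" "\<epsilon> powi (a + b - (?T - z - y) - y) / q *
      (Qp.theta_ii l * (Qp.f (- (?T - z - y - a + l)) * Qp.f (y - b - l))) \<noteq> 0"
    have "Qp.f (y - b - l) \<noteq> 0" using l(2) by (simp_all only: mult_eq_0_iff de_Morgan_disj simp_thms)
    then have "\<not> y - b - l < 0" using Qp.f_neg by blast
    then show "y - l \<in> {lo..L}" using y l lo by auto
  qed auto
  have "EE i a (EE j m (EE i b v)) = (\<Sum>e\<in>{lo..L}. \<Sum>z\<in>{lo..L}. \<Sum>c\<in>{lo..L}.
    (th j i (c - b) * th i i (e - c) * th i j (z + c - m - b)) *s NN i j ?T v (?T - z - e) e)"
  proof -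
    have perm: "ins i e (ins j z (EE i x)) v = ins i x (ins i e (EE j z)) v" for e x z
      unfolding EE_swap[of j z] by (rule ins_commute[OF lin_EE])
    show ?thesis unfolding EE_EE_EE[OF v lo(2), of m, unfolded add.commute[of m b], OF lo(6)] perm
      by (subst sum.swap, rule sum.cong[OF refl], subst sum.swap, intro sum.cong refl) (simp add: algebra_simps)
  qed
  also have "\<dots> = (\<Sum>y\<in>{lo..L}. \<Sum>z\<in>{lo..L}.
      (\<epsilon> powi (a + b - (?T - z - y) - y) / q * weight (\<lambda>x' y'. Qp.f (- x') * Qp.f y') (?T - z - y) y) *s NN i j ?T v (?T - z - y) y)"
    unfolding scale_sum_left[symmetric] by (intro sum.cong refl arg_cong[where f = "\<lambda>c. c *s _"] coef)
  also have "\<dots> = (\<Sum>y\<in>{lo..L}. \<Sum>x\<in>{lo..L}.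
      (\<epsilon> powi (a + b - x - y) / q * weight (\<lambda>x' y'. Qp.f (- x') * Qp.f y') x y) *s NN i j ?T v x y)"
  proof (rule sum.cong, rule refl)
    fix y assume y: "y \<in> {lo..L}"
    have "?T - (?T - x - y) - y = x" for x by simp
    then show "(\<Sum>z\<in>{lo..L}. (\<epsilon> powi (a + b - (?T - z - y) - y) / q * weight (\<lambda>x' y'. Qp.f (- x') * Qp.f y') (?T - z - y) y) *s NN i j ?T v (?T - z - y) y) =
        (\<Sum>x\<in>{lo..L}. (\<epsilon> powi (a + b - x - y) / q * weight (\<lambda>x' y'. Qp.f (- x') * Qp.f y') x y) *s NN i j ?T v x y)"
      unfolding NN_reindex[OF v lo(7) y] by (simp only:)
  qed
  finally show ?thesis .
qed

lemma product_jii: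
  "EE j m (EE i a (EE i b v)) = (\<Sum>y\<in>{lo..L}. \<Sum>x\<in>{lo..L}.
    (\<epsilon> powi (a + b - x - y) / q * weight (\<lambda>x' y'. Qp.f x' * Qp.f y') x y) *s NN i j (a + b + m) v x y)"
proof -
  let ?T = "a + b + m"
  have coef: "(\<Sum>c\<in>{lo..L}. th i i (c - b) * th j i (y - c) * th j i (x + c - a - b)) =
      \<epsilon> powi (a + b - x - y) / q * weight (\<lambda>x' y'. Qp.f x' * Qp.f y') x y"
    if x: "x \<in> {lo..L}" and y: "y \<in> {lo..L}" for x y
    unfolding weight_def sum_distrib_left
  proof (rule sum_reindex_support[where j = "\<lambda>c. c - b" and i = "\<lambda>l. l + b"])
    fix c
    have eq: "x - a + (c - b) = x + c - a - b" "y - b - (c - b) = y - c"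
      and ex: "- (x + c - a - b) - (y - c) = a + b - x - y" by simp_all
    then show "\<epsilon> powi (a + b - x - y) / q * (Qp.theta_ii (c - b) * (Qp.f (x - a + (c - b)) * Qp.f (y - b - (c - b)))) =
        th i i (c - b) * th j i (y - c) * th j i (x + c - a - b)"
      unfolding th_neighbour[OF neighbour_sym[OF nb]] th_diag eq ex[symmetric] eps_powi(3)[symmetric]
      by (simp only: power2_eq_square divide_inverse inverse_mult_distrib mult_ac)
  next
    fix c assume c: "c \<in> {lo..L}" "th i i (c - b) * th j i (y - c) * th j i (x + c - a - b) \<noteq> 0"
    then have "\<not> c - b < 0" by (auto simp: zcoeff_neg)
    then show "c - b \<in> {0..int K}" using c(1) K by auto
  next
    fix l assume l: "l \<in> {0..int K}" "\<epsilon> powi (a + b - x - y) / q *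
      (Qp.theta_ii l * (Qp.f (x - a + l) * Qp.f (y - b - l))) \<noteq> 0"
    have "Qp.f (y - b - l) \<noteq> 0" using l(2) by (simp_all only: mult_eq_0_iff de_Morgan_disj simp_thms)
    then have "\<not> y - b - l < 0" using Qp.f_neg by blast
    then show "l + b \<in> {lo..L}" using y l lo by auto
  qed auto
  have "EE j m (EE i a (EE i b v)) = (\<Sum>e\<in>{lo..L}. \<Sum>x\<in>{lo..L}. \<Sum>c\<in>{lo..L}.
    (th i i (c - b) * th j i (e - c) * th j i (x + c - a - b)) *s NN i j ?T v x e)"
  proof -
    have perm: "ins i e (ins i x (EE j (m + a + b - e - x))) v = NN i j ?T v x e" for e x
    proof -
      have "m + a + b - e - x = ?T - e - x" by simp
      then show ?thesis using NN_sym[of i e x j ?T v] by (simp only:)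
    qed
    show ?thesis unfolding EE_EE_EE[OF v lo(2,4)] perm
      by (subst sum.swap, rule sum.cong[OF refl], rule sum.swap)
  qed
  also have "\<dots> = (\<Sum>y\<in>{lo..L}. \<Sum>x\<in>{lo..L}.
      (\<epsilon> powi (a + b - x - y) / q * weight (\<lambda>x' y'. Qp.f x' * Qp.f y') x y) *s NN i j ?T v x y)"
    unfolding scale_sum_left[symmetric] by (intro sum.cong refl arg_cong[where f = "\<lambda>c. c *s _"] coef)
  finally show ?thesis .
qed

text \<open>
  The two terms with \<open>E\<^sub>j\<close> in the middle coincide after symmetrization, which turns the nested brackets
  into this combination.
\<close>

lemma serre_combination:
  "EE i a (EE i b (EE j m v)) - (q + 1 / q) *s EE i a (EE j m (EE i b v)) + EE j m (EE i a (EE i b v)) =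
   (\<Sum>y\<in>{lo..L}. \<Sum>x\<in>{lo..L}. (\<epsilon> powi (a + b - x - y) * Qp.cubic K (x - a) (y - b)) *s NN i j (a + b + m) v x y)"
proof -
  have "Qp.cubic K (x - a) (y - b) = (weight (\<lambda>x' y'. Qp.f (- x') * Qp.f (- y')) x y
      - (q + 1 / q) * weight (\<lambda>x' y'. Qp.f (- x') * Qp.f y') x y + weight (\<lambda>x' y'. Qp.f x' * Qp.f y') x y) / q" for x y
  proof -
    have "t * ((u - c * w + z) / p) = (t * u - c * (t * w) + t * z) / p" for t u c w z p :: complex
      by (simp add: algebra_simps divide_inverse)
    then show ?thesis
      unfolding Qp.cubic_def weight_def Qp.Q_def sum_distrib_left sum_subtractf[symmetric] sum.distrib[symmetric] sum_divide_distrib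
      by (intro sum.cong refl)
  qed
  moreover have "e * ((A - c * B + D) / p) = e / p * A - c * (e / p * B) + e / p * D" for e A B D c p :: complex
    by (simp add: algebra_simps divide_inverse)
  ultimately have "\<epsilon> powi (a + b - x - y) * Qp.cubic K (x - a) (y - b) =
      \<epsilon> powi (a + b - x - y) / q * weight (\<lambda>x' y'. Qp.f (- x') * Qp.f (- y')) x y
      - (q + 1 / q) * (\<epsilon> powi (a + b - x - y) / q * weight (\<lambda>x' y'. Qp.f (- x') * Qp.f y') x y)
      + \<epsilon> powi (a + b - x - y) / q * weight (\<lambda>x' y'. Qp.f x' * Qp.f y') x y" for x y
    by (simp only:)
  then show ?thesis
    unfolding product_iij product_iji product_jii scale_sum_right sum_subtractf[symmetric] sum.distrib[symmetric]
    by (simp only: scale_left_distrib scale_left_diff_distrib scale_scale)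
qed

end

lemma sum_symmetrize: "(\<Sum>y\<in>A. \<Sum>x\<in>A. h x y *s NN i j T v x y) = (\<Sum>y\<in>A. \<Sum>x\<in>A. h y x *s NN i j T v x y)"
  by (subst sum.swap) (simp only: NN_sym[of i _ _ j T v])

text \<open>
  The two geometric series are the halves \<open>t \<ge> 0\<close> and \<open>t < 0\<close> of one sum over the integers, and
  \<open>ins_ins_diagonal\<close>, read from right to left, turns \<open>K\<^sub>i\<^sup>- E\<^sub>j K\<^sub>i\<^sup>+\<close> into normally ordered products.
\<close>

lemma delta_KEK_eq:
  assumes nb: "neighbour \<epsilon> i j" and v: "bnd L v"
    and lo: "lo \<le> a + b - L" "lo \<le> a + b + m - 2 * L"
  shows "K.delta_KEK \<epsilon> i j a b m v =
    (\<Sum>y\<in>{lo..L}. \<Sum>x\<in>{lo..L}. (kap * \<epsilon> powi (a + b - x - y) * (q powi (b - y) * Qp.rho (x + y - a - b))) *s NN i j (a + b + m) v x y)"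
proof -
  have nz: "\<epsilon> \<noteq> 0" by (rule neighbour_nz[OF nb])
  let ?T = "a + b + m"
  \<comment> \<open>\<open>W t c\<close> is the summand with \<open>l = t\<close> of the first series if \<open>t \<ge> 0\<close>, with \<open>l = - t\<close> of the second one if \<open>t < 0\<close>\<close>
  define W where "W t c = (\<epsilon> powi (- t) * Qp.rho t * q powi (b - c)) *s KMz i (c - (a + b + t)) \<star> EB j (m - t) (KPz i c \<star> v)" for t c
  have W0: "W t c = 0" if "c < 0 \<or> c > L \<or> c < a + b + t \<or> t < m - L" for t c
  proof -
    have "KMz i (c - (a + b + t)) \<star> EB j (m - t) (KPz i c \<star> v) = 0"
    proof (cases "c < 0 \<or> c > L")
      case True
      then have "KPz i c \<star> v = 0" using KPz_vanishes[OF v, of c i] by (auto simp: zext_neg)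
      then show ?thesis by (simp add: lin_simps[OF lin_EB] endo_apply_lin[OF linear_zext[OF linear_PM(4)]])
    next
      case False
      then consider "c < a + b + t" | "m - t > L" using \<open>c < 0 \<or> c > L \<or> c < a + b + t \<or> t < m - L\<close> by linarith
      then show ?thesis
      proof cases
        case 1 then show ?thesis by (simp add: zext_neg)
      next
        case 2
        have "bnd L (KPz i c \<star> v)" using False by (auto simp: zext_def intro: bnd_apply[OF v homog_PM(3)])
        then have "EE j (m - t) (KPz i c \<star> v) = 0" using ins_vanishes[OF _ lin_id 2] by blast
        then show ?thesis by (simp add: EB_eq endo_apply_lin[OF linear_zext[OF linear_PM(4)]])
      qed
    qed
    then show ?thesis by (simp add: W_def)
  qed
  have pw: "\<epsilon> powi (- int l) * Qp.rho (int l) = (inverse q * inverse \<epsilon>) ^ l" for l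
    by (simp add: Qp.rho_def power_int_minus power_mult_distrib power_inverse mult.commute)
  have pw': "\<epsilon> powi (int l) * Qp.rho (- int l) * q powi (b - c) = (inverse q * \<epsilon>) ^ l * q powi (b - int l - c)" if "l \<ge> 1" for l c
  proof -
    have "Qp.rho (- int l) = q powi (2 * - int l)" using that by (simp add: Qp.rho_def)
    moreover have "q powi (2 * - int l) * q powi (b - c) = q powi (- int l) * q powi (b - int l - c)"
      unfolding q_powi_add[symmetric] by simp
    moreover have "q powi (- int l) = inverse q ^ l" by (simp add: power_int_minus power_inverse)
    ultimately show ?thesis by (simp add: power_mult_distrib mult_ac)
  qed
  have op: "op_powi C (2 * k) (Km i p (EB j s (Kp i c u))) = q powi k *s KM i p \<star> EB j s (KP i c \<star> u)" for k p c s u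
    by (simp only: op_powi_C_even Kp_KP Km_KM)
  have first: "Sum_any (\<lambda>(l :: nat, k :: int, p :: nat, c :: nat).
       if int l + k + int p = - a \<and> - k - int c = - b
       then (inverse q * inverse \<epsilon>) ^ l *s op_powi C (2 * k) (Km i p (EB j (m - int l) (Kp i c v))) else 0) =
     (\<Sum>t\<in>{0..2 * \<bar>L\<bar> - a - b}. \<Sum>c\<in>{0..L}. W t c)"
  proof -
    let ?g = "\<lambda>(l :: nat, k :: int, p :: nat, c :: nat).
       if int l + k + int p = - a \<and> - k - int c = - b
       then (inverse q * inverse \<epsilon>) ^ l *s op_powi C (2 * k) (Km i p (EB j (m - int l) (Kp i c v))) else 0"
    let ?C = "{(t, c) \<in> {0..2 * \<bar>L\<bar> - a - b} \<times> {0..L}. c \<ge> a + b + t}"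
    let ?j = "\<lambda>(t, c). (nat t, b - c, nat (c - (a + b + t)), nat c)"
    have g: "?g (nat t, b - c, nat (c - (a + b + t)), nat c) = W t c" if "t \<ge> 0" "c \<ge> 0" "c \<ge> a + b + t" for t c
    proof -
      have "?g (nat t, b - c, nat (c - (a + b + t)), nat c) =
          (inverse q * inverse \<epsilon>) ^ nat t *s q powi (b - c) *s KM i (nat (c - (a + b + t))) \<star> EB j (m - t) (KP i (nat c) \<star> v)"
        unfolding op using that by simp
      then show ?thesis using that pw[of "nat t"] by (simp add: W_def zext_def)
    qed
    have "finite ?C" by (rule finite_subset[of _ "{0..2 * \<bar>L\<bar> - a - b} \<times> {0..L}"]) auto
    have "inj_on ?j ?C" by (auto simp: inj_on_def)
    have "Sum_any ?g = sum ?g (?j ` ?C)"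
    proof (rule Sum_any.expand_superset)
      show "finite (?j ` ?C)" using \<open>finite ?C\<close> by (rule finite_imageI)
      show "{x. ?g x \<noteq> 0} \<subseteq> ?j ` ?C"
      proof
        fix x assume x: "x \<in> {x. ?g x \<noteq> 0}"
        obtain l k p c where kpc: "x = (l, k, p, c)" by (cases x)
        have 1: "int l + k + int p = - a" "- k - int c = - b" using x unfolding kpc by (auto split: if_splits)
        then have 2: "l = nat (int l)" "k = b - int c" "p = nat (int c - (a + b + int l))" "c = nat (int c)" "int c \<ge> a + b + int l" by auto
        have "?g x = W (int l) (int c)" unfolding kpc 2(2,3) using g[of "int l" "int c"] 2(5) by simp
        then have "W (int l) (int c) \<noteq> 0" using x by simp
        then have "int c \<le> L" using W0 by force
        then show "x \<in> ?j ` ?C" unfolding kpc using 2 by (intro image_eqI[of _ _ "(int l, int c)"]) auto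
      qed
    qed
    also have "sum ?g (?j ` ?C) = (\<Sum>(t, c)\<in>?C. W t c)"
      unfolding sum.reindex[OF \<open>inj_on ?j ?C\<close>] o_def by (rule sum.cong) (use g in auto)
    also have "\<dots> = (\<Sum>(t, c)\<in>{0..2 * \<bar>L\<bar> - a - b} \<times> {0..L}. W t c)"
      by (rule sum.mono_neutral_left) (auto intro: W0)
    finally show ?thesis by (simp only: sum.cartesian_product)
  qed
  have second: "Sum_any (\<lambda>(l :: nat, k :: int, p :: nat, c :: nat).
       if l \<ge> 1 \<and> k + int p = - a \<and> - int l - k - int c = - b
       then (inverse q * \<epsilon>) ^ l *s op_powi C (2 * k) (Km i p (EB j (m + int l) (Kp i c v))) else 0) =
     (\<Sum>t\<in>{m - L..- 1}. \<Sum>c\<in>{0..L}. W t c)"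
  proof -
    let ?g = "\<lambda>(l :: nat, k :: int, p :: nat, c :: nat).
       if l \<ge> 1 \<and> k + int p = - a \<and> - int l - k - int c = - b
       then (inverse q * \<epsilon>) ^ l *s op_powi C (2 * k) (Km i p (EB j (m + int l) (Kp i c v))) else 0"
    let ?C = "{(t, c) \<in> {m - L..- 1} \<times> {0..L}. c \<ge> a + b + t}"
    let ?j = "\<lambda>(t, c). (nat (- t), b + t - c, nat (c - (a + b + t)), nat c)"
    have g: "?g (nat (- t), b + t - c, nat (c - (a + b + t)), nat c) = W t c" if "t \<le> - 1" "c \<ge> 0" "c \<ge> a + b + t" for t c
    proof -
      have "?g (nat (- t), b + t - c, nat (c - (a + b + t)), nat c) =
          (inverse q * \<epsilon>) ^ nat (- t) *s q powi (b + t - c) *s KM i (nat (c - (a + b + t))) \<star> EB j (m - t) (KP i (nat c) \<star> v)"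
      proof -
        have "Suc 0 \<le> nat (- t)" using that by linarith
        then show ?thesis unfolding op using that by simp
      qed
      then show ?thesis using that pw'[of "nat (- t)" c] by (simp add: W_def zext_def)
    qed
    have "finite ?C" by (rule finite_subset[of _ "{m - L..- 1} \<times> {0..L}"]) auto
    have "inj_on ?j ?C" by (auto simp: inj_on_def)
    have "Sum_any ?g = sum ?g (?j ` ?C)"
    proof (rule Sum_any.expand_superset)
      show "finite (?j ` ?C)" using \<open>finite ?C\<close> by (rule finite_imageI)
      show "{x. ?g x \<noteq> 0} \<subseteq> ?j ` ?C"
      proof
        fix x assume x: "x \<in> {x. ?g x \<noteq> 0}"
        obtain l k p c where kpc: "x = (l, k, p, c)" by (cases x)
        have 1: "l \<ge> 1" "k + int p = - a" "- int l - k - int c = - b" using x unfolding kpc by (auto split: if_splits)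
        then have 2: "l = nat (- (- int l))" "k = b + (- int l) - int c" "p = nat (int c - (a + b + (- int l)))" "c = nat (int c)"
          "int c \<ge> a + b + (- int l)" "- int l \<le> - 1" by auto
        have "?g x = W (- int l) (int c)" unfolding kpc 2(2,3) using g[of "- int l" "int c"] 2(5,6) by simp
        then have "W (- int l) (int c) \<noteq> 0" using x by simp
        then have "int c \<le> L" "m - L \<le> - int l" using W0[of "int c" "- int l"] by force+
        then show "x \<in> ?j ` ?C" unfolding kpc using 2 by (intro image_eqI[of _ _ "(- int l, int c)"]) auto
      qed
    qed
    also have "sum ?g (?j ` ?C) = (\<Sum>(t, c)\<in>?C. W t c)"
      unfolding sum.reindex[OF \<open>inj_on ?j ?C\<close>] o_def by (rule sum.cong) (use g in auto)
    also have "\<dots> = (\<Sum>(t, c)\<in>{m - L..- 1} \<times> {0..L}. W t c)"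
      by (rule sum.mono_neutral_left) (auto intro: W0)
    finally show ?thesis by (simp only: sum.cartesian_product)
  qed
  define U where "U t = (\<Sum>c\<in>{0..L}. W t c)" for t
  let ?I = "{m - L..2 * \<bar>L\<bar> - a - b}"
  \<comment> \<open>below this range \<open>E\<^sub>j\<close> kills the vector, above it the index of \<open>K\<^sub>i\<^sup>-\<close> is negative\<close>
  have U0: "U t = 0" if "t < m - L \<or> t > L - a - b" for t
    unfolding U_def by (rule sum.neutral) (use that in \<open>auto intro!: W0\<close>)
  have "K.delta_KEK \<epsilon> i j a b m v = sum U {0..2 * \<bar>L\<bar> - a - b} + sum U {m - L..- 1}"
    unfolding K.delta_KEK_def first second U_def ..
  also have "sum U {0..2 * \<bar>L\<bar> - a - b} = sum U (?I \<inter> {0..})"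
    by (rule sum.mono_neutral_right) (auto intro!: U0)
  also have "sum U {m - L..- 1} = sum U (?I \<inter> {..-1})"
    by (rule sum.mono_neutral_right) (use lo in \<open>auto intro!: U0\<close>)
  also have "sum U (?I \<inter> {0..}) + sum U (?I \<inter> {..-1}) = sum U ?I"
  proof -
    have "sum U ((?I \<inter> {0..}) \<union> (?I \<inter> {..-1})) = sum U (?I \<inter> {0..}) + sum U (?I \<inter> {..-1})"
      by (rule sum.union_disjoint) auto
    moreover have "(?I \<inter> {0..}) \<union> (?I \<inter> {..-1}) = ?I" by auto
    ultimately show ?thesis by simp
  qed
  also have "\<dots> = (\<Sum>t\<in>?I. \<Sum>y\<in>{lo..L}. (kap * \<epsilon> powi (- t) * (q powi (b - y) * Qp.rho t)) *s NN i j ?T v (a + b + t - y) y)"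
  proof (rule sum.cong, rule refl)
    fix t assume t: "t \<in> ?I"
    have "U t = (\<Sum>c\<in>{0..L}. (kap * \<epsilon> powi (- t) * Qp.rho t * q powi b) *s q powi (- c) *s KMz i (c - (a + b + t)) \<star> EE j (m - t) (KPz i c \<star> v))"
      unfolding U_def
    proof (rule sum.cong, rule refl)
      fix c
      have "q powi (b - c) = q powi b * q powi (- c)" unfolding q_powi_add[symmetric] by simp
      then show "W t c = (kap * \<epsilon> powi (- t) * Qp.rho t * q powi b) *s q powi (- c) *s KMz i (c - (a + b + t)) \<star> EE j (m - t) (KPz i c \<star> v)"
        by (simp add: W_def EB_eq endo_apply_lin[OF linear_zext[OF linear_PM(4)]] mult_ac)
    qed
    also have "\<dots> = (kap * \<epsilon> powi (- t) * Qp.rho t * q powi b) *s (\<Sum>y\<in>{lo..L}. q powi (- y) *s ins i (a + b + t - y) (ins i y (EE j (m - t))) v)"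
      unfolding scale_sum_right[symmetric]
      by (rule arg_cong[OF ins_ins_diagonal[OF v lin_EE, symmetric]]) (use t lo in auto)
    also have "\<dots> = (\<Sum>y\<in>{lo..L}. (kap * \<epsilon> powi (- t) * (q powi (b - y) * Qp.rho t)) *s NN i j ?T v (a + b + t - y) y)"
      unfolding scale_sum_right
    proof (rule sum.cong, rule refl)
      fix y
      have "q powi (b - y) = q powi b * q powi (- y)" unfolding q_powi_add[symmetric] by simp
      moreover have "?T - (a + b + t - y) - y = m - t" by simp
      ultimately show "(kap * \<epsilon> powi (- t) * Qp.rho t * q powi b) *s q powi (- y) *s ins i (a + b + t - y) (ins i y (EE j (m - t))) v =
          (kap * \<epsilon> powi (- t) * (q powi (b - y) * Qp.rho t)) *s NN i j ?T v (a + b + t - y) y"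
        by (simp only: scale_scale mult_ac)
    qed
    finally show "U t = (\<Sum>y\<in>{lo..L}. (kap * \<epsilon> powi (- t) * (q powi (b - y) * Qp.rho t)) *s NN i j ?T v (a + b + t - y) y)" .
  qed
  also have "\<dots> = (\<Sum>y\<in>{lo..L}. \<Sum>t\<in>?I. (kap * \<epsilon> powi (- t) * (q powi (b - y) * Qp.rho t)) *s NN i j ?T v (a + b + t - y) y)"
    by (rule sum.swap)
  also have "\<dots> = (\<Sum>y\<in>{lo..L}. \<Sum>x\<in>{lo..L}. (kap * \<epsilon> powi (a + b - x - y) * (q powi (b - y) * Qp.rho (x + y - a - b))) *s NN i j ?T v x y)"
  proof (rule sum.cong, rule refl)
    fix y assume y: "y \<in> {lo..L}"
    show "(\<Sum>t\<in>?I. (kap * \<epsilon> powi (- t) * (q powi (b - y) * Qp.rho t)) *s NN i j ?T v (a + b + t - y) y) =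
      (\<Sum>x\<in>{lo..L}. (kap * \<epsilon> powi (a + b - x - y) * (q powi (b - y) * Qp.rho (x + y - a - b))) *s NN i j ?T v x y)"
    proof (rule sum_reindex_support[where j = "\<lambda>t. a + b + t - y" and i = "\<lambda>x. x + y - a - b"])
      fix t assume t: "t \<in> ?I" "(kap * \<epsilon> powi (- t) * (q powi (b - y) * Qp.rho t)) *s NN i j ?T v (a + b + t - y) y \<noteq> 0"
      have "NN i j ?T v (a + b + t - y) y \<noteq> 0" using t(2) by (simp only: scale_eq_0_iff de_Morgan_disj simp_thms)
      then have "\<not> a + b + t - y > L" using NN_vanishes[OF v, of "a + b + t - y" y ?T i j] by blast
      then show "a + b + t - y \<in> {lo..L}" using t(1) y lo by auto
    next
      fix x assume x: "x \<in> {lo..L}" "(kap * \<epsilon> powi (a + b - x - y) * (q powi (b - y) * Qp.rho (x + y - a - b))) *s NN i j ?T v x y \<noteq> 0"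
      have "NN i j ?T v x y \<noteq> 0" using x(2) by (simp only: scale_eq_0_iff de_Morgan_disj simp_thms)
      then have "\<not> ?T - x - y > L" using NN_vanishes[OF v, of x y ?T i j] by blast
      then show "x + y - a - b \<in> ?I" using x(1) y by auto
    next
      fix t
      have "a + b - (a + b + t - y) - y = - t" "a + b + t - y + y - a - b = t" by simp_all
      then show "(kap * \<epsilon> powi (a + b - (a + b + t - y) - y) * (q powi (b - y) * Qp.rho (a + b + t - y + y - a - b))) *s NN i j ?T v (a + b + t - y) y =
        (kap * \<epsilon> powi (- t) * (q powi (b - y) * Qp.rho t)) *s NN i j ?T v (a + b + t - y) y" by (simp only:)
    qed auto
  qed
  finally show ?thesis .
qed

lemma kap_cube: "kap^3 * ((q - 1)^2 / q) = kap"
proof -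
  have "(q - 1)^2 \<noteq> 0" using Qp.q_neq_1 by simp
  then have "kap^2 * ((q - 1)^2 / q) = 1" unfolding kap_square by simp
  then have "kap * (kap^2 * ((q - 1)^2 / q)) = kap" by simp
  then show ?thesis by (simp only: power3_eq_cube power2_eq_square mult.assoc)
qed

lemma EEE_symmetrized:
  "K.EEE i j a b m v + K.EEE i j b a m v = kap^3 *s (
    (EE i a (EE i b (EE j m v)) - (q + 1 / q) *s EE i a (EE j m (EE i b v)) + EE j m (EE i a (EE i b v))) +
    (EE i b (EE i a (EE j m v)) - (q + 1 / q) *s EE i b (EE j m (EE i a v)) + EE j m (EE i b (EE i a v))))"
proof -
  have EB3: "EB i1 m1 (EB i2 m2 (EB i3 m3 v)) = kap^3 *s EE i1 m1 (EE i2 m2 (EE i3 m3 v))" for i1 i2 i3 m1 m2 m3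
    by (simp add: EB_eq lin_simps[OF lin_EE] power3_eq_cube mult.assoc)
  have EEE: "K.EEE i j a b m v = kap^3 *s (EE i a (EE i b (EE j m v)) - q *s EE i a (EE j m (EE i b v))
      - inverse q *s EE i b (EE j m (EE i a v)) + EE j m (EE i b (EE i a v)))" for a b
  proof -
    have "K.EEE i j a b m v = EB i a (EB i b (EB j m v)) - q *s EB i a (EB j m (EB i b v))
      - inverse q *s (EB i b (EB j m (EB i a v)) - q *s EB j m (EB i b (EB i a v)))"
      by (simp add: K.EEE_def K.bracket_def lin_simps[OF lin_EB])
    also have "\<dots> = kap^3 *s (EE i a (EE i b (EE j m v)) - q *s EE i a (EE j m (EE i b v))
      - inverse q *s EE i b (EE j m (EE i a v)) + EE j m (EE i b (EE i a v)))"
      unfolding EB3 by (simp add: scale_right_distrib scale_right_diff_distrib mult_ac)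
    finally show ?thesis .
  qed
  have "(q + 1 / q) *s w = q *s w + inverse q *s w" for w :: 'v by (simp only: scale_left_distrib inverse_eq_divide)
  show ?thesis unfolding EEE scale_right_distrib[symmetric] \<open>\<And>w. (q + 1 / q) *s w = q *s w + inverse q *s w\<close>
    by (rule arg_cong[where f = "\<lambda>w. kap^3 *s w"]) (simp only: algebra_simps)
qed

text \<open>
  Both sides are expanded in the same normally ordered products, and \<open>cubic_delta\<close> compares the weights.
\<close>

lemma serre_relation:
  assumes nb: "neighbour \<epsilon> i j"
  shows "K.EEE i j a b m v + K.EEE i j b a m v = - (K.delta_KEK \<epsilon> i j a b m v + K.delta_KEK \<epsilon> i j b a m v)"
proof -
  obtain L where v: "bnd L v" using bnd_exists by blast
  define lo where "lo = - (\<bar>a\<bar> + \<bar>b\<bar> + \<bar>m\<bar> + 2 * \<bar>L\<bar>)"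
  define K where "K = nat (4 * (\<bar>lo\<bar> + \<bar>L\<bar> + \<bar>a\<bar> + \<bar>b\<bar> + \<bar>m\<bar>))"
  have lo: "lo \<le> a" "lo \<le> b" "lo \<le> m" "lo \<le> a + b - L" "lo \<le> a + m - L" "lo \<le> b + m - L" "lo \<le> a + b + m - 2 * L"
    "lo \<le> b + a - L" "lo \<le> b + a + m - 2 * L"
    unfolding lo_def by linarith+
  have K: "int K \<ge> 4 * (\<bar>lo\<bar> + \<bar>L\<bar> + \<bar>a\<bar> + \<bar>b\<bar> + \<bar>m\<bar>)" "int K \<ge> 4 * (\<bar>lo\<bar> + \<bar>L\<bar> + \<bar>b\<bar> + \<bar>a\<bar> + \<bar>m\<bar>)"
  proof -
    show K1: "int K \<ge> 4 * (\<bar>lo\<bar> + \<bar>L\<bar> + \<bar>a\<bar> + \<bar>b\<bar> + \<bar>m\<bar>)" by (simp add: K_def)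
    show "int K \<ge> 4 * (\<bar>lo\<bar> + \<bar>L\<bar> + \<bar>b\<bar> + \<bar>a\<bar> + \<bar>m\<bar>)" using K1 by (simp only: ac_simps)
  qed
  let ?B = "{lo..L}" and ?N = "NN i j (a + b + m) v"
  let ?e = "\<lambda>x y. \<epsilon> powi (a + b - x - y)" and ?r = "\<lambda>x y. Qp.rho (x + y - a - b)"
  have box_bound: "k \<ge> 2 * (u + w)" if "x \<le> l + c" "y \<le> l + c" "u \<le> x + a" "w \<le> y + b" "k \<ge> 4 * (l + c + a + b + m)"
      "l \<ge> 0" "c \<ge> 0" "a \<ge> 0" "b \<ge> 0" "m \<ge> 0" for k u w x y l c a b m :: int
    using that by simp
  have sw: "b + a + m = a + b + m" "\<And>x y. b + a - y - x = a + b - x - y" "\<And>x y. y + x - b - a = x + y - a - b" by simp_all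
  have S: "EE i b (EE i a (EE j m v)) - (q + 1 / q) *s EE i b (EE j m (EE i a v)) + EE j m (EE i b (EE i a v)) =
      (\<Sum>y\<in>?B. \<Sum>x\<in>?B. (?e x y * Qp.cubic K (y - b) (x - a)) *s ?N x y)"
    unfolding serre_combination[OF nb v lo(2,1,3,8,6,5,9) K(2)] sw(1) by (subst sum_symmetrize) (simp only: sw)
  have "K.EEE i j a b m v + K.EEE i j b a m v =
      (\<Sum>y\<in>?B. \<Sum>x\<in>?B. (kap^3 * (?e x y * (Qp.cubic K (x - a) (y - b) + Qp.cubic K (y - b) (x - a)))) *s ?N x y)"
    unfolding EEE_symmetrized S serre_combination[OF nb v lo(1-7) K(1)] sum.distrib[symmetric] scale_sum_right
      scale_left_distrib[symmetric] scale_scale distrib_left[symmetric] ..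
  also have "\<dots> = (\<Sum>y\<in>?B. \<Sum>x\<in>?B. (- (kap * ?e x y * (q powi (a - x) * ?r x y)) - kap * ?e x y * (q powi (b - y) * ?r x y)) *s ?N x y)"
  proof (intro sum.cong refl arg_cong[where f = "\<lambda>c. c *s _"])
    fix x y assume "x \<in> ?B" "y \<in> ?B"
    then have "\<bar>x\<bar> \<le> \<bar>lo\<bar> + \<bar>L\<bar>" "\<bar>y\<bar> \<le> \<bar>lo\<bar> + \<bar>L\<bar>" by auto
    then have "int K \<ge> 2 * (\<bar>x - a\<bar> + \<bar>y - b\<bar>)"
      by (rule box_bound[OF _ _ abs_triangle_ineq4 abs_triangle_ineq4 K(1)]) simp_all
    note cubic = Qp.cubic_delta[OF this]
    have eq: "x - a + (y - b) = x + y - a - b" "- (x - a) = a - x" "- (y - b) = b - y" by simp_all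
    have "kap^3 * (E * (- ((q - 1)^2 / q) * (X + Y) * r)) = - (kap * E * (X * r)) - kap * E * (Y * r)" for E X Y r
    proof -
      have "kap^3 * (E * (- ((q - 1)^2 / q) * (X + Y) * r)) = - ((kap^3 * ((q - 1)^2 / q)) * E * (X + Y) * r)" by (simp only: mult_ac mult_minus_left mult_minus_right)
      then show ?thesis unfolding kap_cube by (simp add: algebra_simps)
    qed
    then show "kap^3 * (?e x y * (Qp.cubic K (x - a) (y - b) + Qp.cubic K (y - b) (x - a))) =
        - (kap * ?e x y * (q powi (a - x) * ?r x y)) - kap * ?e x y * (q powi (b - y) * ?r x y)"
      unfolding cubic eq .
  qed
  also have "\<dots> = - ((\<Sum>y\<in>?B. \<Sum>x\<in>?B. (kap * ?e x y * (q powi (b - y) * ?r x y)) *s ?N x y)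
      + (\<Sum>y\<in>?B. \<Sum>x\<in>?B. (kap * ?e x y * (q powi (a - x) * ?r x y)) *s ?N x y))"
    by (simp add: scale_left_diff_distrib sum_subtractf sum_negf)
  also have "(\<Sum>y\<in>?B. \<Sum>x\<in>?B. (kap * ?e x y * (q powi (b - y) * ?r x y)) *s ?N x y) = K.delta_KEK \<epsilon> i j a b m v"
    by (rule delta_KEK_eq[OF nb v lo(4,7), symmetric])
  also have "(\<Sum>y\<in>?B. \<Sum>x\<in>?B. (kap * ?e x y * (q powi (a - x) * ?r x y)) *s ?N x y) = K.delta_KEK \<epsilon> i j b a m v"
    unfolding delta_KEK_eq[OF nb v lo(8,9)] sw(1) by (subst sum_symmetrize) (simp only: sw)
  finally show ?thesis .
qed

section \<open>The module structure and its admissibility\<close>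

text \<open>
  The exchange series is 1, so the product is already normally ordered.
\<close>

lemma EE_distant:
  assumes "j \<noteq> i" "j \<noteq> i + 1" "j \<noteq> i - 1"
  shows "EE i m (EE j n v) = ins j n (EE i m) v"
proof -
  obtain L where v: "bnd L v" using bnd_exists by blast
  have "EE i m (EE j n v) = (\<Sum>b\<in>{n..L}. if n = b then ins j b (EE i (m + n - b)) v else 0)"
    unfolding EE_EE[OF v order.refl] th_distant[OF assms] by (rule sum.cong) auto
  also have "\<dots> = ins j n (EE i m) v"
    using ins_vanishes[OF v lin_EE, of n j i m] by (simp add: sum.delta)
  finally show ?thesis .
qed

lemma E_E_distant: "i \<noteq> j \<Longrightarrow> i \<noteq> j + 1 \<Longrightarrow> i \<noteq> j - 1 \<Longrightarrow> EB i a (EB j b v) = EB j b (EB i a v)"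
proof -
  assume *: "i \<noteq> j" "i \<noteq> j + 1" "i \<noteq> j - 1"
  have ji: "j \<noteq> i" "j \<noteq> i + 1" "j \<noteq> i - 1" using * by auto
  show ?thesis
    unfolding EB_eq lin_simps(2)[OF lin_EE] EE_distant[OF ji] EE_distant[OF *] EE_swap[of j b i a] ..
qed

text \<open>
  Since \<open>P\<^sub>j\<close> contains only zero modes \<open>R\<^sub>j\<^sup>+\<close>, the factor comes from \<open>M\<^sub>j\<close> alone.
\<close>

lemma rp_PM: "rp i * P j a = P j a * rp i" "rp i * M j a = sc (root_factor qh i j) * (M j a * rp i)"
proof -
  show "rp i * P j a = P j a * rp i"
    unfolding P_def by (rule mult_commute2[symmetric]) (rule r_commute r_expser[symmetric])+
  have e: "rp i * S.expser (S.rescale tw (hY j)) $ a = S.expser (S.rescale tw (hY j)) $ a * rp i"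
    by (rule r_expser)
  have "rp i * (rm j * x) = sc (root_factor qh i j) * (rm j * x * rp i)" if "rp i * x = x * rp i" for x
  proof -
    have "rp i * (rm j * x) = sc (root_factor qh i j) * (rm j * (rp i * x))"
      by (simp only: mult.assoc[symmetric] r_commute(3))
    then show ?thesis unfolding that by (simp only: mult.assoc)
  qed
  from this[OF e] show "rp i * M j a = sc (root_factor qh i j) * (M j a * rp i)" unfolding M_def .
qed

lemma PM_rm: "P j a * rm i = sc (root_factor qh j i) * (rm i * P j a)" "M j a * rm i = rm i * M j a"
proof -
  show "M j a * rm i = rm i * M j a"
    unfolding M_def by (rule mult_commute2) (rule r_commute r_expser[symmetric])+
  have "rp j * x * rm i = sc (root_factor qh j i) * (rm i * (rp j * x))" if "rm i * x = x * rm i" for x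
  proof -
    have "rp j * x * rm i = rp j * rm i * x" by (simp only: mult.assoc that)
    then show ?thesis unfolding r_commute(3) by (simp only: mult.assoc)
  qed
  then show "P j a * rm i = sc (root_factor qh j i) * (rm i * P j a)" unfolding P_def by (blast intro: r_expser)
qed

lemma rp_EE: "rp i \<star> EE j m v = root_factor qh i j *s EE j m (rp i \<star> v)"
proof -
  obtain L1 L2 where L: "bnd L1 v" "bnd L2 (rp i \<star> v)" using bnd_exists by blast
  define L where "L = max L1 L2"
  have b: "bnd L v" "bnd L (rp i \<star> v)" using L by (auto simp: L_def intro: bnd_mono)
  have zM: "rp i \<star> Mz j k \<star> w = root_factor qh i j *s Mz j k \<star> rp i \<star> w" for k w
    using arg_cong[OF rp_PM(2)[of i j "nat k"], of "\<lambda>e. e \<star> w"]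
    by (cases "k < 0") (simp_all add: zext_def lin_simps[OF linear_R(1)])
  have zP: "rp i \<star> Pz j k \<star> w = Pz j k \<star> rp i \<star> w" for k w
    using arg_cong[OF zext_commute[of "rp i" "P j" k, OF rp_PM(1)], of "\<lambda>e. e \<star> w"] by simp
  show ?thesis
    unfolding ins_eq[OF b(1) lin_id order.refl] ins_eq[OF b(2) lin_id order.refl]
      endo_apply_lin(4)[OF linear_zero_mode(3)] zM zP scale_sum_right ..
qed

lemma EE_rm: "EE j m (rm i \<star> v) = root_factor qh j i *s rm i \<star> EE j m v"
proof -
  obtain L1 L2 where L: "bnd L1 v" "bnd L2 (rm i \<star> v)" using bnd_exists by blast
  define L where "L = max L1 L2"
  have b: "bnd L v" "bnd L (rm i \<star> v)" using L by (auto simp: L_def intro: bnd_mono)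
  have zP: "Pz j k \<star> rm i \<star> w = root_factor qh j i *s rm i \<star> Pz j k \<star> w" for k w
    using arg_cong[OF PM_rm(1)[of j "nat k" i], of "\<lambda>e. e \<star> w"]
    by (cases "k < 0") (simp_all add: zext_def lin_simps[OF linear_R(2)])
  have zM: "Mz j k \<star> rm i \<star> w = rm i \<star> Mz j k \<star> w" for k w
    using arg_cong[OF zext_commute[of "rm i" "M j" k, OF PM_rm(2)[symmetric]], of "\<lambda>e. e \<star> w"] by simp
  show ?thesis
    unfolding ins_eq[OF b(1) lin_id order.refl] ins_eq[OF b(2) lin_id order.refl]
      endo_apply_lin(4)[OF linear_zero_mode(4)] zP PMz_lin zM scale_sum_right ..
qed

lemma homog_zext: "(\<And>a. homog (f a) (s * int a)) \<Longrightarrow> homog (zext f c) (s * c)"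
  by (cases "c < 0") (auto simp: zext_def homog_0 dest: spec[of _ "nat c"] meta_spec[of _ "nat c"])

lemma EB_comp: assumes v: "v \<in> comp k" shows "EB i m v \<in> comp (k + m)"
proof -
  obtain L where L: "bnd L v" using bnd_exists by blast
  have "homog (Mz i (c - m)) ((-1) * (c - m))" "homog (Pz i c) (1 * c)" for c
    using homog_PM by (intro homog_zext; simp)+
  then have "homog (Mz i (c - m) * Pz i c) ((-1) * (c - m) + 1 * c)" for c by (intro homog_mult)
  then have "homog (Mz i (c - m) * Pz i c) m" for c by simp
  then have "(Mz i (c - m) * Pz i c) \<star> v \<in> comp (k + m)" for c using v unfolding homog_def by blast
  then have "Mz i (c - m) \<star> Pz i c \<star> v \<in> comp (k + m)" for c by simp
  then show ?thesis unfolding EB_eq ins_eq[OF L lin_id order.refl]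
    by (intro subspace_scale[OF subspace_comp] subspace_sum[OF subspace_comp])
qed

lemma K_gens_props:
  assumes "x \<in> K.K_gens" shows "lin (snd x)" "v \<in> comp k \<Longrightarrow> snd x v \<in> comp (k + fst x)"
proof -
  have x: "x \<in> H_gens \<or> (\<exists>i m. x = (m, EB i m))" using assms unfolding K.K_gens_def by auto
  show "lin (snd x)" using x linear_H_gens[of x] lin_EB by auto
  show "v \<in> comp k \<Longrightarrow> snd x v \<in> comp (k + fst x)" using x H_gens_comp EB_comp by fastforce
qed

text \<open>
  Monomials in all generators are homogeneous operators, so the bound \<open>bnd\<close> applies to them.
\<close>

lemma K_monomial_homog:
  "xs \<in> lists K.K_gens \<Longrightarrow> lin (foldr (\<lambda>x. snd x) xs) \<and> homog (endo_of (foldr (\<lambda>x. snd x) xs)) (sum_list (map fst xs))"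
proof (induction xs)
  case Nil
  have "endo_apply (endo_of (\<lambda>v. v)) u = u" for u using endo_apply_linear[OF lin_id] by simp
  then show ?case using lin_id linear_endo_of[OF lin_id] by (simp add: homog_def id_def)
next
  case (Cons x xs)
  let ?F = "foldr (\<lambda>x. snd x) xs"
  have x: "x \<in> K.K_gens" and F: "lin ?F" "homog (endo_of ?F) (sum_list (map fst xs))" using Cons by auto
  have lin: "lin (\<lambda>u. snd x (?F u))" by (rule lin_comp[OF K_gens_props(1)[OF x] F(1)])
  have "snd x (?F v) \<in> comp (k + (fst x + sum_list (map fst xs)))" if "v \<in> comp k" for k v
  proof -
    have "?F v \<in> comp (k + sum_list (map fst xs))"
      using F that unfolding homog_def by (simp add: endo_apply_linear)
    from K_gens_props(2)[OF x this] show ?thesis by (simp add: ac_simps)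
  qed
  then have "homog (endo_of (\<lambda>u. snd x (?F u))) (fst x + sum_list (map fst xs))"
    unfolding homog_def using linear_endo_of[OF lin] by (simp add: endo_apply_linear[OF lin])
  then show ?case using lin by (simp add: o_def)
qed

lemma continuous_K: "continuous_action K.K_gens"
  unfolding continuous_action_def
proof
  fix v
  obtain L where L: "bnd L v" using bnd_exists by blast
  have "foldr (\<lambda>x. snd x) xs v = 0" if xs: "xs \<in> lists K.K_gens" "sum_list (map fst xs) \<ge> L + 1" for xs
  proof -
    have "endo_apply (endo_of (foldr (\<lambda>x. snd x) xs)) v = 0"
      using L K_monomial_homog[OF xs(1)] xs(2) unfolding bnd_def by auto
    then show ?thesis using endo_apply_linear[of "foldr (\<lambda>x. snd x) xs"] K_monomial_homog[OF xs(1)] by simp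
  qed
  then show "\<exists>N. \<forall>xs\<in>lists K.K_gens. N \<le> sum_list (map fst xs) \<longrightarrow> foldr (\<lambda>x. snd x) xs v = 0" by blast
qed

lemma boundary_action_K_module: "K_module scale qh dh C K0p K0m Rp Rm H EB"
proof (intro K_module.intro K_module_axioms.intro)
  show "heisenberg_module scale qh dh C K0p K0m Rp Rm H" by (rule heisenberg_module_axioms)
  show "K_data scale" by (rule K.K_data_axioms)
  show "lin (EB i k)" for i k by (rule lin_EB)
  show "continuous_action K.K_gens" by (rule continuous_K)
  show "C (EB i k v) = EB i k (C v)" for i k v by (simp add: C_eq lin_simps[OF lin_EB])
  show "Kp i a (EB j m v) = (\<Sum>l\<le>a. (G_series q d i j $ l) *s EB j (m + int l) (Kp i (a - l) v))" for i j a m v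
    by (simp add: EB_eq Kp_KP endo_apply_lin[OF linear_PM(3)] KP_EE scale_sum_right mult.commute)
  show "EB j m (Km i b v) = (\<Sum>l\<le>b. (G_series q d j i $ l) *s Km i (b - l) (EB j (m - int l) v))" for i j b m v
    by (simp add: EB_eq Km_KM endo_apply_lin[OF linear_PM(4)] EE_KM scale_sum_right mult.commute)
  show "Rp i (EB j m v) = root_factor qh i j *s EB j m (Rp i v)" for i j m v
    using rp_EE[of i j m v] by (simp add: EB_eq lin_simps[OF linear_R(1)] mult.commute)
  show "EB j m (Rm i v) = root_factor qh j i *s Rm i (EB j m v)" for i j m v
    using EE_rm[of j m i v] by (simp add: EB_eq lin_simps[OF linear_R(2)] mult.commute)
  show "d_coeff d i j *s (EB i (a + 1) (EB j b v) - g_root q d i j *s EB i a (EB j (b + 1) v))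
      + (EB j (b + 1) (EB i a v) - g_root q d j i *s EB j b (EB i (a + 1) v)) =
      (if i = j then inverse (q - inverse q) *s
         ((K.delta_KK i (a + 1) b v - g_root q d i i *s K.delta_KK i a (b + 1) v)
          + (K.delta_KK i (b + 1) a v - g_root q d i i *s K.delta_KK i b (a + 1) v))
       else 0)" for i j a b v
    by (rule E_E_relation)
  show "EB i a (EB j b v) = EB j b (EB i a v)" if "i \<noteq> j" "i \<noteq> j + 1" "i \<noteq> j - 1" for i j a b v
    by (rule E_E_distant[OF that])
  show "(1/2) *s (K.EEE i j a b m v + K.EEE i j b a m v) =
      - ((1/2) *s (K.delta_KEK \<epsilon> i j a b m v + K.delta_KEK \<epsilon> i j b a m v))"
    if "(j, \<epsilon>) \<in> {(i + 1, d), (i - 1, inverse d)}" for i j \<epsilon> a b m v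
  proof -
    have "neighbour \<epsilon> i j" using that by (auto simp: neighbour_def)
    from serre_relation[OF this] show ?thesis by (simp only: scale_minus_right)
  qed
qed

lemma boundary_action_admissible: "admissible_K_module scale qh dh C K0p K0m Rp Rm H EB"
proof (intro admissible_K_module.intro admissible_K_module_axioms.intro)
  show "K_module scale qh dh C K0p K0m Rp Rm H EB" by (rule boundary_action_K_module)
  have "{v. \<exists>c. C v = c *s v} = UNIV" using C_eq by auto
  then show "diagonalizable C" unfolding diagonalizable_def by simp
  have "\<forall>(r, f)\<in>K.K_gens. \<forall>k. f ` comp k \<subseteq> comp (k + r)" using K_gens_props(2) by fastforce
  then show "\<exists>V N. is_grading V \<and> (\<forall>(r, f)\<in>K.K_gens. \<forall>k. f ` V k \<subseteq> V (k + r)) \<and>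
      (\<forall>k>N. V k = {0}) \<and> (\<forall>k. finite_over_zero_modes (V k))"
    using is_grading_comp comp_positive finite_comp by (intro exI[of _ comp] exI[of _ 0]) blast
qed

end

theorem lemma3p6:
  fixes scale :: "complex \<Rightarrow> 'v::ab_group_add \<Rightarrow> 'v"
    and qh dh :: complex
    and C :: "'v \<Rightarrow> 'v"
    and K0p K0m Rp Rm :: "'n::nontriv mod_ring \<Rightarrow> 'v \<Rightarrow> 'v"
    and H :: "'n mod_ring \<Rightarrow> int \<Rightarrow> 'v \<Rightarrow> 'v"
    and Ktp Ktm :: "'n mod_ring \<Rightarrow> nat \<Rightarrow> 'v \<Rightarrow> 'v"
  assumes "CARD('n) \<ge> 3"
    and "generic_parameters qh dh"
    and "heisenberg_module scale qh dh C K0p K0m Rp Rm H"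
    and "heisenberg_data.irreducible_H_module scale C K0p K0m Rp Rm H"
    and "\<And>v. C v = scale qh v"
    and "\<And>i. is_tilde scale (inverse (qh^2)) (Rp i) (heisenberg_data.Kp scale qh K0p H i) (Ktp i)"
    and "\<And>i. is_tilde scale (qh^2) (Rm i) (heisenberg_data.Km scale qh K0m H i) (Ktm i)"
  shows "admissible_K_module scale qh dh C K0p K0m Rp Rm H (boundary_E scale qh Ktp Ktm)"
proof -
  have "boundary_module scale qh dh C K0p K0m Rp Rm H Ktp Ktm"
    by (intro boundary_module.intro boundary_module_axioms.intro) (rule assms)+
  then show ?thesis by (rule boundary_module.boundary_action_admissible)
qed

end
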